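(* Let $G$ be a $3$-dicritical digraph. If $G$ is not a symmetric cycle of odd length, then \[\lvert A(G)\rvert = 2\lvert V(G)\rvert + 1\] if and only if $G \in \mathcal D'_3$, and otherwise \[\lvert A(G)\rvert \geq 2\lvert V(G)\rvert + 2.\]
   Context: A digraph $G$ is $3$-dicritical if its vertex set cannot be partitioned into two sets inducing acyclic subdigraphs but every proper subdigraph can. A symmetric path/cycle is a path/cycle with every edge replaced by a digon. An extended wheel is a digraph made of a vertex $x$ and a directed triangle $abca$ together with three symmetric paths whose lengths have the same parity, linking $x$ with $a$, $b$ and $c$ respectively, the three paths having only $x$ in common; one of the paths may have length $0$ (i.e. $x$ equals one of $a,b,c$), in which case the other two have even length. Let $F$ be the digraph on vertices $x,y,z,u,w$ with digons $xz$, $yz$, $uw$ and simple arcs $xy$, $yw$, $yu$, $wx$, $ux$. $\mathcal D'_3$ is the set consisting of all extended wheels and all digraphs obtained from $F$ by replacing each digon by a symmetric path of odd length. *)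

theory Defs
  imports "Graph_Theory.Graph_Theory"
begin

text \<open>
  Finite digraphs without loops and parallel arcs (digons are allowed) are the
  \<^locale>\<open>pair_digraph\<close>s of the Graph Theory entry. Its notion of cycle is that of a
  directed cycle; in particular a digon is a cycle of length 2.
\<close>

definition acyclic_digraph :: "('a, 'b) pre_digraph \<Rightarrow> bool" where
  "acyclic_digraph D \<longleftrightarrow> \<not> (\<exists>p. pre_digraph.cycle D p)"

text \<open>The two parts may be empty, as usual for colourings.\<close>

definition two_dicolourable :: "'a pair_pre_digraph \<Rightarrow> bool" where
  "two_dicolourable G \<longleftrightarrow>
     (\<exists>X Y. X \<union> Y = pverts G \<and> X \<inter> Y = {} \<and>
            acyclic_digraph (with_proj G \<restriction> X) \<and> acyclic_digraph (with_proj G \<restriction> Y))"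

definition three_dicritical :: "'a pair_pre_digraph \<Rightarrow> bool" where
  "three_dicritical G \<longleftrightarrow>
     \<not> two_dicolourable G \<and>
     (\<forall>H :: 'a pair_pre_digraph.
        subgraph (with_proj H) (with_proj G) \<and> H \<noteq> G \<longrightarrow> two_dicolourable H)"

text \<open>
  Undirected paths are given by their vertex sequences. The length is the number of
  edges, so a path of length 0 is a one-element list.
\<close>

definition path_between :: "'a \<Rightarrow> 'a list \<Rightarrow> 'a \<Rightarrow> bool" where
  "path_between u p v \<longleftrightarrow> p \<noteq> [] \<and> hd p = u \<and> last p = v \<and> distinct p"

definition sym_arcs :: "'a list \<Rightarrow> ('a \<times> 'a) set" where
  "sym_arcs p = set (vwalk_arcs p) \<union> (set (vwalk_arcs p))\<inverse>"

text \<open>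
  A cycle is the vertex sequence of a path together with the edge joining its two ends;
  its length is the number of vertices.
\<close>

definition symmetric_odd_cycle :: "'a pair_pre_digraph \<Rightarrow> bool" where
  "symmetric_odd_cycle G \<longleftrightarrow>
     (\<exists>c. distinct c \<and> length c \<ge> 3 \<and> odd (length c) \<and>
          pverts G = set c \<and> parcs G = sym_arcs (c @ [hd c]))"

text \<open>
  At most one of the three paths below can have length 0, since the triangle has distinct
  vertices; in that case the parity condition makes the other two lengths even.
\<close>

definition extended_wheel :: "'a pair_pre_digraph \<Rightarrow> bool" where
  "extended_wheel G \<longleftrightarrow>
     (\<exists>x a b c P Q R.
        distinct [a, b, c] \<and>
        path_between x P a \<and> path_between x Q b \<and> path_between x R c \<and>
        set P \<inter> set Q = {x} \<and> set P \<inter> set R = {x} \<and> set Q \<inter> set R = {x} \<and>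
        even (vwalk_length P) = even (vwalk_length Q) \<and>
        even (vwalk_length Q) = even (vwalk_length R) \<and>
        pverts G = set P \<union> set Q \<union> set R \<and>
        parcs G = {(a, b), (b, c), (c, a)} \<union> sym_arcs P \<union> sym_arcs Q \<union> sym_arcs R)"

text \<open>
  The digons \<open>xz\<close>, \<open>yz\<close>, \<open>uw\<close> of the digraph \<open>F\<close> are replaced by the paths \<open>P\<close>, \<open>Q\<close>, \<open>R\<close>, whose
  inner vertices are new; \<open>F\<close> itself is the case where all three lengths are 1. Odd lengths
  are positive, so \<open>x\<close>, \<open>y\<close>, \<open>z\<close>, \<open>u\<close>, \<open>w\<close> are automatically distinct.
\<close>

definition F_expansion :: "'a pair_pre_digraph \<Rightarrow> bool" where
  "F_expansion G \<longleftrightarrow>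
     (\<exists>x y z u w P Q R.
        path_between x P z \<and> path_between y Q z \<and> path_between u R w \<and>
        odd (vwalk_length P) \<and> odd (vwalk_length Q) \<and> odd (vwalk_length R) \<and>
        set P \<inter> set Q = {z} \<and> set P \<inter> set R = {} \<and> set Q \<inter> set R = {} \<and>
        pverts G = set P \<union> set Q \<union> set R \<and>
        parcs G = {(x, y), (y, w), (y, u), (w, x), (u, x)}
                    \<union> sym_arcs P \<union> sym_arcs Q \<union> sym_arcs R)"

definition D3' :: "'a pair_pre_digraph set" where
  "D3' = {G. extended_wheel G \<or> F_expansion G}"

end

theory Submission
  imports Defs
begin

text \<open>
  In a 3-dicritical digraph all in- and out-degrees are at least 2. If there are at most \<open>2n + 1\<close>
  arcs, then at most one vertex has out-degree 3, at most one has in-degree 3, and all other vertices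
  are low, with both degrees equal to 2. Delete a vertex \<open>h\<close> and 2-colour the rest. If \<open>h\<close> is low, its two
  out-neighbours have different colours, and so have its two in-neighbours; hence \<open>h\<close> can take the
  colour of any neighbour \<open>p\<close>, leaving \<open>p\<close> uncoloured. Moving this hole around a chordless cycle
  rotates the colours along it, which forces the cycle to be a directed cycle of simple arcs (or
  an odd symmetric cycle, which cannot occur), and moving it along a path that leaves the cycle and
  comes back to it elsewhere gives a contradiction. So a connected set \<open>S\<close> of low vertices is built
  from digons, single arcs and directed cycles in a tree-like way and spans at most \<open>2|S| - 2\<close> arcs,
  with equality only for symmetric paths; the sets with \<open>2|S| - 3\<close> arcs are classified in the same way.
  With one exceptional vertex \<open>x\<close> the rest is such a set, and \<open>G\<close> is an extended wheel. With two
  exceptional vertices the rest splits into exactly two symmetric paths, and \<open>G\<close> is an expansion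
  of \<open>F\<close>. The parities come from alternating colourings of the paths.
\<close>

section \<open>Digraphs as arc sets\<close>

text \<open>On a cycle with k vertices the hole is back after k moves, while the colours of the
  other k - 1 vertices, read as a cyclic word, have turned by one place. So each position of the
  hole can be combined with each offset of the word. The two out-neighbours of a hole of out-degree
  2 differ in colour, so the word must be constant if exactly one of them is on the cycle and
  alternating if both are; likewise for in-neighbours.

  A move needs degree 2 on one side only. This matters because, with two exceptional vertices, the
  one of out-degree 2 and in-degree 3 must be analysed like a low vertex. Reversing all arcs then
  gives the dual statements.

  The arc bound controls the number of components: 2|K| arcs start in a component K of low vertices
  and at most 2|K| - 2 stay inside, so at least two enter exceptional vertices. The in-degrees of
  these sum to at most 3 (one exceptional vertex) or 5 (two of them), which leaves room for one
  component or two.\<close>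

definition mono_arcs :: "('a \<times> 'a) set \<Rightarrow> ('a \<Rightarrow> bool) \<Rightarrow> ('a \<times> 'a) set" where
  "mono_arcs A f = {(u, w) \<in> A. f u = f w}"

text \<open>\<open>cycle\<close> forbids repeated vertices, whereas \<open>acyclic\<close> speaks of
  arbitrary closed walks; the bridge is that every closed walk contains a cycle.\<close>

lemma acyclic_restriction_iff:
  assumes "pair_wf_digraph G" "X \<subseteq> pverts G"
  shows "acyclic_digraph (with_proj G \<restriction> X) \<longleftrightarrow> acyclic (parcs G \<inter> X \<times> X)"
proof -
  let ?H = "with_proj G \<restriction> X"
  interpret H: wf_digraph ?H
    by unfold_locales (auto simp: induce_subgraph_def)
  have ends: "arcs_ends ?H = parcs G \<inter> X \<times> X"
    by (force simp: arcs_ends_def induce_subgraph_def arc_to_ends_def with_proj_def)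
  have "(\<exists>p. H.cycle p) \<longleftrightarrow> (\<exists>p. H.closed_w p)"
    using H.closed_w_imp_cycle unfolding H.cycle_altdef by blast
  also have "\<dots> \<longleftrightarrow> (\<exists>u. u \<rightarrow>\<^sup>+\<^bsub>?H\<^esub> u)"
    unfolding H.closed_w_def H.reachable1_awalk by blast
  finally show ?thesis
    unfolding acyclic_digraph_def acyclic_def ends by simp
qed

text \<open>A walk along monochromatic arcs never changes colour. This is why the acyclicity of both
  colour classes can be expressed as acyclicity of the single relation
  \<open>mono_arcs A f\<close>.\<close>

lemma mono_trancl_same:
  assumes "(x, y) \<in> (mono_arcs A f)\<^sup>+"
  shows "f x = f y" and "(x, y) \<in> (A \<inter> {z. f z = f x} \<times> {z. f z = f x})\<^sup>+"
proof -
  have "f x = f y \<and> (x, y) \<in> (A \<inter> {z. f z = f x} \<times> {z. f z = f x})\<^sup>+"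
    using assms
  proof induction
    case (base y) then show ?case by (auto simp: mono_arcs_def)
  next
    case (step y z)
    then have "(y, z) \<in> A \<inter> {z. f z = f x} \<times> {z. f z = f x}" by (auto simp: mono_arcs_def)
    with step show ?case by (auto intro: trancl_into_trancl)
  qed
  then show "f x = f y" "(x, y) \<in> (A \<inter> {z. f z = f x} \<times> {z. f z = f x})\<^sup>+" by auto
qed

lemma two_dicolourable_iff:
  assumes "pair_wf_digraph G"
  shows "two_dicolourable G \<longleftrightarrow> (\<exists>f. acyclic (mono_arcs (parcs G) f))"
proof
  interpret pair_wf_digraph G by fact
  assume "two_dicolourable G"
  then obtain X Y where XY: "X \<union> Y = pverts G" "X \<inter> Y = {}"
    "acyclic_digraph (with_proj G \<restriction> X)" "acyclic_digraph (with_proj G \<restriction> Y)"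
    unfolding two_dicolourable_def by blast
  then have ac: "acyclic (parcs G \<inter> X \<times> X)" "acyclic (parcs G \<inter> Y \<times> Y)"
    using acyclic_restriction_iff[OF assms] by auto
  define f where "f = (\<lambda>v. v \<in> X)"
  have "(x, x) \<notin> (mono_arcs (parcs G) f)\<^sup>+" for x
  proof
    assume "(x, x) \<in> (mono_arcs (parcs G) f)\<^sup>+"
    from mono_trancl_same(2)[OF this]
    have *: "(x, x) \<in> (parcs G \<inter> {z. f z = f x} \<times> {z. f z = f x})\<^sup>+" .
    have "parcs G \<inter> {z. f z = f x} \<times> {z. f z = f x} \<subseteq> parcs G \<inter> (if x \<in> X then X \<times> X else Y \<times> Y)"
      using XY(1) in_arcsD1 in_arcsD2 by (auto simp: f_def)
    from trancl_mono[OF * this] ac show False by (auto simp: acyclic_def split: if_splits)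
  qed
  then show "\<exists>f. acyclic (mono_arcs (parcs G) f)" unfolding acyclic_def by blast
next
  assume "\<exists>f. acyclic (mono_arcs (parcs G) f)"
  then obtain f where f: "acyclic (mono_arcs (parcs G) f)" by blast
  let ?X = "{v \<in> pverts G. f v}" and ?Y = "{v \<in> pverts G. \<not> f v}"
  have "acyclic (parcs G \<inter> ?X \<times> ?X)" "acyclic (parcs G \<inter> ?Y \<times> ?Y)"
    by (rule acyclic_subset[OF f], force simp: mono_arcs_def)+
  then have "acyclic_digraph (with_proj G \<restriction> ?X)" "acyclic_digraph (with_proj G \<restriction> ?Y)"
    using acyclic_restriction_iff[OF assms] by auto
  then show "two_dicolourable G"
    unfolding two_dicolourable_def by (intro exI[of _ ?X] exI[of _ ?Y]) auto
qed

text \<open>A vertex without outgoing arcs lies on no cycle, so arcs into it are harmless. With its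
  dual this is how colourings are extended to a hole or changed by a move.\<close>

lemma acyclic_add_sink:
  assumes "acyclic r" "r' \<subseteq> r \<union> UNIV \<times> {h}" "h \<notin> Domain r'"
  shows "acyclic r'"
proof -
  have "(x, y) \<in> r\<^sup>+ \<or> y = h" if "(x, y) \<in> r'\<^sup>+" for x y
    using that
  proof induction
    case (base y) then show ?case using assms(2) by blast
  next
    case (step y z)
    then have "y \<noteq> h" using assms(3) by blast
    with step assms(2) show ?case by (auto intro: trancl_into_trancl)
  qed
  moreover have "x \<noteq> h" if "(x, x) \<in> r'\<^sup>+" for x
    using that assms(3) by (metis Domain.DomainI tranclD)
  ultimately show ?thesis using assms(1) unfolding acyclic_def by blast
qed

lemma acyclic_add_source:
  assumes "acyclic r" "r' \<subseteq> r \<union> {h} \<times> UNIV" "h \<notin> Range r'"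
  shows "acyclic r'"
proof -
  have "acyclic (r'\<inverse>)"
    by (rule acyclic_add_sink[of "r\<inverse>" _ h]) (use assms in auto)
  then show ?thesis by simp
qed

subsection \<open>Symmetric paths\<close>

lemma sym_arcs_Nil [simp]: "sym_arcs [] = {}"
  and sym_arcs_single [simp]: "sym_arcs [x] = {}"
  and sym_arcs_Cons_Cons [simp]:
    "sym_arcs (x # y # p) = {(x, y), (y, x)} \<union> sym_arcs (y # p)"
  by (auto simp: sym_arcs_def)

lemma sym_arcs_sym: "(u, w) \<in> sym_arcs p \<longleftrightarrow> (w, u) \<in> sym_arcs p"
  by (auto simp: sym_arcs_def)

lemma sym_arcs_Cons: "p \<noteq> [] \<Longrightarrow> sym_arcs (x # p) = {(x, hd p), (hd p, x)} \<union> sym_arcs p"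
  by (cases p) auto

lemma sym_arcs_append:
  "p \<noteq> [] \<Longrightarrow> q \<noteq> [] \<Longrightarrow>
     sym_arcs (p @ q) = sym_arcs p \<union> sym_arcs q \<union> {(last p, hd q), (hd q, last p)}"
  by (auto simp: sym_arcs_def vwalk_arcs_append)

lemma sym_arcs_rev [simp]: "sym_arcs (rev p) = sym_arcs p"
proof (induction p)
  case (Cons x p)
  then show ?case
    by (cases "p = []") (auto simp: sym_arcs_append sym_arcs_Cons last_rev)
qed simp

lemma sym_arcs_subset: "sym_arcs p \<subseteq> set p \<times> set p"
proof (induction p)
  case (Cons x p) then show ?case by (cases "p = []") (auto simp: sym_arcs_Cons)
qed simp

lemma sym_arcs_in_set: "(u, w) \<in> sym_arcs p \<Longrightarrow> u \<in> set p \<and> w \<in> set p"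
  using sym_arcs_subset by blast

lemma finite_sym_arcs [simp]: "finite (sym_arcs p)"
  by (simp add: sym_arcs_def)

lemma sym_arcs_neq: "distinct p \<Longrightarrow> (u, w) \<in> sym_arcs p \<Longrightarrow> u \<noteq> w"
proof (induction p)
  case (Cons x p) then show ?case by (cases p) auto
qed simp

lemma card_sym_arcs: "distinct p \<Longrightarrow> p \<noteq> [] \<Longrightarrow> card (sym_arcs p) + 2 = 2 * length p"
proof (induction p)
  case (Cons x p)
  show ?case
  proof (cases "p = []")
    case False
    have "(x, hd p) \<notin> sym_arcs p" "(hd p, x) \<notin> sym_arcs p" "x \<noteq> hd p"
      using Cons.prems False by (auto dest: sym_arcs_in_set)
    then have "card (sym_arcs (x # p)) = 2 + card (sym_arcs p)"
      using False by (simp add: sym_arcs_Cons)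
    with Cons False show ?thesis by simp
  qed simp
qed simp

lemma hd_in_sym_arcs_iff:
  assumes "distinct (x # p)"
  shows "(x, w) \<in> sym_arcs (x # p) \<longleftrightarrow> p \<noteq> [] \<and> w = hd p"
  using assms by (cases p) (auto dest: sym_arcs_in_set)

text \<open>Here \<open>length p\<close> counts vertices: an odd value means an even number of
  edges, hence ends of equal colour.\<close>

lemma alternating_colouring:
  assumes "distinct p" "p \<noteq> []"
  shows "\<exists>f::'a \<Rightarrow> bool. f (hd p) = b \<and> (\<forall>(u, w) \<in> sym_arcs p. f u \<noteq> f w) \<and>
           (f (last p) = b \<longleftrightarrow> odd (length p))"
  using assms
proof (induction p arbitrary: b)
  case (Cons x p)
  show ?case
  proof (cases "p = []")
    case False
    with Cons obtain f where f: "f (hd p) = (\<not> b)" "\<forall>(u, w) \<in> sym_arcs p. f u \<noteq> f w"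
      "f (last p) = (\<not> b) \<longleftrightarrow> odd (length p)" by (metis distinct.simps(2))
    have "x \<notin> set p" using Cons.prems by simp
    moreover have "hd p \<noteq> x" "last p \<noteq> x" using False \<open>x \<notin> set p\<close> by auto
    ultimately show ?thesis using f False
      by (intro exI[of _ "f(x := b)"]) (auto simp: sym_arcs_Cons dest: sym_arcs_in_set)
  qed (use Cons.prems in auto)
qed simp

lemma colouring_last:
  fixes f :: "'a \<Rightarrow> bool"
  assumes "\<forall>(u, w) \<in> sym_arcs p. f u \<noteq> f w" "p \<noteq> []"
  shows "f (last p) = f (hd p) \<longleftrightarrow> odd (length p)"
  using assms
proof (induction p)
  case (Cons x p)
  show ?case
  proof (cases "p = []")
    case False
    then have "\<forall>(u, w) \<in> sym_arcs p. f u \<noteq> f w" "f x \<noteq> f (hd p)"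
      using Cons.prems(1) unfolding sym_arcs_Cons[OF False] by blast+
    then show ?thesis using False Cons.IH by simp blast
  qed simp
qed simp

lemma acyclic_mono_digon:
  assumes "acyclic (mono_arcs A f)" "(u, w) \<in> A" "(w, u) \<in> A"
  shows "f u \<noteq> f w"
proof
  assume "f u = f w"
  then have "(u, w) \<in> mono_arcs A f" "(w, u) \<in> mono_arcs A f"
    using assms(2,3) by (auto simp: mono_arcs_def)
  then have "(u, u) \<in> (mono_arcs A f)\<^sup>+" by (meson trancl.simps)
  with assms(1) show False by (simp add: acyclic_def)
qed

text \<open>The closed list \<open>c @ [hd c]\<close> has even length, so a colouring that
  alternates along it would give \<open>hd c\<close> two colours.\<close>

lemma odd_cycle_not_colourable:
  assumes "c \<noteq> []" "odd (length c)" "sym_arcs (c @ [hd c]) \<subseteq> A"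
  shows "\<not> acyclic (mono_arcs A f)"
proof
  assume ac: "acyclic (mono_arcs A f)"
  have "\<forall>(u, w) \<in> sym_arcs (c @ [hd c]). f u \<noteq> f w"
    using acyclic_mono_digon[OF ac] assms(3) sym_arcs_sym by fast
  from colouring_last[OF this] assms show False by simp
qed

section \<open>Moving the uncoloured vertex\<close>

lemma card_2_other:
  assumes "card S = 2" "p \<in> S"
  obtains q where "S = {p, q}" "q \<noteq> p"
  using assms by (auto simp: card_2_iff insert_commute)

text \<open>The form in which criticality enters: colourability after deleting a vertex, and the
  absence of odd symmetric cycles, which would be proper subdigraphs without a colouring. Working
  with bare sets \<open>V\<close> and \<open>A\<close> makes the reversed digraph another
  instance.\<close>

locale dicrit =
  fixes V :: "'a set" and A :: "('a \<times> 'a) set"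
  assumes finite_V: "finite V"
    and A_subset: "A \<subseteq> V \<times> V"
    and loopfree: "(v, v) \<notin> A"
    and not_colourable: "\<not> acyclic (mono_arcs A f)"
    and vertex_critical: "v \<in> V \<Longrightarrow> \<exists>f. acyclic (mono_arcs (A \<inter> (- {v}) \<times> (- {v})) f)"
    and no_odd_cycle: "distinct c \<Longrightarrow> length c \<ge> 3 \<Longrightarrow> odd (length c) \<Longrightarrow> \<not> sym_arcs (c @ [hd c]) \<subseteq> A"

lemma mono_arcs_converse: "mono_arcs (A\<inverse>) f = (mono_arcs A f)\<inverse>"
  by (auto simp: mono_arcs_def)

text \<open>Directed cycles, colourings and symmetric cycles survive reversal. This is the source of
  all in/out dualities below.\<close>

lemma dicrit_converse:
  assumes "dicrit V A"
  shows "dicrit V (A\<inverse>)"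
proof -
  interpret dicrit V A by fact
  show ?thesis
  proof
    fix v assume "v \<in> V"
    from vertex_critical[OF this] obtain f where "acyclic (mono_arcs (A \<inter> (- {v}) \<times> (- {v})) f)" ..
    then have "acyclic (mono_arcs ((A \<inter> (- {v}) \<times> (- {v}))\<inverse>) f)"
      by (simp add: mono_arcs_converse)
    then show "\<exists>f. acyclic (mono_arcs (A\<inverse> \<inter> (- {v}) \<times> (- {v})) f)"
      by (auto simp: converse_Int converse_Times)
  next
    fix c :: "'a list" assume "distinct c" "length c \<ge> 3" "odd (length c)"
    from no_odd_cycle[OF this] show "\<not> sym_arcs (c @ [hd c]) \<subseteq> A\<inverse>"
      using sym_arcs_sym by fast
  qed (use finite_V A_subset loopfree not_colourable in \<open>auto simp: mono_arcs_converse\<close>)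
qed

context dicrit
begin

definition outs :: "'a \<Rightarrow> 'a set" where "outs v = {w. (v, w) \<in> A}"
definition ins :: "'a \<Rightarrow> 'a set" where "ins v = {w. (w, v) \<in> A}"
definition adj :: "'a \<Rightarrow> 'a \<Rightarrow> bool" where "adj u v \<longleftrightarrow> (u, v) \<in> A \<or> (v, u) \<in> A"
definition low :: "'a \<Rightarrow> bool" where "low v \<longleftrightarrow> v \<in> V \<and> card (outs v) = 2 \<and> card (ins v) = 2"

text \<open>Colourings stay total functions; \<open>f h\<close> is a dummy value, since no arc at
  \<open>h\<close> is inspected.\<close>

definition hole :: "'a \<Rightarrow> ('a \<Rightarrow> bool) \<Rightarrow> bool" where
  "hole h f \<longleftrightarrow> acyclic (mono_arcs (A \<inter> (- {h}) \<times> (- {h})) f)"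

text \<open>One side suffices: if \<open>h\<close> has just two out-neighbours, they have different
  colours, and giving \<open>h\<close> the colour of \<open>p\<close> creates no monochromatic
  out-arc except the one to \<open>p\<close>.\<close>

definition moves :: "'a \<Rightarrow> 'a \<Rightarrow> bool" where
  "moves h p \<longleftrightarrow> ((h, p) \<in> A \<and> card (outs h) = 2) \<or> ((p, h) \<in> A \<and> card (ins h) = 2)"

lemma finite_A: "finite A"
  using finite_subset[OF A_subset] finite_V by blast

lemma outs_subset: "outs v \<subseteq> V" and ins_subset: "ins v \<subseteq> V"
  using A_subset by (auto simp: outs_def ins_def)

lemma finite_outs [simp]: "finite (outs v)" and finite_ins [simp]: "finite (ins v)"
  using finite_subset[OF outs_subset finite_V] finite_subset[OF ins_subset finite_V] by auto

lemma adj_sym: "adj u v \<longleftrightarrow> adj v u" by (auto simp: adj_def)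

lemma adj_neq: "adj u v \<Longrightarrow> u \<noteq> v" using loopfree by (auto simp: adj_def)

lemma adj_in_V: "adj u v \<Longrightarrow> u \<in> V \<and> v \<in> V" using A_subset by (auto simp: adj_def)

lemma low_moves: "low h \<Longrightarrow> adj h p \<Longrightarrow> moves h p"
  by (auto simp: low_def adj_def moves_def)

text \<open>If colour \<open>b\<close> is missing among the out-neighbours, giving it to
  \<open>h\<close> makes \<open>h\<close> a sink of the monochromatic arcs, and the whole digraph
  would be coloured.\<close>

lemma hole_outs:
  assumes "hole h f"
  shows "\<exists>w\<in>outs h. f w = b"
proof (rule ccontr)
  assume *: "\<not> ?thesis"
  have "acyclic (mono_arcs A (f(h := b)))"
    by (rule acyclic_add_sink[OF assms[unfolded hole_def], of _ h])
      (use * loopfree in \<open>auto simp: mono_arcs_def outs_def split: if_splits\<close>)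
  with not_colourable show False by blast
qed

lemma hole_ins:
  assumes "hole h f"
  shows "\<exists>w\<in>ins h. f w = b"
proof (rule ccontr)
  assume *: "\<not> ?thesis"
  have "acyclic (mono_arcs A (f(h := b)))"
    by (rule acyclic_add_source[OF assms[unfolded hole_def], of _ h])
      (use * loopfree in \<open>auto simp: mono_arcs_def ins_def split: if_splits\<close>)
  with not_colourable show False by blast
qed

lemma ex_hole: "v \<in> V \<Longrightarrow> \<exists>f. hole v f"
  using vertex_critical by (simp add: hole_def)

lemma hole_outs_neq: "hole h f \<Longrightarrow> outs h = {a, b} \<Longrightarrow> f a \<noteq> f b"
  using hole_outs[of h f True] hole_outs[of h f False] by auto

lemma hole_ins_neq: "hole h f \<Longrightarrow> ins h = {a, b} \<Longrightarrow> f a \<noteq> f b"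
  using hole_ins[of h f True] hole_ins[of h f False] by auto

lemma two_outs_ge: "v \<in> V \<Longrightarrow> card (outs v) \<ge> 2"
  and two_ins_ge: "v \<in> V \<Longrightarrow> card (ins v) \<ge> 2"
proof -
  assume "v \<in> V"
  then obtain f where f: "hole v f" using ex_hole by blast
  obtain a b where "a \<in> outs v" "f a = True" "b \<in> outs v" "f b = False"
    using hole_outs[OF f] by metis
  then have "a \<noteq> b" "{a, b} \<subseteq> outs v" by auto
  then show "card (outs v) \<ge> 2" by (metis card_2_iff card_mono finite_outs)
  obtain a b where "a \<in> ins v" "f a = True" "b \<in> ins v" "f b = False"
    using hole_ins[OF f] by metis
  then have "a \<noteq> b" "{a, b} \<subseteq> ins v" by auto
  then show "card (ins v) \<ge> 2" by (metis card_2_iff card_mono finite_ins)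
qed

text \<open>With the colour of \<open>p\<close>, the vertex \<open>h\<close> has no monochromatic
  arc on the degree-2 side except the one at \<open>p\<close>, and \<open>p\<close> is now left out.
  So \<open>h\<close> is a sink or a source of the remaining monochromatic arcs.\<close>

lemma hole_move:
  assumes "hole h f" "moves h p"
  shows "hole p (f(h := f p))"
proof -
  have "h \<noteq> p" using assms(2) loopfree by (auto simp: moves_def)
  from assms(2) consider "(h, p) \<in> A" "card (outs h) = 2" | "(p, h) \<in> A" "card (ins h) = 2"
    by (auto simp: moves_def)
  then show ?thesis
  proof cases
    case 1
    then have "p \<in> outs h" by (simp add: outs_def)
    then obtain q where q: "outs h = {p, q}" "q \<noteq> p"
      using card_2_other[OF 1(2)] by blast
    have "f p \<noteq> f q" using hole_outs_neq[OF assms(1) q(1)] .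
    then have "(h, w) \<in> A \<Longrightarrow> w \<noteq> p \<Longrightarrow> f w \<noteq> f p" for w
      using q(1) by (auto simp: outs_def)
    then show ?thesis unfolding hole_def
      by (intro acyclic_add_sink[OF assms(1)[unfolded hole_def], of _ h])
        (use \<open>h \<noteq> p\<close> loopfree in \<open>auto simp: mono_arcs_def split: if_splits\<close>)
  next
    case 2
    then have "p \<in> ins h" by (simp add: ins_def)
    then obtain q where q: "ins h = {p, q}" "q \<noteq> p"
      using card_2_other[OF 2(2)] by blast
    have "f p \<noteq> f q" using hole_ins_neq[OF assms(1) q(1)] .
    then have "(w, h) \<in> A \<Longrightarrow> w \<noteq> p \<Longrightarrow> f w \<noteq> f p" for w
      using q(1) by (auto simp: ins_def)
    then show ?thesis unfolding hole_def
      by (intro acyclic_add_source[OF assms(1)[unfolded hole_def], of _ h])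
        (use \<open>h \<noteq> p\<close> loopfree in \<open>auto simp: mono_arcs_def split: if_splits\<close>)
  qed
qed

text \<open>Each vertex that the hole leaves takes the colour of the next one. Distinctness ensures
  that it is not recoloured later, so \<open>h\<close> keeps the colour of
  \<open>hd ws\<close>.\<close>

lemma hole_walk:
  assumes "hole h f" "successively moves (h # ws)" "distinct (h # ws)" "ws \<noteq> []"
  shows "\<exists>g. hole (last ws) g \<and> g h = f (hd ws) \<and> (\<forall>u. u \<notin> set (h # ws) \<longrightarrow> g u = f u)"
  using assms
proof (induction ws arbitrary: h f)
  case (Cons w ws)
  have m: "hole w (f(h := f w))" using hole_move Cons.prems by auto
  show ?case
  proof (cases "ws = []")
    case True
    then show ?thesis using m by (intro exI[of _ "f(h := f w)"]) (simp del: fun_upd_apply, simp)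
  next
    case False
    then obtain g where g: "hole (last ws) g" "\<forall>u. u \<notin> set (w # ws) \<longrightarrow> g u = (f(h := f w)) u"
      using Cons.IH[OF m] Cons.prems by auto
    show ?thesis
      by (intro exI[of _ g]) (use g False Cons.prems in auto)
  qed
qed simp

text \<open>The hole sits at the head of \<open>L\<close>, and the colours form a word on the tail.
  After a move the old hole goes to the end carrying the colour of the new one, so vertices and word
  are rotated simultaneously, but with periods differing by one.\<close>

lemma hole_rotate1:
  assumes "hole (hd L) f" "distinct L" "length L \<ge> 2" "moves (hd L) (L ! 1)"
  shows "\<exists>g. hole (hd (rotate1 L)) g \<and> map g (tl (rotate1 L)) = rotate1 (map f (tl L)) \<and>
             (\<forall>u. u \<notin> set L \<longrightarrow> g u = f u)"
proof -
  obtain h p cs where L: "L = h # p # cs"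
    using assms(3) by (metis Suc_le_length_iff numeral_2_eq_2)
  have "hole p (f(h := f p))" using hole_move assms(1,4) L by auto
  then show ?thesis using assms(2)
    by (intro exI[of _ "f(h := f p)"]) (auto simp: L)
qed

lemma hole_rotate:
  assumes "hole (hd L) f" "distinct L" "length L \<ge> 2"
    and mv: "\<And>i. i < length L \<Longrightarrow> moves (L ! i) (L ! (Suc i mod length L))"
  shows "\<exists>g. hole (hd (rotate n L)) g \<and> map g (tl (rotate n L)) = rotate n (map f (tl L)) \<and>
             (\<forall>u. u \<notin> set L \<longrightarrow> g u = f u)"
proof (induction n)
  case 0
  then show ?case using assms(1) by auto
next
  case (Suc n)
  then obtain g where g: "hole (hd (rotate n L)) g"
    "map g (tl (rotate n L)) = rotate n (map f (tl L))" "\<forall>u. u \<notin> set L \<longrightarrow> g u = f u" by blast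
  have len: "length L > 0" "1 < length L" using assms(3) by auto
  have h: "hd (rotate n L) = L ! (n mod length L)"
    using len by (simp add: hd_rotate_conv_nth)
  have s: "rotate n L ! 1 = L ! (Suc n mod length L)"
    using len by (simp add: nth_rotate)
  have "moves (hd (rotate n L)) (rotate n L ! 1)"
    using mv[of "n mod length L"] len unfolding h s by (simp add: mod_Suc_eq)
  with hole_rotate1[OF g(1)] assms(2,3) obtain g' where
    "hole (hd (rotate1 (rotate n L))) g'"
    "map g' (tl (rotate1 (rotate n L))) = rotate1 (map g (tl (rotate n L)))"
    "\<forall>u. u \<notin> set L \<longrightarrow> g' u = g u" by fastforce
  then show ?case using g by auto
qed

text \<open>Since \<open>length L\<close> and \<open>length L - 1\<close> are coprime, hole and colours rotate independently.\<close>
lemma hole_rotate_indep: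
  assumes "hole (hd L) f" "distinct L" "length L \<ge> 3"
    and mv: "\<And>i. i < length L \<Longrightarrow> moves (L ! i) (L ! (Suc i mod length L))"
  shows "\<exists>g. hole (hd (rotate i L)) g \<and> map g (tl (rotate i L)) = rotate m (map f (tl L)) \<and>
             (\<forall>u. u \<notin> set L \<longrightarrow> g u = f u)"
proof -
  define k where "k = length L - 2"
  have k: "length L = k + 2" using assms(3) by (simp add: k_def)
  \<comment> \<open>Explicit Chinese remainder: \<open>n\<close> is \<open>i\<close> modulo
    \<open>k + 2\<close>. Modulo \<open>k + 1\<close> the factor \<open>k + 2\<close> is 1 and
    \<open>k\<close> is -1, so there \<open>n\<close> is \<open>m\<close>.\<close>
  define n where "n = i + (k + 2) * (m + k * i)"
  have n': "n = m + (k + 1) * (i + m + k * i)"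
    by (simp add: n_def algebra_simps)
  have "n mod length L = i mod length L"
    unfolding n_def k by (rule mod_mult_self2)
  then have "rotate n L = rotate i L" by (metis rotate_conv_mod)
  moreover have "length (map f (tl L)) = k + 1" using k by simp
  then have "n mod length (map f (tl L)) = m mod length (map f (tl L))"
    unfolding n' by (simp only: mod_mult_self2)
  then have "rotate n (map f (tl L)) = rotate m (map f (tl L))" by (metis rotate_conv_mod)
  ultimately show ?thesis using hole_rotate[OF assms(1,2) _ mv, of n] assms(3) by simp
qed

end

section \<open>Chordless cycles\<close>

lemma sym_arcs_nth:
  assumes "(u, w) \<in> sym_arcs p"
  shows "\<exists>i. Suc i < length p \<and> ((u, w) = (p ! i, p ! Suc i) \<or> (u, w) = (p ! Suc i, p ! i))"
  using assms
proof (induction p)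
  case (Cons x p)
  show ?case
  proof (cases "p = []")
    case False
    with Cons.prems consider "(u, w) = (x, hd p) \<or> (u, w) = (hd p, x)" | "(u, w) \<in> sym_arcs p"
      by (auto simp: sym_arcs_Cons)
    then show ?thesis
    proof cases
      case 1
      then show ?thesis using False by (intro exI[of _ 0]) (auto simp: hd_conv_nth)
    next
      case 2
      with Cons.IH obtain i where "Suc i < length p"
        "(u, w) = (p ! i, p ! Suc i) \<or> (u, w) = (p ! Suc i, p ! i)" by blast
      then show ?thesis by (intro exI[of _ "Suc i"]) auto
    qed
  qed (use Cons.prems in auto)
qed simp

text \<open>The cycle is \<open>v # xs\<close>. Only \<open>v\<close> may be exceptional, and it has
  out-degree 2; hence the cycle is listed so that the hole leaves \<open>v\<close> through the arc
  to \<open>hd xs\<close>.\<close>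

locale chordless_cycle = dicrit V A for V :: "'a set" and A +
  fixes v :: 'a and xs :: "'a list"
  assumes xs_low: "u \<in> set xs \<Longrightarrow> low u"
    and v_outs: "card (outs v) = 2" and v_notin: "v \<notin> set xs"
    and len_xs: "length xs \<ge> 2" and dist_xs: "distinct xs"
    and hd_xs: "(v, hd xs) \<in> A" and last_xs: "adj v (last xs)"
    and chain: "successively adj xs"
    and chordless: "i < j \<Longrightarrow> j < length xs \<Longrightarrow> adj (xs ! i) (xs ! j) \<Longrightarrow> j = Suc i"
    and chordless_v: "i < length xs \<Longrightarrow> adj v (xs ! i) \<Longrightarrow> i = 0 \<or> Suc i = length xs"
begin

abbreviation "L \<equiv> v # xs"
abbreviation "k \<equiv> Suc (length xs)"
abbreviation "succ i \<equiv> L ! (Suc i mod k)"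
text \<open>Adding \<open>length xs\<close> is subtracting 1 modulo \<open>k\<close>, without
  truncated subtraction.\<close>

abbreviation "pred i \<equiv> L ! ((i + length xs) mod k)"

lemma xs_ne: "xs \<noteq> []" using len_xs by auto

lemma dist_L: "distinct L" using v_notin dist_xs by simp

lemma pred_mod: "Suc i < k \<Longrightarrow> (Suc i + length xs) mod k = i"
  by (metis Suc_lessD add_Suc add_Suc_right mod_add_self2 mod_less)

lemma pred_Suc: "Suc i < k \<Longrightarrow> pred (Suc i) = L ! i"
  by (simp only: pred_mod)

lemma adj_succ:
  assumes "i < k" shows "adj (L ! i) (succ i)"
proof (cases i)
  case 0
  then show ?thesis using hd_xs len_xs xs_ne by (auto simp: adj_def hd_conv_nth)
next
  case (Suc j)
  show ?thesis
  proof (cases "Suc j < length xs")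
    case True
    then show ?thesis using Suc successively_nth[OF chain] by simp
  next
    case False
    then have "j = length xs - 1" "Suc j = length xs" using assms Suc by auto
    then show ?thesis using Suc last_xs xs_ne by (simp add: adj_sym last_conv_nth)
  qed
qed

lemma moves_L: "i < k \<Longrightarrow> moves (L ! i) (succ i)"
proof (cases i)
  case 0
  then show ?thesis using hd_xs len_xs v_outs xs_ne by (auto simp: moves_def hd_conv_nth)
next
  case (Suc j)
  assume "i < k"
  then have "low (L ! i)" using Suc xs_low by simp
  then show ?thesis using adj_succ[OF \<open>i < k\<close>] low_moves by blast
qed

lemma succ_neq_pred: "i < k \<Longrightarrow> succ i \<noteq> pred i"
proof -
  assume "i < k"
  have "Suc i mod k \<noteq> (i + length xs) mod k"
  proof (cases i)
    case 0
    then show ?thesis using len_xs xs_ne by simp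
  next
    case (Suc j)
    then have "(i + length xs) mod k = j" using \<open>i < k\<close> pred_mod by blast
    moreover have "Suc i mod k \<noteq> j" using Suc \<open>i < k\<close> len_xs by (cases "Suc i = k") auto
    ultimately show ?thesis by simp
  qed
  moreover have "Suc i mod k < length L" "(i + length xs) mod k < length L" by simp_all
  ultimately show ?thesis using dist_L nth_eq_iff_index_eq by blast
qed

lemma adj_L_cases:
  assumes "i < k" "w \<in> set L" "adj (L ! i) w"
  shows "w = succ i \<or> w = pred i"
proof -
  obtain j where j: "j < k" "w = L ! j"
    using assms(2) by (metis in_set_conv_nth length_Cons)
  have "i \<noteq> j" using adj_neq assms(3) j by auto
  have *: "Suc a = b \<or> (a = 0 \<and> b = length xs)" if "a < b" "b < k" "adj (L ! a) (L ! b)" for a b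
  proof (cases a)
    case 0
    then show ?thesis using that chordless_v[of "b - 1"] by (cases b) auto
  next
    case (Suc c)
    then show ?thesis using that chordless[of c "b - 1"] by (cases b) auto
  qed
  from \<open>i \<noteq> j\<close> consider "i < j" | "j < i" by linarith
  then show ?thesis
  proof cases
    case 1
    with *[of i j] assms j consider "Suc i = j" | "i = 0" "j = length xs" by blast
    then show ?thesis by cases (use j in auto)
  next
    case 2
    with *[of j i] assms j consider "Suc j = i" | "j = 0" "i = length xs" by (auto simp: adj_sym)
    then show ?thesis by cases (use j pred_Suc assms in auto)
  qed
qed

lemma hole_states:
  assumes "hole v f" "i < k"
  shows "\<exists>g. hole (L ! i) g \<and> (\<forall>u. u \<notin> set L \<longrightarrow> g u = f u) \<and>
     (\<forall>j < length xs. g (L ! ((i + Suc j) mod k)) = f (xs ! ((m + j) mod length xs)))"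
proof -
  obtain g where g: "hole (hd (rotate i L)) g" "map g (tl (rotate i L)) = rotate m (map f (tl L))"
     "\<forall>u. u \<notin> set L \<longrightarrow> g u = f u"
    using hole_rotate_indep[of L f i m] assms(1) dist_L len_xs moves_L by auto
  have "hd (rotate i L) = L ! i" using assms(2) by (simp add: hd_rotate_conv_nth del: rotate_Suc)
  moreover have "g (L ! ((i + Suc j) mod k)) = f (xs ! ((m + j) mod length xs))"
    if "j < length xs" for j
  proof -
    have "map g (tl (rotate i L)) ! j = g (rotate i L ! Suc j)"
      using that by (simp add: nth_tl)
    also have "\<dots> = g (L ! ((i + Suc j) mod k))"
      using that by (subst nth_rotate) auto
    also have "map g (tl (rotate i L)) ! j = map f xs ! ((m + j) mod length xs)"
      unfolding g(2) using that by (simp add: nth_rotate)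
    finally show ?thesis using xs_ne by simp
  qed
  ultimately show ?thesis using g by auto
qed

text \<open>The two neighbours of the hole on the cycle carry cyclically consecutive entries of the
  colour word, and \<open>m\<close> may be chosen freely. These two entries are all that the degree
  arguments look at.\<close>

lemma hole_states_nbrs:
  assumes "hole v f" "i < k"
  obtains g where "hole (L ! i) g" "\<forall>u. u \<notin> set L \<longrightarrow> g u = f u"
     "g (succ i) = f (xs ! (m mod length xs))"
     "g (pred i) = f (xs ! ((m + length xs - 1) mod length xs))"
proof -
  obtain g where g: "hole (L ! i) g" "\<forall>u. u \<notin> set L \<longrightarrow> g u = f u"
     "\<forall>j < length xs. g (L ! ((i + Suc j) mod k)) = f (xs ! ((m + j) mod length xs))"
    using hole_states[OF assms] by blast
  have "g (succ i) = f (xs ! (m mod length xs))" using g(3)[rule_format, of 0] xs_ne by simp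
  moreover obtain n where n: "length xs = Suc n" using xs_ne by (cases "length xs") auto
  have "g (pred i) = f (xs ! ((m + length xs - 1) mod length xs))"
    using g(3)[rule_format, of n] n by simp
  ultimately show ?thesis using that g by blast
qed

text \<open>\<open>N\<close> stands for the out- or the in-neighbours of \<open>L ! i\<close>. The
  member of \<open>N\<close> off the cycle keeps its colour in all states, while every entry of the
  word can be brought to the member on the cycle; so all entries are opposite to the same colour. An
  entry \<open>m\<close> is seen by the predecessor at offset \<open>Suc m\<close>.\<close>

lemma one_nbr_constant:
  assumes f: "hole v f" and i: "i < k" and N: "card N = 2" "\<And>w. w \<in> N \<Longrightarrow> adj (L ! i) w"
    and neq: "\<And>g a b. hole (L ! i) g \<Longrightarrow> N = {a, b} \<Longrightarrow> g a \<noteq> g b"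
    and one: "(succ i \<in> N) \<noteq> (pred i \<in> N)"
  shows "\<exists>b. \<forall>u \<in> set xs. f u = b"
proof -
  from one obtain w where w: "w \<in> N" "w = succ i \<or> w = pred i" by blast
  obtain z where z: "N = {w, z}" "z \<noteq> w" using card_2_other[OF N(1) w(1)] .
  have zL: "z \<notin> set L"
    using adj_L_cases[OF i, of z] N(2)[of z] z one w by auto
  have "f (xs ! m) = (\<not> f z)" if m: "m < length xs" for m
  proof (cases "w = succ i")
    case True
    obtain g where "hole (L ! i) g" "\<forall>u. u \<notin> set L \<longrightarrow> g u = f u" "g (succ i) = f (xs ! (m mod length xs))"
      using hole_states_nbrs[OF f i, of m] .
    then show ?thesis using neq[of g w z] z zL True m by auto
  next
    case False
    obtain g where "hole (L ! i) g" "\<forall>u. u \<notin> set L \<longrightarrow> g u = f u"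
      "g (pred i) = f (xs ! ((Suc m + length xs - 1) mod length xs))"
      using hole_states_nbrs[OF f i, of "Suc m"] .
    then show ?thesis using neq[of g w z] z zL False w m by auto
  qed
  then show ?thesis by (metis in_set_conv_nth)
qed

text \<open>Now the two members of \<open>N\<close> see consecutive entries of the word, for every
  offset. A word of length \<open>length xs\<close> that alternates also across its ends has even
  length, whence the odd \<open>k\<close>.\<close>

lemma both_nbrs_alternate:
  assumes f: "hole v f" and i: "i < k" and N: "card N = 2"
    and neq: "\<And>g a b. hole (L ! i) g \<Longrightarrow> N = {a, b} \<Longrightarrow> g a \<noteq> g b"
    and both: "succ i \<in> N" "pred i \<in> N"
  shows "f (hd xs) \<noteq> f (last xs)" and "odd k"
proof -
  obtain q where q: "N = {succ i, q}" using card_2_other[OF N both(1)] .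
  have "q = pred i" using both(2) succ_neq_pred[OF i] unfolding q by simp
  with q have Neq: "N = {succ i, pred i}" by simp
  have alt: "f (xs ! (m mod length xs)) \<noteq> f (xs ! ((m + length xs - 1) mod length xs))" for m
  proof -
    obtain g where "hole (L ! i) g" "g (succ i) = f (xs ! (m mod length xs))"
      "g (pred i) = f (xs ! ((m + length xs - 1) mod length xs))"
      using hole_states_nbrs[OF f i, of m] .
    then show ?thesis using neq[OF _ Neq] by metis
  qed
  have 0: "f (xs ! 0) \<noteq> f (xs ! (length xs - 1))" using alt[of 0] xs_ne by simp
  then show "f (hd xs) \<noteq> f (last xs)" using xs_ne by (simp add: hd_conv_nth last_conv_nth)
  have step: "f (xs ! Suc m) \<noteq> f (xs ! m)" if "Suc m < length xs" for m
    using alt[of "Suc m"] that by simp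
  have "f (xs ! m) = (f (xs ! 0) \<longleftrightarrow> even m)" if "m < length xs" for m
    using that by (induction m) (use step in auto)
  from this[of "length xs - 1"] 0 show "odd k" using xs_ne by (cases "length xs") auto
qed

lemma low_L:
  assumes "0 < i" "i < k" shows "low (L ! i)"
  using assms xs_low by (cases i) auto

lemma
  assumes "hole v f" "i < k" "card (outs (L ! i)) = 2"
  shows one_out_constant: "(succ i \<in> outs (L ! i)) \<noteq> (pred i \<in> outs (L ! i)) \<Longrightarrow> \<exists>b. \<forall>u \<in> set xs. f u = b"
    and both_out_alternate: "succ i \<in> outs (L ! i) \<Longrightarrow> pred i \<in> outs (L ! i) \<Longrightarrow> f (hd xs) \<noteq> f (last xs) \<and> odd k"
proof -
  show "(succ i \<in> outs (L ! i)) \<noteq> (pred i \<in> outs (L ! i)) \<Longrightarrow> \<exists>b. \<forall>u \<in> set xs. f u = b"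
    by (rule one_nbr_constant[OF assms(1,2,3)]) (use hole_outs_neq in \<open>auto simp: outs_def adj_def\<close>)
  show "succ i \<in> outs (L ! i) \<Longrightarrow> pred i \<in> outs (L ! i) \<Longrightarrow> f (hd xs) \<noteq> f (last xs) \<and> odd k"
    using both_nbrs_alternate[OF assms] hole_outs_neq by blast
qed

lemma
  assumes "hole v f" "i < k" "card (ins (L ! i)) = 2"
  shows one_in_constant: "(succ i \<in> ins (L ! i)) \<noteq> (pred i \<in> ins (L ! i)) \<Longrightarrow> \<exists>b. \<forall>u \<in> set xs. f u = b"
    and both_in_alternate: "succ i \<in> ins (L ! i) \<Longrightarrow> pred i \<in> ins (L ! i) \<Longrightarrow> f (hd xs) \<noteq> f (last xs) \<and> odd k"
proof -
  show "(succ i \<in> ins (L ! i)) \<noteq> (pred i \<in> ins (L ! i)) \<Longrightarrow> \<exists>b. \<forall>u \<in> set xs. f u = b"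
    by (rule one_nbr_constant[OF assms(1,2,3)]) (use hole_ins_neq in \<open>auto simp: ins_def adj_def\<close>)
  show "succ i \<in> ins (L ! i) \<Longrightarrow> pred i \<in> ins (L ! i) \<Longrightarrow> f (hd xs) \<noteq> f (last xs) \<and> odd k"
    using both_nbrs_alternate[OF assms] hole_ins_neq by blast
qed

abbreviation "fwd i \<equiv> (L ! i, succ i) \<in> A"
abbreviation "bwd i \<equiv> (succ i, L ! i) \<in> A"

lemma succ_eq: "Suc i < k \<Longrightarrow> succ i = L ! Suc i"
  by (simp only: mod_less)

lemma succ_in_nbrs: "succ i \<in> outs (L ! i) \<longleftrightarrow> fwd i" "succ i \<in> ins (L ! i) \<longleftrightarrow> bwd i"
  by (simp_all only: outs_def ins_def mem_Collect_eq)

lemma pred_in_nbrs: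
  assumes "Suc i < k"
  shows "pred (Suc i) \<in> outs (L ! Suc i) \<longleftrightarrow> bwd i" "pred (Suc i) \<in> ins (L ! Suc i) \<longleftrightarrow> fwd i"
  by (simp_all only: outs_def ins_def mem_Collect_eq pred_Suc[OF assms] succ_eq[OF assms])

lemma fwd_0: "fwd 0" using hd_xs xs_ne len_xs by (simp add: hd_conv_nth)

text \<open>Otherwise both cycle neighbours of \<open>v\<close> are out-neighbours, so the word
  alternates and \<open>k\<close> is odd. Going round the cycle, the arc pattern then has period 2,
  and oddness closes it up to a symmetric cycle of odd length.\<close>

lemma not_bwd_last: "\<not> bwd (length xs)"
proof
  assume bl: "bwd (length xs)"
  then have vl: "(v, L ! length xs) \<in> A" by simp
  have "v \<in> V" using hd_xs A_subset by auto
  then obtain f where f: "hole v f" using ex_hole by blast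
  have alt: "f (hd xs) \<noteq> f (last xs)" "odd k"
    using both_out_alternate[OF f, of 0] v_outs fwd_0 vl by (auto simp: outs_def)
  have "\<not> (\<exists>b. \<forall>u \<in> set xs. f u = b)" using alt(1) hd_in_set[OF xs_ne] last_in_set[OF xs_ne] by metis
  \<comment> \<open>As the word is not constant, neither the out-neighbours nor the in-neighbours of
    a low cycle vertex contain exactly one of its cycle neighbours: each contains both or
    none.\<close>
  then have sw: "fwd (Suc i) = bwd i" "bwd (Suc i) = fwd i" if "Suc i < k" for i
    using one_out_constant[OF f that] one_in_constant[OF f that] low_L[OF zero_less_Suc that]
    unfolding pred_in_nbrs[OF that] succ_in_nbrs low_def by blast+
  have per: "fwd (2 * i) = fwd 0 \<and> bwd (2 * i) = bwd 0" if "2 * i < k" for i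
    using that
  proof (induction i)
    case (Suc i)
    then have "Suc (Suc (2 * i)) < k" by simp
    with Suc sw[of "Suc (2 * i)"] sw[of "2 * i"] show ?case by (simp only: mult_Suc_right) simp
  qed simp
  \<comment> \<open>The index of the closing edge is even, so by periodicity its backward arc forces
    one on edge 0.\<close>
  have "2 * (length xs div 2) = length xs" using alt(2) by simp
  then have "bwd 0" using per[of "length xs div 2"] bl by simp
  have all: "fwd i \<and> bwd i" if "i < k" for i
    using that
  proof (induction i)
    case (Suc i) then show ?case using sw[of i] Suc_lessD by blast
  qed (use fwd_0 \<open>bwd 0\<close> in blast)
  have "sym_arcs (L @ [hd L]) \<subseteq> A"
  proof (rule subrelI)
    fix a b assume "(a, b) \<in> sym_arcs (L @ [hd L])"
    from sym_arcs_nth[OF this] obtain i where i: "i < k"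
      "(a, b) = ((L @ [hd L]) ! i, (L @ [hd L]) ! Suc i) \<or> (a, b) = ((L @ [hd L]) ! Suc i, (L @ [hd L]) ! i)"
      by auto
    have "(L @ [hd L]) ! i = L ! i" using i(1) by (metis length_Cons nth_append)
    moreover have "(L @ [hd L]) ! Suc i = succ i"
    proof (cases "Suc i = k")
      case True
      then show ?thesis by (metis length_Cons mod_self nth_Cons_0 nth_append_length list.sel(1))
    next
      case False
      then have "Suc i < k" using i(1) by simp
      then show ?thesis by (metis length_Cons mod_less nth_append)
    qed
    ultimately show "(a, b) \<in> A" using all[OF i(1)] i(2) by auto
  qed
  moreover have "length L \<ge> 3" using len_xs by simp
  ultimately show False using no_odd_cycle[OF dist_L] alt(2) by simp
qed

lemma xs_monochromatic:
  assumes "hole v f" shows "\<exists>b. \<forall>u \<in> set xs. f u = b"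
  using one_out_constant[OF assms, of 0] v_outs fwd_0 not_bwd_last by (auto simp: outs_def)

text \<open>A constant word excludes a low cycle vertex having both cycle neighbours as
  out-neighbours, or both as in-neighbours. So the direction of the arc leaving \<open>v\<close>
  propagates, and a reverse arc would clash with the forward arc that follows it;
  \<open>not_bwd_last\<close> settles the closing edge.\<close>

lemma directed: "i < k \<Longrightarrow> fwd i \<and> \<not> bwd i"
proof -
  have "v \<in> V" using hd_xs A_subset by auto
  then obtain f where f: "hole v f" using ex_hole by blast
  have "f (hd xs) = f (last xs)" using xs_monochromatic[OF f] hd_in_set[OF xs_ne] last_in_set[OF xs_ne] by metis
  then have no: "\<not> (fwd (Suc i) \<and> bwd i)" "\<not> (bwd (Suc i) \<and> fwd i)" if "Suc i < k" for i
    using both_out_alternate[OF f that] both_in_alternate[OF f that] low_L[OF zero_less_Suc that]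
    unfolding pred_in_nbrs[OF that] succ_in_nbrs low_def by blast+
  have fb: "fwd i \<or> bwd i" if "i < k" for i using adj_succ[OF that] by (auto simp: adj_def)
  have fw: "fwd i" if "i < k" for i
    using that
  proof (induction i)
    case (Suc i) then show ?case using no[of i] fb[of "Suc i"] Suc_lessD by blast
  qed (use fwd_0 in blast)
  assume "i < k"
  show ?thesis
  proof (cases "Suc i < k")
    case True
    then show ?thesis using fw[OF \<open>i < k\<close>] no fw[OF True] by blast
  next
    case False
    then have "i = length xs" using \<open>i < k\<close> by simp
    then show ?thesis using fw[OF \<open>i < k\<close>] not_bwd_last by blast
  qed
qed

text \<open>Bring the hole along the cycle from \<open>v\<close> to \<open>w\<close>, then back to
  \<open>v\<close> through \<open>ys\<close>. At \<open>w\<close> both cycle neighbours have the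
  common colour \<open>b\<close>, so \<open>last ys\<close> has the other colour, which
  \<open>w\<close> inherits on the way back. The rest of \<open>xs\<close> still has colour
  \<open>b\<close>, contrary to \<open>xs_monochromatic\<close>.\<close>

lemma no_third_nbr:
  assumes r: "adj v r" "r \<noteq> hd xs" "r \<noteq> last xs"
    and ys: "ys \<noteq> []" "hd ys = r" "distinct ys" "set ys \<inter> set L = {}" "\<And>u. u \<in> set ys \<Longrightarrow> low u"
      "successively adj ys" "adj (last ys) w" "w \<in> set xs"
  shows False
proof -
  obtain i where i: "i < length xs" "w = xs ! i" using ys(8) by (metis in_set_conv_nth)
  then have Si: "Suc i < k" "w = L ! Suc i" by auto
  have "v \<in> V" using hd_xs A_subset by auto
  then obtain f where f: "hole v f" using ex_hole by blast
  obtain b where b: "\<forall>u \<in> set xs. f u = b" using xs_monochromatic[OF f] by blast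
  obtain g where g: "hole w g" "\<forall>u. u \<notin> set L \<longrightarrow> g u = f u"
     "\<forall>j < length xs. g (L ! ((Suc i + Suc j) mod k)) = f (xs ! ((0 + j) mod length xs))"
    using hole_states[OF f Si(1), of 0] Si(2) by blast
  have gb: "g u = b" if "u \<in> set L" "u \<noteq> w" for u
  proof -
    obtain l where l: "l < k" "u = L ! l" using \<open>u \<in> set L\<close> by (metis in_set_conv_nth length_Cons)
    have "l \<noteq> Suc i" using that Si l by auto
    \<comment> \<open>\<open>j\<close> solves \<open>Suc i + Suc j = l\<close> modulo
      \<open>k\<close>; the second branch is the wrap-around, with \<open>k\<close> added to
      \<open>l\<close>.\<close>
    define j where "j = (if l > Suc i then l - Suc i - 1 else l + length xs - Suc i)"
    have "j < length xs" "(Suc i + Suc j) mod k = l"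
    proof -
      show "j < length xs" using \<open>l \<noteq> Suc i\<close> l Si by (auto simp: j_def)
      show "(Suc i + Suc j) mod k = l"
      proof (cases "l > Suc i")
        case True then show ?thesis using l by (simp add: j_def)
      next
        case False
        then have "Suc i + Suc j = l + k" using \<open>l \<noteq> Suc i\<close> Si by (simp add: j_def)
        then show ?thesis using l(1) by (metis mod_add_self2 mod_less)
      qed
    qed
    then have "g u = f (xs ! j)" using g(3) l by fastforce
    then show ?thesis using b \<open>j < length xs\<close> by simp
  qed
  let ?y = "last ys"
  have y: "?y \<notin> set L" "?y \<in> set ys" using last_in_set[OF ys(1)] ys(4) by blast+
  have lw: "low w" using xs_low ys(8) by blast
  have "g ?y \<noteq> b"
  proof -
    have "(w, succ (Suc i)) \<in> A" using directed[OF Si(1)] Si(2) by blast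
    moreover have "(pred (Suc i), w) \<in> A"
      using directed[of i] Si(1) unfolding pred_Suc[OF Si(1)] Si(2) succ_eq[OF Si(1)] by simp
    moreover have "succ (Suc i) \<in> set L" "pred (Suc i) \<in> set L"
      by (rule nth_mem, simp)+
    moreover obtain s p where sp: "s = succ (Suc i)" "p = pred (Suc i)" by blast
    ultimately have ss: "(w, s) \<in> A" "(p, w) \<in> A" "s \<in> set L" "p \<in> set L" by (simp_all only: sp)
    then have "s \<noteq> w" "p \<noteq> w" "s \<noteq> ?y" "p \<noteq> ?y" using loopfree y(1) by metis+
    with ss have S': "s \<in> outs w" "p \<in> ins w" "g s = b" "g p = b" "s \<noteq> ?y" "p \<noteq> ?y"
      using gb by (auto simp: outs_def ins_def)
    consider "?y \<in> outs w" | "?y \<in> ins w" using ys(7) by (auto simp: adj_def outs_def ins_def)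
    then show ?thesis
    proof cases
      case 1
      obtain z where "outs w = {?y, z}" using card_2_other[of "outs w" ?y] 1 lw by (auto simp: low_def)
      then show ?thesis using hole_outs_neq[OF g(1)] S' by force
    next
      case 2
      obtain z where "ins w = {?y, z}" using card_2_other[of "ins w" ?y] 2 lw by (auto simp: low_def)
      then show ?thesis using hole_ins_neq[OF g(1)] S' by force
    qed
  qed
  \<comment> \<open>The last move enters \<open>v\<close> from a low vertex, so the degrees of
    \<open>v\<close> do not restrict it.\<close>
  have "\<exists>g'. hole (last (rev ys @ [v])) g' \<and> g' w = g (hd (rev ys @ [v])) \<and>
     (\<forall>u. u \<notin> set (w # rev ys @ [v]) \<longrightarrow> g' u = g u)"
  proof (rule hole_walk[OF g(1)])
    show "distinct (w # rev ys @ [v])" using ys v_notin by auto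
    have "successively adj (w # rev ys @ [v])"
      using ys r(1) by (simp add: successively_Cons successively_append_iff hd_rev last_rev adj_sym)
    moreover have "\<forall>u \<in> set (w # rev ys). low u" using lw ys(5) by auto
    ultimately have "successively moves (w # rev ys)" "moves (last (w # rev ys)) v"
      using ys(1) r(1) ys(2,5)
      by (auto intro!: low_moves simp: last_rev adj_sym successively_append_iff successively_Cons
          elim!: successively_mono)
    then show "successively moves (w # rev ys @ [v])"
      using ys(1) by (simp add: successively_append_iff successively_Cons)
  qed simp
  then obtain g' where g': "hole v g'" "g' w = g ?y" "\<forall>u. u \<notin> set (w # rev ys @ [v]) \<longrightarrow> g' u = g u"
    using ys(1) by (auto simp: hd_rev)
  have "\<exists>u\<in>set xs. u \<noteq> w"
  proof (rule ccontr)
    assume "\<not> ?thesis"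
    then have "set xs \<subseteq> {w}" by blast
    then have "card (set xs) \<le> 1" using card_mono[of "{w}"] by simp
    then show False using dist_xs len_xs by (simp add: distinct_card)
  qed
  then obtain u where u: "u \<in> set xs" "u \<noteq> w" by blast
  then have "g' u = b" using g'(3) ys(4) v_notin gb by auto
  moreover have "g' u = g' w" using xs_monochromatic[OF g'(1)] u ys(8) by blast
  ultimately show False using g'(2) \<open>g ?y \<noteq> b\<close> by simp
qed

end

section \<open>Neighbours in connected sets\<close>

context dicrit
begin

text \<open>Connectivity as growth by one adjacent vertex at a time: arcs can then be counted by
  induction, without choosing a removable vertex.\<close>

inductive conn :: "'a set \<Rightarrow> bool" where
  conn_single: "conn {a}"
| conn_insert: "conn S \<Longrightarrow> v \<notin> S \<Longrightarrow> u \<in> S \<Longrightarrow> adj v u \<Longrightarrow> conn (insert v S)"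

definition link :: "'a set \<Rightarrow> 'a \<Rightarrow> 'a \<Rightarrow> 'a list \<Rightarrow> bool" where
  "link K a b p \<longleftrightarrow> p \<noteq> [] \<and> hd p = a \<and> last p = b \<and> set p \<subseteq> K \<and> successively adj p"

lemma conn_link:
  assumes "conn K" "a \<in> K" "b \<in> K"
  shows "\<exists>p. link K a b p"
  using assms
proof (induction arbitrary: a b)
  case (conn_single c)
  then show ?case by (intro exI[of _ "[c]"]) (auto simp: link_def)
next
  case (conn_insert S v u)
  have mono: "link S c d p \<Longrightarrow> link (insert v S) c d p" for c d p by (auto simp: link_def)
  consider "a \<in> S" "b \<in> S" | "a = v" "b \<in> S" | "a \<in> S" "b = v" | "a = v" "b = v"
    using conn_insert.prems by blast
  then show ?case
  proof cases
    case 1 then show ?thesis using conn_insert.IH mono by blast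
  next
    case 2
    obtain p where "link S u b p" using conn_insert.IH 2 conn_insert.hyps by blast
    then show ?thesis using 2 conn_insert.hyps
      by (intro exI[of _ "v # p"]) (auto simp: link_def successively_Cons)
  next
    case 3
    obtain p where "link S a u p" using conn_insert.IH 3 conn_insert.hyps by blast
    then show ?thesis using 3 conn_insert.hyps
      by (intro exI[of _ "p @ [v]"]) (auto simp: link_def successively_append_iff adj_sym)
  next
    case 4
    then show ?thesis by (intro exI[of _ "[v]"]) (auto simp: link_def)
  qed
qed

lemma conn_finite: "conn K \<Longrightarrow> finite K"
  by (induction rule: conn.induct) auto

lemma conn_nonempty: "conn K \<Longrightarrow> K \<noteq> {}"
  by (induction rule: conn.induct) auto

section \<open>Shortest walks inside a connected set\<close>

lemma last_take_Suc: "i < length p \<Longrightarrow> last (take (Suc i) p) = p ! i"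
  by (simp add: take_Suc_conv_app_nth)

lemma link_take: "link K a b p \<Longrightarrow> i < length p \<Longrightarrow> link K a (p ! i) (take (Suc i) p)"
  unfolding link_def
  by (auto simp: last_take_Suc successively_conv_nth dest: in_set_takeD)

lemma link_shortcut:
  assumes "link K a b p" "i < j" "j < length p" "adj (p ! i) (p ! j)"
  shows "link K a b (take (Suc i) p @ drop j p)"
proof -
  have "successively adj (take (Suc i) p)" "successively adj (drop j p)"
    using assms(1) by (auto simp: link_def successively_conv_nth)
  moreover have "last (take (Suc i) p) = p ! i" "hd (drop j p) = p ! j"
    using assms by (auto simp: last_take_Suc hd_drop_conv_nth)
  ultimately show ?thesis using assms
    by (auto simp: link_def successively_append_iff hd_append dest: in_set_takeD in_set_dropD)
qed

text \<open>The ends vary too, within the pairs allowed by \<open>P\<close>. Minimality over all of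
  them is what keeps other admissible ends out of the interior.\<close>

lemma shortest_link:
  assumes "link K a b p" "P a b"
  obtains a' b' q where "link K a' b' q" "P a' b'"
    "\<And>c d r. link K c d r \<Longrightarrow> P c d \<Longrightarrow> length q \<le> length r"
proof -
  let ?Q = "\<lambda>q. \<exists>c d. link K c d q \<and> P c d"
  have "?Q p" using assms by blast
  from ex_has_least_nat[of ?Q, OF this, of length] that show ?thesis by blast
qed

text \<open>A chord is a shortcut. A repeated vertex gives a chord to the successor of its second
  occurrence, or a shorter walk if that occurrence is the end.\<close>

lemma
  assumes "link K a b p" and min: "\<And>q. link K a b q \<Longrightarrow> length p \<le> length q"
  shows shortest_link_chordless: "i < j \<Longrightarrow> j < length p \<Longrightarrow> adj (p ! i) (p ! j) \<Longrightarrow> j = Suc i"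
    and shortest_link_distinct: "distinct p"
proof -
  show chordless: "j = Suc i" if "i < j" "j < length p" "adj (p ! i) (p ! j)" for i j
    using min[OF link_shortcut[OF assms(1) that]] that by auto
  have "p ! i \<noteq> p ! j" if "i < j" "j < length p" for i j
  proof
    assume eq: "p ! i = p ! j"
    show False
    proof (cases "Suc j < length p")
      case True
      then have "adj (p ! i) (p ! Suc j)"
        using assms(1) unfolding eq by (auto simp: link_def successively_nth)
      from chordless[OF _ True this] that show False by simp
    next
      case False
      then have "p ! j = b" using assms(1) that by (auto simp: link_def last_conv_nth Suc_lessI
        intro!: arg_cong[of _ _ "(!) p"])
      then have "link K a b (take (Suc i) p)" using link_take[OF assms(1), of i] eq that by simp
      from min[OF this] that show False by simp
    qed
  qed
  then show "distinct p" by (metis distinct_conv_nth linorder_neqE_nat)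
qed

text \<open>A shortest walk in \<open>K\<close> from an out-neighbour of \<open>v\<close> to another
  neighbour closes a chordless cycle with \<open>v\<close>, which is therefore directed. Any third
  neighbour in \<open>K\<close> would be connected to this cycle inside \<open>K\<close>, which
  \<open>no_third_nbr\<close> forbids.\<close>

lemma nbrs_in_conn:
  assumes K: "conn K" "\<And>u. u \<in> K \<Longrightarrow> low u" and v: "v \<notin> K" "card (outs v) = 2"
    and q: "q \<in> K" "(v, q) \<in> A" and p: "p \<in> K" "adj v p" "p \<noteq> q"
  shows "(p, v) \<in> A \<and> (v, p) \<notin> A \<and> (q, v) \<notin> A \<and> (\<forall>r \<in> K. adj v r \<longrightarrow> r = p \<or> r = q) \<and>
     (\<exists>xs. link K q p xs \<and> (\<forall>i. Suc i < length xs \<longrightarrow> (xs ! i, xs ! Suc i) \<in> A \<and> (xs ! Suc i, xs ! i) \<notin> A))"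
proof -
  let ?P = "\<lambda>a b. (v, a) \<in> A \<and> adj v b \<and> a \<noteq> b"
  obtain xs0 where xs0: "link K q p xs0" using conn_link K q p by blast
  have P0: "?P q p" using q p by blast
  obtain a b xs where xs: "link K a b xs" "?P a b"
    and min: "\<And>c d r. link K c d r \<Longrightarrow> ?P c d \<Longrightarrow> length xs \<le> length r"
    using shortest_link[OF xs0, of ?P, OF P0] by metis
  have min': "\<And>r. link K a b r \<Longrightarrow> length xs \<le> length r" using min xs(2) by blast
  have dist: "distinct xs" using shortest_link_distinct[OF xs(1) min'] .
  have ne: "xs \<noteq> []" using xs(1) by (simp add: link_def)
  have len: "length xs \<ge> 2"
    using xs ne by (cases xs; cases "tl xs") (auto simp: link_def)
  interpret C: chordless_cycle V A v xs
  proof unfold_locales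
    fix i assume i: "i < length xs" "adj v (xs ! i)"
    show "i = 0 \<or> Suc i = length xs"
    proof (rule ccontr)
      assume *: "\<not> ?thesis"
      \<comment> \<open>The walk could stop at \<open>xs ! i\<close>, another neighbour of
        \<open>v\<close>, and be shorter.\<close>
      have "xs ! i \<noteq> a"
        using dist i * xs(1) by (auto simp: link_def hd_conv_nth distinct_conv_nth)
      with min[OF link_take[OF xs(1) i(1)]] xs(2) i * show False by auto
    qed
  qed (use xs K v len dist shortest_link_chordless[OF xs(1) min'] in \<open>auto simp: link_def\<close>)
  have ab: "a = hd xs" "b = last xs" "set xs \<subseteq> K" using xs(1) by (auto simp: link_def)
  have only: "r = a \<or> r = b" if r: "r \<in> K" "adj v r" for r
  proof (rule ccontr)
    assume *: "\<not> ?thesis"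
    have rxs: "r \<notin> set xs"
    proof
      assume "r \<in> set xs"
      then obtain i where i: "i < length xs" "r = xs ! i" by (metis in_set_conv_nth)
      then have "i = 0 \<or> i = length xs - 1" using C.chordless_v[of i] r by auto
      then show False using * ab ne i by (auto simp: hd_conv_nth last_conv_nth)
    qed
    \<comment> \<open>The target is the whole of \<open>xs\<close>, so a shortest such walk meets
      the cycle only in its last vertex; dropping that vertex gives the detour
      \<open>zs\<close>.\<close>
    let ?R = "\<lambda>c d. c = r \<and> d \<in> set xs"
    have "a \<in> K" using ab hd_in_set[OF ne] by auto
    then obtain ys0 where ys0: "link K r a ys0" using conn_link[OF K(1)] r by blast
    have R0: "?R r a" using ab ne by auto
    obtain c w ys where ys: "link K c w ys" "?R c w"
      and minR: "\<And>c d s. link K c d s \<Longrightarrow> ?R c d \<Longrightarrow> length ys \<le> length s"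
      using shortest_link[OF ys0, of ?R, OF R0] by metis
    have minR': "\<And>s. link K c w s \<Longrightarrow> length ys \<le> length s" using minR ys(2) by blast
    have dys: "distinct ys" using shortest_link_distinct[OF ys(1) minR'] .
    have yne: "ys \<noteq> []" using ys(1) by (simp add: link_def)
    define zs where "zs = butlast ys"
    have yz: "ys = zs @ [w]" using ys(1) yne by (auto simp: zs_def link_def)
    have zne: "zs \<noteq> []" using ys rxs yz by (auto simp: link_def)
    have "y \<notin> set xs" if yzs: "y \<in> set zs" for y
    proof
      assume "y \<in> set xs"
      obtain i where i: "i < length zs" "y = zs ! i" using yzs by (metis in_set_conv_nth)
      then have "link K c y (take (Suc i) ys)"
        using link_take[OF ys(1), of i] yz by (simp add: nth_append)
      from minR[OF this] \<open>y \<in> set xs\<close> ys(2) i yz show False by auto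
    qed
    moreover have "set zs \<subseteq> K" using ys(1) yz by (auto simp: link_def)
    ultimately have "set zs \<inter> set (v # xs) = {}" using v(1) by auto
    then show False
      using C.no_third_nbr[of r zs w] r * ab zne yz dys ys K(2) \<open>set zs \<subseteq> K\<close>
      by (auto simp: link_def successively_append_iff)
  qed
  have arcs: "(xs ! i, xs ! Suc i) \<in> A \<and> (xs ! Suc i, xs ! i) \<notin> A" if "Suc i < length xs" for i
    using C.directed[of "Suc i"] that by auto
  have lastd: "(b, v) \<in> A \<and> (v, b) \<notin> A"
    using C.directed[of "length xs"] ab ne by (auto simp: last_conv_nth nth_Cons')
  have hdd: "(v, a) \<in> A \<and> (a, v) \<notin> A"
    using C.directed[of 0] ab ne by (auto simp: hd_conv_nth)
  \<comment> \<open>The directed cycle enters \<open>v\<close> from \<open>b\<close> by a simple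
    arc, so the out-neighbour \<open>q\<close> can only be \<open>a\<close>.\<close>
  have "q = a" using only[of q] q lastd by (auto simp: adj_def)
  then have "p = b" using only p by blast
  show ?thesis using \<open>q = a\<close> \<open>p = b\<close> lastd hdd only xs(1) arcs by blast
qed

end

lemma (in dicrit) converse_defs:
  "dicrit.outs (A\<inverse>) = ins" "dicrit.ins (A\<inverse>) = outs" "dicrit.adj (A\<inverse>) = adj"
  "dicrit.low V (A\<inverse>) = low" "dicrit.conn (A\<inverse>) = conn" "dicrit.link (A\<inverse>) = link"
proof -
  interpret C: dicrit V "A\<inverse>" by (rule dicrit_converse) unfold_locales
  show o: "C.outs = ins" by (auto simp: C.outs_def ins_def)
  show i: "C.ins = outs" by (auto simp: outs_def C.ins_def)
  show a: "C.adj = adj" by (auto simp: fun_eq_iff C.adj_def adj_def)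
  show "C.low = low" by (auto simp: fun_eq_iff C.low_def low_def o i)
  have "C.conn K" if "conn K" for K
    using that by induction (auto intro: C.conn.intros simp: a)
  moreover have "conn K" if "C.conn K" for K
    using that by induction (auto intro: conn.intros simp: a)
  ultimately show "C.conn = conn" by (auto simp: fun_eq_iff)
  show "C.link = link" by (auto simp: fun_eq_iff C.link_def link_def a)
qed

context dicrit
begin

section \<open>Attaching a vertex to a connected set of low vertices\<close>

lemma card_nbrs_in_conn:
  assumes K: "conn K" "\<And>u. u \<in> K \<Longrightarrow> low u" and v: "v \<notin> K" "card (outs v) = 2"
    and ne: "outs v \<inter> K \<noteq> {}"
  shows "card (outs v \<inter> K) = 1" "card (ins v \<inter> K) \<le> 1"
proof -
  obtain q where q: "q \<in> K" "(v, q) \<in> A" using ne by (auto simp: outs_def)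
  have "outs v \<inter> K = {q} \<and> (\<exists>p. ins v \<inter> K \<subseteq> {p})"
  proof (cases "\<exists>p \<in> K. adj v p \<and> p \<noteq> q")
    case True
    then obtain p where "p \<in> K" "adj v p" "p \<noteq> q" by blast
    note N = nbrs_in_conn[OF K v q this]
    have "(p, v) \<in> A" "(v, p) \<notin> A" "(q, v) \<notin> A" "\<And>r. r \<in> K \<Longrightarrow> adj v r \<Longrightarrow> r = p \<or> r = q"
      using N by simp_all
    with q have "outs v \<inter> K = {q}" "ins v \<inter> K \<subseteq> {p}"
      unfolding outs_def ins_def adj_def by blast+
    then show ?thesis by blast
  next
    case False
    then have "outs v \<inter> K = {q}" "ins v \<inter> K \<subseteq> {q}" using q by (auto simp: outs_def ins_def adj_def)
    then show ?thesis by blast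
  qed
  then obtain p where "outs v \<inter> K = {q}" "ins v \<inter> K \<subseteq> {p}" by blast
  then show "card (outs v \<inter> K) = 1" "card (ins v \<inter> K) \<le> 1"
    using card_mono[of "{p}" "ins v \<inter> K"] by auto
qed

lemma card_nbrs_in_conn':
  assumes K: "conn K" "\<And>u. u \<in> K \<Longrightarrow> low u" and v: "v \<notin> K" "card (ins v) = 2"
    and ne: "ins v \<inter> K \<noteq> {}"
  shows "card (ins v \<inter> K) = 1" "card (outs v \<inter> K) \<le> 1"
proof -
  interpret C: dicrit V "A\<inverse>" by (rule dicrit_converse) unfold_locales
  show "card (ins v \<inter> K) = 1" "card (outs v \<inter> K) \<le> 1"
    using C.card_nbrs_in_conn[of K v] assms unfolding converse_defs by auto
qed

text \<open>Two different neighbours would be connected inside \<open>K\<close> by a walk of simple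
  arcs, but \<open>K\<close> spans digons only.\<close>

lemma unique_nbr_symmetric:
  assumes K: "conn K" "\<And>u. u \<in> K \<Longrightarrow> low u" and v: "v \<notin> K" "card (outs v) = 2"
    and sym: "\<And>a b. a \<in> K \<Longrightarrow> b \<in> K \<Longrightarrow> (a, b) \<in> A \<Longrightarrow> (b, a) \<in> A"
    and q: "q \<in> K" "(v, q) \<in> A" and p: "p \<in> K" "adj v p"
  shows "p = q"
proof (rule ccontr)
  assume "p \<noteq> q"
  from nbrs_in_conn[OF K v q p this] obtain xs where xs: "link K q p xs"
    "\<forall>i. Suc i < length xs \<longrightarrow> (xs ! i, xs ! Suc i) \<in> A \<and> (xs ! Suc i, xs ! i) \<notin> A" by blast
  have "length xs > 1"
    using xs(1) \<open>p \<noteq> q\<close> by (cases xs; cases "tl xs") (auto simp: link_def)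
  then have "(xs ! 0, xs ! 1) \<in> A" "(xs ! 1, xs ! 0) \<notin> A"
    using xs(2)[rule_format, of 0] by simp_all
  moreover have sub: "set xs \<subseteq> K" using xs(1) by (simp add: link_def)
  have "xs ! 0 \<in> K" "xs ! 1 \<in> K" 
      by (rule subsetD[OF sub nth_mem], use \<open>length xs > 1\<close> in linarith)+
  ultimately show False using sym by blast
qed

lemma unique_nbr_symmetric':
  assumes K: "conn K" "\<And>u. u \<in> K \<Longrightarrow> low u" and v: "v \<notin> K" "card (ins v) = 2"
    and sym: "\<And>a b. a \<in> K \<Longrightarrow> b \<in> K \<Longrightarrow> (a, b) \<in> A \<Longrightarrow> (b, a) \<in> A"
    and q: "q \<in> K" "(q, v) \<in> A" and p: "p \<in> K" "adj v p"
  shows "p = q"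
proof -
  interpret C: dicrit V "A\<inverse>" by (rule dicrit_converse) unfold_locales
  show ?thesis
    by (rule C.unique_nbr_symmetric[unfolded converse_defs, OF K v _ q(1) _ p])
      (use sym q(2) in \<open>simp_all only: converse_iff\<close>)
qed

text \<open>A new vertex brings at most one arc in each direction, hence at most two. In the case
  \<open>detour\<close> they close a directed cycle, so the old set already contains simple arcs and
  is not a symmetric path.\<close>

lemma attach_cases:
  assumes K: "conn K" "\<And>u. u \<in> K \<Longrightarrow> low u" and v: "v \<notin> K" "low v" "u \<in> K" "adj v u"
  obtains (one_out) u where "outs v \<inter> K = {u}" "ins v \<inter> K = {}"
  | (one_in) u where "outs v \<inter> K = {}" "ins v \<inter> K = {u}"
  | (digon) u where "outs v \<inter> K = {u}" "ins v \<inter> K = {u}"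
  | (detour) p q xs where "outs v \<inter> K = {q}" "ins v \<inter> K = {p}" "p \<noteq> q" "link K q p xs"
      "\<And>i. Suc i < length xs \<Longrightarrow> (xs ! i, xs ! Suc i) \<in> A \<and> (xs ! Suc i, xs ! i) \<notin> A"
proof (cases "outs v \<inter> K = {}")
  case True
  with v have ne: "ins v \<inter> K \<noteq> {}" by (auto simp: adj_def outs_def ins_def)
  from card_nbrs_in_conn'(1)[OF K v(1) _ ne] v(2) obtain u where "ins v \<inter> K = {u}"
    by (auto simp: low_def card_1_singleton_iff)
  with True one_in show ?thesis by blast
next
  case False
  have vo: "card (outs v) = 2" using v(2) by (simp add: low_def)
  from card_nbrs_in_conn(1)[OF K v(1) vo False] obtain q where q: "outs v \<inter> K = {q}"
    by (auto simp: card_1_singleton_iff)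
  show ?thesis
  proof (cases "ins v \<inter> K = {}")
    case True
    then show ?thesis using one_out q by blast
  next
    case False
    then have "card (ins v \<inter> K) = 1"
      using card_nbrs_in_conn(2)[OF K v(1) vo \<open>outs v \<inter> K \<noteq> {}\<close>]
      by (metis One_nat_def card_0_eq finite_Int finite_ins le_SucE le_zero_eq)
    then obtain p where p: "ins v \<inter> K = {p}" by (auto simp: card_1_singleton_iff)
    show ?thesis
    proof (cases "p = q")
      case True
      then show ?thesis using digon p q by blast
    next
      case False
      have "q \<in> K" "(v, q) \<in> A" "p \<in> K" "adj v p" using p q by (auto simp: outs_def ins_def adj_def)
      from nbrs_in_conn[OF K v(1) vo this False] show ?thesis using detour[OF q p False] by blast
    qed
  qed
qed

lemma arcs_insert:
  assumes "v \<notin> S"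
  shows "A \<inter> insert v S \<times> insert v S = A \<inter> S \<times> S \<union> {v} \<times> (outs v \<inter> S) \<union> (ins v \<inter> S) \<times> {v}"
  using loopfree by (auto simp: outs_def ins_def)

lemma card_arcs_insert:
  assumes "v \<notin> S"
  shows "card (A \<inter> insert v S \<times> insert v S) =
     card (A \<inter> S \<times> S) + card (outs v \<inter> S) + card (ins v \<inter> S)"
proof -
  have "card (A \<inter> insert v S \<times> insert v S) =
     card (A \<inter> S \<times> S \<union> {v} \<times> (outs v \<inter> S)) + card ((ins v \<inter> S) \<times> {v})"
    unfolding arcs_insert[OF assms]
    by (rule card_Un_disjoint) (use assms finite_A in auto)
  also have "card (A \<inter> S \<times> S \<union> {v} \<times> (outs v \<inter> S)) = card (A \<inter> S \<times> S) + card ({v} \<times> (outs v \<inter> S))"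
    by (rule card_Un_disjoint) (use assms finite_A in auto)
  finally show ?thesis by (simp add: card_cartesian_product)
qed

section \<open>Connected sets of low vertices with many arcs\<close>

lemma card_3_le: "a \<noteq> b \<Longrightarrow> a \<noteq> c \<Longrightarrow> b \<noteq> c \<Longrightarrow> {a, b, c} \<subseteq> S \<Longrightarrow> finite S \<Longrightarrow> 3 \<le> card S"
  using card_mono[of S "{a, b, c}"] by simp

text \<open>The two digons at an inner vertex already use up both of its degrees.\<close>

lemma nbr_of_symmetric_path:
  assumes p: "distinct p" "sym_arcs p \<subseteq> A" and u: "u \<in> set p" "low u" "adj u v" "v \<notin> set p"
  shows "u = hd p \<or> u = last p"
proof (rule ccontr)
  assume *: "\<not> ?thesis"
  obtain as bs where ps: "p = as @ u # bs" using u(1) by (metis split_list)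
  with * have ne: "as \<noteq> []" "bs \<noteq> []" by auto
  have "last as \<in> set as" "hd bs \<in> set bs" using ne by auto
  then have d: "last as \<noteq> hd bs" "last as \<noteq> v" "hd bs \<noteq> v" using p(1) u(4) unfolding ps by auto
  have "{last as, hd bs} \<subseteq> outs u" "{last as, hd bs} \<subseteq> ins u"
    using p(2) ne unfolding ps by (auto simp: sym_arcs_append sym_arcs_Cons outs_def ins_def)
  moreover have "v \<in> outs u \<or> v \<in> ins u" using u(3) by (auto simp: adj_def outs_def ins_def)
  ultimately have "3 \<le> card (outs u) \<or> 3 \<le> card (ins u)"
    using card_3_le[OF d, of "outs u"] card_3_le[OF d, of "ins u"] by auto
  then show False using u(2) by (simp add: low_def)
qed

text \<open>At \<open>last p\<close> the arc to \<open>z\<close> leaves no room for a digon to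
  \<open>v\<close> besides the one along the path; only for a one-vertex path do head and last
  coincide.\<close>

lemma digon_to_symmetric_path:
  assumes p: "distinct p" "sym_arcs p \<subseteq> A" and u: "u \<in> set p" "low u" "(u, v) \<in> A" "(v, u) \<in> A" "v \<notin> set p"
    and z: "adj (last p) z" "z \<notin> set p" "z \<noteq> v"
  shows "u = hd p"
proof (rule ccontr)
  assume *: "u \<noteq> hd p"
  then have l: "u = last p" using nbr_of_symmetric_path[OF p u(1,2) _ u(5)] u by (auto simp: adj_def)
  obtain as where ps: "p = as @ [u]" using u(1) l by (metis append_butlast_last_id empty_iff empty_set)
  with * have ne: "as \<noteq> []" by auto
  have "last as \<in> set as" using ne by auto
  then have d: "last as \<noteq> v" "last as \<noteq> z" "v \<noteq> z" using p(1) u(5) z unfolding ps by auto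
  have "{last as, v} \<subseteq> outs u" "{last as, v} \<subseteq> ins u"
    using p(2) ne u(3,4) unfolding ps by (auto simp: sym_arcs_append outs_def ins_def)
  moreover have "z \<in> outs u \<or> z \<in> ins u" using z(1) l by (auto simp: adj_def outs_def ins_def)
  ultimately have "3 \<le> card (outs u) \<or> 3 \<le> card (ins u)"
    using card_3_le[OF d, of "outs u"] card_3_le[OF d, of "ins u"] by auto
  then show False using u(2) by (simp add: low_def)
qed

text \<open>The set of the other three vertices is connected through \<open>q\<close>, and
  \<open>p\<close> is adjacent to all of them, although it has at most one out- and one in-neighbour
  there.\<close>

lemma no_diamond:
  assumes "low p" "low q" "low r" "low v" "distinct [p, q, r, v]"
    and "adj p q" "adj p r" "adj p v" "adj q r" "adj q v"
  shows False
proof -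
  let ?K = "{v, r, q}"
  have K: "conn ?K"
    using assms by (intro conn_insert[of "{r, q}" v q] conn_insert[of "{q}" r q] conn_single) (auto simp: adj_sym)
  have low: "\<And>u. u \<in> ?K \<Longrightarrow> low u" and pK: "p \<notin> ?K" using assms by auto
  have p2: "card (outs p) = 2" "card (ins p) = 2" using assms(1) by (auto simp: low_def)
  have sub: "?K \<subseteq> (outs p \<inter> ?K) \<union> (ins p \<inter> ?K)" using assms by (auto simp: adj_def outs_def ins_def)
  then have "outs p \<inter> ?K \<noteq> {} \<or> ins p \<inter> ?K \<noteq> {}" by blast
  then have "card (outs p \<inter> ?K) + card (ins p \<inter> ?K) \<le> 2"
    using card_nbrs_in_conn[OF K low pK p2(1)] card_nbrs_in_conn'[OF K low pK p2(2)] by linarith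
  moreover have "card ?K \<le> card (outs p \<inter> ?K) + card (ins p \<inter> ?K)"
    using card_mono[OF _ sub] card_Un_le[of "outs p \<inter> ?K" "ins p \<inter> ?K"] by simp
  moreover have "card ?K = 3" using assms(5) by auto
  ultimately show False by linarith
qed

text \<open>A single vertex has deficit 2, and each further vertex adds at most two arcs. The
  deficit stays 2 only if every new vertex is joined by a digon to an end of the symmetric path
  built so far.\<close>

lemma arcs_in_conn:
  assumes "conn S" "\<And>u. u \<in> S \<Longrightarrow> low u"
  shows "card (A \<inter> S \<times> S) + 2 \<le> 2 * card S \<and>
    (card (A \<inter> S \<times> S) + 2 = 2 * card S \<longrightarrow>
       (\<exists>p. distinct p \<and> set p = S \<and> A \<inter> S \<times> S = sym_arcs p))"
  using assms
proof induction
  case (conn_single a)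
  have "A \<inter> {a} \<times> {a} = {}" using loopfree by auto
  then show ?case by (auto intro!: exI[of _ "[a]"])
next
  case (conn_insert S v u)
  have low: "\<And>u. u \<in> S \<Longrightarrow> low u" "low v" using conn_insert.prems by auto
  note IH = conn_insert.IH[OF low(1)]
  have fS: "finite S" using conn_finite conn_insert.hyps by blast
  have cS: "card (insert v S) = Suc (card S)" using fS conn_insert.hyps by simp
  note ca = card_arcs_insert[OF conn_insert.hyps(2)]
  show ?case
  proof (rule attach_cases[OF conn_insert.hyps(1) low(1) conn_insert.hyps(2) low(2) conn_insert.hyps(3,4)])
    fix u assume "outs v \<inter> S = {u}" "ins v \<inter> S = {}"
    then show ?case using ca cS IH by simp
  next
    fix u assume "outs v \<inter> S = {}" "ins v \<inter> S = {u}"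
    then show ?case using ca cS IH by simp
  next
    fix u assume u: "outs v \<inter> S = {u}" "ins v \<inter> S = {u}"
    then have card: "card (A \<inter> insert v S \<times> insert v S) = card (A \<inter> S \<times> S) + 2" using ca by simp
    have uS: "u \<in> S" "(u, v) \<in> A" "(v, u) \<in> A" using u by (auto simp: outs_def ins_def)
    have "\<exists>p. distinct p \<and> set p = insert v S \<and> A \<inter> insert v S \<times> insert v S = sym_arcs p"
      if "card (A \<inter> insert v S \<times> insert v S) + 2 = 2 * card (insert v S)"
    proof -
      from that card cS have "card (A \<inter> S \<times> S) + 2 = 2 * card S" by simp
      then obtain p where p: "distinct p" "set p = S" "A \<inter> S \<times> S = sym_arcs p" using IH by blast
      have "u = hd p \<or> u = last p"
        by (rule nbr_of_symmetric_path[of p u v]) (use p uS low conn_insert.hyps in \<open>auto simp: adj_def\<close>)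
      then obtain p' where p': "distinct p'" "set p' = S" "A \<inter> S \<times> S = sym_arcs p'" "u = hd p'"
        using p that by (metis distinct_rev hd_rev set_rev sym_arcs_rev)
      have "p' \<noteq> []" using p'(2) uS by auto
      then show ?thesis
        using p' u arcs_insert[OF conn_insert.hyps(2)] conn_insert.hyps(2)
        by (intro exI[of _ "v # p'"]) (auto simp: sym_arcs_Cons)
    qed
    then show ?case using card cS IH by auto
  next
    fix p q xs
    assume pq: "outs v \<inter> S = {q}" "ins v \<inter> S = {p}" "p \<noteq> q" and xs: "link S q p xs"
      "\<And>i. Suc i < length xs \<Longrightarrow> (xs ! i, xs ! Suc i) \<in> A \<and> (xs ! Suc i, xs ! i) \<notin> A"
    \<comment> \<open>Two arcs are added here as well, but the simple arcs of the detour show that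
      \<open>S\<close> was not extremal, so the inequality for \<open>S\<close> is already
      strict.\<close>
    have card: "card (A \<inter> insert v S \<times> insert v S) = card (A \<inter> S \<times> S) + 2" using ca pq by simp
    have "length xs > 1" using xs(1) \<open>p \<noteq> q\<close> by (cases xs; cases "tl xs") (auto simp: link_def)
    then have "(xs ! 0, xs ! 1) \<in> A" "(xs ! 1, xs ! 0) \<notin> A"
      using xs(2)[of 0] by simp_all
    moreover have sub: "set xs \<subseteq> S" using xs(1) by (simp add: link_def)
    have "xs ! 0 \<in> S" "xs ! 1 \<in> S" 
      by (rule subsetD[OF sub nth_mem], use \<open>length xs > 1\<close> in linarith)+
    ultimately have "(xs ! 0, xs ! 1) \<in> A \<inter> S \<times> S" "(xs ! 1, xs ! 0) \<notin> A \<inter> S \<times> S" by auto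
    then have "A \<inter> S \<times> S \<noteq> sym_arcs p" for p using sym_arcs_sym by fast
    then show ?case using card cS IH by auto
  qed
qed

text \<open>Both paths are listed towards the simple arc, so \<open>hd p\<close> and
  \<open>hd q\<close> are the free ends.\<close>

definition bridge_form :: "'a set \<Rightarrow> 'a list \<Rightarrow> 'a list \<Rightarrow> bool" where
  "bridge_form S p q \<longleftrightarrow> p \<noteq> [] \<and> q \<noteq> [] \<and> distinct (p @ q) \<and> S = set p \<union> set q \<and>
     A \<inter> S \<times> S = {(last p, last q)} \<union> sym_arcs p \<union> sym_arcs q"

text \<open>The future rim of a wheel with its spokes; the heads are the ends that will meet the
  hub.\<close>

definition triangle_form :: "'a set \<Rightarrow> 'a list \<Rightarrow> 'a list \<Rightarrow> 'a list \<Rightarrow> bool" where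
  "triangle_form S p q r \<longleftrightarrow> p \<noteq> [] \<and> q \<noteq> [] \<and> r \<noteq> [] \<and> distinct (p @ q @ r) \<and>
     S = set p \<union> set q \<union> set r \<and>
     A \<inter> S \<times> S = {(last p, last q), (last q, last r), (last r, last p)}
       \<union> sym_arcs p \<union> sym_arcs q \<union> sym_arcs r"

lemma bridge_formD:
  assumes "bridge_form S p q"
  shows "p \<noteq> []" "q \<noteq> []" "distinct (p @ q)" "S = set p \<union> set q"
    "A \<inter> S \<times> S = {(last p, last q)} \<union> sym_arcs p \<union> sym_arcs q"
  using assms[unfolded bridge_form_def] by - (elim conjE, assumption)+

lemma triangle_formD:
  assumes "triangle_form S p q r"
  shows "p \<noteq> []" "q \<noteq> []" "r \<noteq> []" "distinct (p @ q @ r)" "S = set p \<union> set q \<union> set r"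
    "A \<inter> S \<times> S = {(last p, last q), (last q, last r), (last r, last p)}
       \<union> sym_arcs p \<union> sym_arcs q \<union> sym_arcs r"
  using assms[unfolded triangle_form_def] by - (elim conjE, assumption)+

lemma triangle_form_rotate:
  assumes "triangle_form S p q r"
  shows "triangle_form S q r p"
proof -
  note F = triangle_formD[OF assms]
  have "distinct (q @ r @ p)" using F(4) by auto
  moreover have "S = set q \<union> set r \<union> set p" using F(5) by blast
  moreover have "A \<inter> S \<times> S = {(last q, last r), (last r, last p), (last p, last q)}
       \<union> sym_arcs q \<union> sym_arcs r \<union> sym_arcs p" unfolding F(6) by blast
  ultimately show ?thesis unfolding triangle_form_def using F(1-3) by blast
qed

text \<open>Deficit 3 arises when one arc attaches a vertex to a symmetric path, giving a bridge.
  Afterwards every new vertex brings two arcs: a digon prolongs a path at its free end, and a detour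
  turns the bridge into a triangle. A detour at a triangle would produce a diamond.\<close>

lemma near_symmetric_conn:
  assumes "conn S" "\<And>u. u \<in> S \<Longrightarrow> low u" "card (A \<inter> S \<times> S) + 3 = 2 * card S"
  shows "(\<exists>p q. bridge_form S p q) \<or> (\<exists>p q r. triangle_form S p q r)"
  using assms
proof induction
  case (conn_single a)
  have "A \<inter> {a} \<times> {a} = {}" using loopfree by auto
  with conn_single show ?case by simp
next
  case (conn_insert S v u)
  have low: "\<And>u. u \<in> S \<Longrightarrow> low u" "low v" using conn_insert.prems by auto
  have IH: "(\<exists>p q. bridge_form S p q) \<or> (\<exists>p q r. triangle_form S p q r)"
    if "card (A \<inter> S \<times> S) + 3 = 2 * card S"
    using conn_insert.IH low(1) that by blast
  have fS: "finite S" using conn_finite conn_insert.hyps by blast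
  have cS: "card (insert v S) = Suc (card S)" using fS conn_insert.hyps by simp
  note ca = card_arcs_insert[OF conn_insert.hyps(2)]
  note ai = arcs_insert[OF conn_insert.hyps(2)]
  have vS: "v \<notin> S" by fact
  have path: "\<exists>p. p \<noteq> [] \<and> distinct p \<and> set p = S \<and> A \<inter> S \<times> S = sym_arcs p \<and> u = last p"
    if u: "u \<in> S" "adj u v" and c: "card (A \<inter> S \<times> S) + 2 = 2 * card S" for u
  proof -
    obtain p where p: "distinct p" "set p = S" "A \<inter> S \<times> S = sym_arcs p"
      using arcs_in_conn[OF conn_insert.hyps(1) low(1)] c by blast
    have "u = hd p \<or> u = last p"
      by (rule nbr_of_symmetric_path[of p u v]) (use p u low vS in auto)
    moreover have "p \<noteq> []" using p u by auto
    ultimately show ?thesis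
    proof (elim disjE)
      assume "u = hd p" "p \<noteq> []"
      then show ?thesis using p by (intro exI[of _ "rev p"]) (auto simp: last_rev)
    qed (use p in auto)
  qed
  show ?case
  proof (rule attach_cases[OF conn_insert.hyps(1) low(1) conn_insert.hyps(2) low(2) conn_insert.hyps(3,4)])
    fix u assume u: "outs v \<inter> S = {u}" "ins v \<inter> S = {}"
    then have "card (A \<inter> S \<times> S) + 2 = 2 * card S" using ca cS conn_insert.prems(2) by simp
    moreover have "u \<in> S" "adj u v" using u by (auto simp: outs_def adj_def)
    ultimately obtain p where p: "p \<noteq> []" "distinct p" "set p = S" "A \<inter> S \<times> S = sym_arcs p" "u = last p"
      using path by blast
    have "bridge_form (insert v S) [v] p"
      unfolding bridge_form_def using p vS u ai by auto
    then show ?case by blast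
  next
    fix u assume u: "outs v \<inter> S = {}" "ins v \<inter> S = {u}"
    then have "card (A \<inter> S \<times> S) + 2 = 2 * card S" using ca cS conn_insert.prems(2) by simp
    moreover have "u \<in> S" "adj u v" using u by (auto simp: ins_def adj_def)
    ultimately obtain p where p: "p \<noteq> []" "distinct p" "set p = S" "A \<inter> S \<times> S = sym_arcs p" "u = last p"
      using path by blast
    have "bridge_form (insert v S) p [v]"
      unfolding bridge_form_def using p vS u ai by auto
    then show ?case by blast
  next
    fix u assume u: "outs v \<inter> S = {u}" "ins v \<inter> S = {u}"
    have uS: "u \<in> S" "(u, v) \<in> A" "(v, u) \<in> A" using u by (auto simp: outs_def ins_def)
    have "card (A \<inter> S \<times> S) + 3 = 2 * card S" using u ca cS conn_insert.prems(2) by simp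
    from IH[OF this] show ?case
    proof (elim disjE exE)
      fix p q assume F: "bridge_form S p q"
      note F' = bridge_formD[OF F]
      have lpq: "(last p, last q) \<in> A" "sym_arcs p \<subseteq> A" "sym_arcs q \<subseteq> A"
        "last p \<in> set p" "last q \<in> set q" "set p \<inter> set q = {}"
        "distinct p" "distinct q" "v \<notin> set p" "v \<notin> set q"
        using F' vS by (blast, blast, blast, simp_all)
      consider "u \<in> set p" | "u \<in> set q" using F uS unfolding bridge_form_def by blast
      then show ?case
      proof cases
        case 1
        then have "u = hd p"
          using digon_to_symmetric_path[of p u v "last q"] lpq uS low
          by (auto simp: adj_def)
        then have "A \<inter> insert v S \<times> insert v S = {(last (v # p), last q)} \<union> sym_arcs (v # p) \<union> sym_arcs q"
          unfolding ai u F'(5) sym_arcs_Cons[OF F'(1)] using F'(1) by auto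
        then have "bridge_form (insert v S) (v # p) q"
          unfolding bridge_form_def using F'(1-4) vS by simp
        then show ?thesis by blast
      next
        case 2
        then have "u = hd q"
          using digon_to_symmetric_path[of q u v "last p"] lpq uS low
          by (auto simp: adj_def)
        then have "A \<inter> insert v S \<times> insert v S = {(last p, last (v # q))} \<union> sym_arcs p \<union> sym_arcs (v # q)"
          unfolding ai u F'(5) sym_arcs_Cons[OF F'(2)] using F'(2) by auto
        then have "bridge_form (insert v S) p (v # q)"
          unfolding bridge_form_def using F'(1-4) vS by simp
        then show ?thesis by blast
      qed
    next
      fix a b c assume T: "triangle_form S a b c"
      then consider "u \<in> set a" | "u \<in> set b" | "u \<in> set c"
        using uS(1) unfolding triangle_form_def by auto
      then obtain p q r where F: "triangle_form S p q r" "u \<in> set p"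
      proof cases
        case 1 show ?thesis by (rule that[OF T 1])
      next
        case 2 show ?thesis by (rule that[OF triangle_form_rotate[OF T] 2])
      next
        case 3 show ?thesis by (rule that[OF triangle_form_rotate[OF triangle_form_rotate[OF T]] 3])
      qed
      note F' = triangle_formD[OF F(1)]
      have lpq: "(last p, last q) \<in> A" "sym_arcs p \<subseteq> A" using F'(6) by blast+
      have lpq': "last p \<in> set p" "last q \<in> set q" "set p \<inter> set q = {}"
        "distinct p" "v \<notin> set p" "v \<notin> set q"
        using F'(1-5) vS by auto
      note lpq = lpq lpq'
      have "u = hd p"
        using digon_to_symmetric_path[of p u v "last q"] F(2) lpq uS low
        by (auto simp: adj_def)
      then have "A \<inter> insert v S \<times> insert v S =
          {(last (v # p), last q), (last q, last r), (last r, last (v # p))}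
           \<union> sym_arcs (v # p) \<union> sym_arcs q \<union> sym_arcs r"
        unfolding ai u F'(6) sym_arcs_Cons[OF F'(1)] using F'(1) by auto
      then have "triangle_form (insert v S) (v # p) q r"
        unfolding triangle_form_def using F'(1-5) vS by simp
      then show ?case by blast
    qed
  next
    fix d e xs
    assume de: "outs v \<inter> S = {e}" "ins v \<inter> S = {d}" "d \<noteq> e" and xs: "link S e d xs"
      "\<And>i. Suc i < length xs \<Longrightarrow> (xs ! i, xs ! Suc i) \<in> A \<and> (xs ! Suc i, xs ! i) \<notin> A"
    have len: "length xs > 1" using xs(1) \<open>d \<noteq> e\<close> by (cases xs; cases "tl xs") (auto simp: link_def)
    have ends: "xs ! 0 = e" "xs ! (length xs - 1) = d"
      using xs(1) by (auto simp: link_def hd_conv_nth last_conv_nth)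
    have arcs: "(xs ! i, xs ! Suc i) \<in> A \<inter> S \<times> S" "(xs ! Suc i, xs ! i) \<notin> A" if "Suc i < length xs" for i
    proof -
      have sub: "set xs \<subseteq> S" using xs(1) by (simp add: link_def)
      have "xs ! i \<in> S" "xs ! Suc i \<in> S" 
        by (rule subsetD[OF sub nth_mem], use that in linarith)+
      then show "(xs ! i, xs ! Suc i) \<in> A \<inter> S \<times> S" "(xs ! Suc i, xs ! i) \<notin> A" using xs(2)[OF that] by auto
    qed
    have "card (A \<inter> S \<times> S) + 3 = 2 * card S" using de ca cS conn_insert.prems(2) by simp
    from IH[OF this] show ?case
    proof (elim disjE exE)
      fix p q assume F: "bridge_form S p q"
      have sub: "sym_arcs p \<union> sym_arcs q \<subseteq> A" using bridge_formD(5)[OF F] by blast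
      have simple: "(a, b) = (last p, last q)" if "(a, b) \<in> A \<inter> S \<times> S" "(b, a) \<notin> A" for a b
        using that sub sym_arcs_sym[of a b p] sym_arcs_sym[of a b q] unfolding bridge_formD(5)[OF F] by blast
      have "last p \<noteq> last q"
        using bridge_formD(1-3)[OF F] by (metis disjoint_iff distinct_append last_in_set)
      \<comment> \<open>A detour consists of simple arcs, and the bridge is the only one, so it
        cannot be followed by another.\<close>
      have "\<not> Suc 1 < length xs"
        using simple[OF arcs[of 0]] simple[OF arcs[of 1]] len \<open>last p \<noteq> last q\<close> by auto
      then have "length xs = 2" using len by simp
      then have "e = last p" "d = last q" using simple[OF arcs[of 0]] ends by auto
      then have "triangle_form (insert v S) p q [v]"
        unfolding triangle_form_def ai de bridge_formD(5)[OF F] using bridge_formD(1-4)[OF F] vS by auto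
      then show ?case by blast
    next
      fix p q r assume F: "triangle_form S p q r"
      let ?T = "{last p, last q, last r}"
      have sub: "sym_arcs p \<union> sym_arcs q \<union> sym_arcs r \<subseteq> A" using triangle_formD(6)[OF F] by blast
      have simple: "a \<in> ?T \<and> b \<in> ?T" if "(a, b) \<in> A \<inter> S \<times> S" "(b, a) \<notin> A" for a b
        using that sub sym_arcs_sym[of a b p] sym_arcs_sym[of a b q] sym_arcs_sym[of a b r]
        unfolding triangle_formD(6)[OF F] by blast
      have "e \<in> ?T" using simple[OF arcs[of 0]] len ends by auto
      moreover have "d \<in> ?T"
        using simple[OF arcs[of "length xs - 2"]] len ends by (simp add: Suc_diff_Suc numeral_2_eq_2)
      moreover have T: "?T \<subseteq> S" "last p \<noteq> last q" "last q \<noteq> last r" "last r \<noteq> last p"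
      proof -
        have l: "last p \<in> set p" "last q \<in> set q" "last r \<in> set r" using triangle_formD(1-3)[OF F] by simp_all
        have d: "set p \<inter> set q = {}" "set q \<inter> set r = {}" "set p \<inter> set r = {}"
          using triangle_formD(4)[OF F] by auto
        show "?T \<subseteq> S" using l triangle_formD(5)[OF F] by blast
        show "last p \<noteq> last q" "last q \<noteq> last r" "last r \<noteq> last p"
          using l d by (metis disjoint_iff)+
      qed
      moreover have "adj (last p) (last q)" "adj (last q) (last r)" "adj (last r) (last p)"
        using triangle_formD(6)[OF F] unfolding adj_def by blast+
      moreover have "adj d v" "adj e v" using de by (auto simp: outs_def ins_def adj_def)
      \<comment> \<open>Both ends of the detour are corners of the triangle; \<open>c\<close> is the
        third corner, and it forms a diamond with them and \<open>v\<close>.\<close>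
      ultimately obtain c where "c \<in> S" "c \<noteq> d" "c \<noteq> e" "adj d e" "adj d c" "adj e c" "adj d v" "adj e v" "d \<in> S" "e \<in> S"
        using de(3) adj_sym by (smt (verit) insert_iff empty_iff subset_iff)
      then show ?case
        using no_diamond[of d e c v] low vS de(3) by auto
    qed
  qed
qed

end

section \<open>One exceptional vertex\<close>

lemma exactly_one_excess:
  fixes g :: "'a \<Rightarrow> nat"
  assumes "finite X" "\<And>v. v \<in> X \<Longrightarrow> 2 \<le> g v" "sum g X \<le> 2 * card X + 1"
  shows "(\<forall>v \<in> X. g v = 2) \<and> sum g X = 2 * card X \<or>
    (\<exists>s \<in> X. g s = 3 \<and> (\<forall>v \<in> X - {s}. g v = 2)) \<and> sum g X = 2 * card X + 1"
proof -
  have "sum g X = sum (\<lambda>v. 2 + (g v - 2)) X" by (intro sum.cong refl) (simp only: le_add_diff_inverse assms(2))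
  then have s: "sum g X = 2 * card X + (\<Sum>v\<in>X. g v - 2)" by (simp only: sum.distrib) simp
  show ?thesis
  proof (cases "(\<Sum>v\<in>X. g v - 2) = 0")
    case True
    then have "\<forall>v\<in>X. g v = 2" using assms(1,2) by (simp add: le_antisym)
    then show ?thesis using True s by simp
  next
    case False
    then have 1: "(\<Sum>v\<in>X. g v - 2) = 1" using s assms(3) by linarith
    then obtain a where a: "a \<in> X" "g a - 2 = 1" "\<forall>b\<in>X. a \<noteq> b \<longrightarrow> g b - 2 = 0"
      using sum_eq_1_iff[OF assms(1), of "\<lambda>v. g v - 2"] by auto
    have "g a = 3" using a(2) by linarith
    moreover have "\<forall>v\<in>X - {a}. g v = 2" using a(3) assms(2) by (auto simp: le_antisym)
    ultimately show ?thesis using a(1) s 1 by auto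
  qed
qed

lemma acyclic_empty [simp]: "acyclic {}"
  by (simp add: wf_acyclic)

lemma acyclic_arc: "a \<noteq> b \<Longrightarrow> acyclic {(a, b)}"
  by simp

lemma hd_sym_arcs: "distinct p \<Longrightarrow> (hd p, w) \<in> sym_arcs p \<Longrightarrow> w = hd (tl p)"
  using hd_in_sym_arcs_iff[of "hd p" "tl p" w] by (cases p) auto

lemma singleton_if_hd_eq_last:
  assumes "distinct p" "p \<noteq> []" "hd p = last p"
  shows "p = [hd p]"
proof (cases p)
  case (Cons a l)
  have "l = []"
  proof (rule ccontr)
    assume "l \<noteq> []"
    then have "last l \<in> set l" by simp
    with Cons assms \<open>l \<noteq> []\<close> show False by simp
  qed
  with Cons show ?thesis by simp
qed (use assms in simp)

lemma sym_arcs_if_hd_eq_last: "distinct p \<Longrightarrow> hd p = last p \<Longrightarrow> sym_arcs p = {}"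
  using singleton_if_hd_eq_last[of p] by (metis sym_arcs_Nil sym_arcs_single)

lemma last_sym_arcs: "distinct p \<Longrightarrow> (last p, w) \<in> sym_arcs p \<Longrightarrow> w = hd (tl (rev p))"
  using hd_sym_arcs[of "rev p" w] by (simp add: hd_rev)

text \<open>Each leg is coloured alternately from the same colour at \<open>x\<close>, its only
  vertex on the other legs, so the three colourings fit together. As \<open>x\<close> is not
  counted, \<open>length p\<close> is the number of edges of its leg.\<close>

lemma star_colouring:
  assumes "distinct (x # p @ q @ r)"
  shows "\<exists>f::'a \<Rightarrow> bool. (\<forall>(u, w) \<in> sym_arcs (x # p) \<union> sym_arcs (x # q) \<union> sym_arcs (x # r). f u \<noteq> f w) \<and>
    (f (last (x # p)) \<longleftrightarrow> even (length p)) \<and> (f (last (x # q)) \<longleftrightarrow> even (length q)) \<and>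
    (f (last (x # r)) \<longleftrightarrow> even (length r))"
proof -
  have ex: "\<exists>f::'a \<Rightarrow> bool. f x \<and> (\<forall>u w. (u, w) \<in> sym_arcs (x # p) \<longrightarrow> f u \<noteq> f w) \<and>
      (f (last (x # p)) \<longleftrightarrow> even (length p))"
    if d: "distinct (x # p)" for p
  proof -
    obtain f :: "'a \<Rightarrow> bool" where f: "f (hd (x # p)) = True" "\<forall>(u, w) \<in> sym_arcs (x # p). f u \<noteq> f w"
      "f (last (x # p)) = True \<longleftrightarrow> odd (length (x # p))"
      using alternating_colouring[OF d, of True] by blast
    have "f x" "f (last (x # p)) \<longleftrightarrow> even (length p)" using f(1,3) by simp_all
    moreover have "\<forall>u w. (u, w) \<in> sym_arcs (x # p) \<longrightarrow> f u \<noteq> f w" using f(2) by blast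
    ultimately show ?thesis by blast
  qed
  have d: "distinct (x # p)" "distinct (x # q)" "distinct (x # r)" using assms by auto
  obtain f where f: "f x" "\<forall>u w. (u, w) \<in> sym_arcs (x # p) \<longrightarrow> f u \<noteq> f w" "f (last (x # p)) \<longleftrightarrow> even (length p)"
    using ex[OF d(1)] by blast
  obtain g where g: "g x" "\<forall>u w. (u, w) \<in> sym_arcs (x # q) \<longrightarrow> g u \<noteq> g w" "g (last (x # q)) \<longleftrightarrow> even (length q)"
    using ex[OF d(2)] by blast
  obtain h where h: "h x" "\<forall>u w. (u, w) \<in> sym_arcs (x # r) \<longrightarrow> h u \<noteq> h w" "h (last (x # r)) \<longleftrightarrow> even (length r)"
    using ex[OF d(3)] by blast
  define k where "k = (\<lambda>u. if u \<in> set p then f u else if u \<in> set q then g u else h u)"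
  have kp: "k u = f u" if "u \<in> set (x # p)" for u using that assms f(1) g(1) h(1) by (auto simp: k_def)
  have kq: "k u = g u" if "u \<in> set (x # q)" for u using that assms f(1) g(1) h(1) by (auto simp: k_def)
  have kr: "k u = h u" if "u \<in> set (x # r)" for u using that assms f(1) g(1) h(1) by (auto simp: k_def)
  have "k u \<noteq> k w" if "(u, w) \<in> sym_arcs (x # p) \<union> sym_arcs (x # q) \<union> sym_arcs (x # r)" for u w
    using that
  proof (elim UnE)
    assume "(u, w) \<in> sym_arcs (x # p)"
    then show ?thesis using f(2) kp sym_arcs_in_set by metis
  next
    assume "(u, w) \<in> sym_arcs (x # q)"
    then show ?thesis using g(2) kq sym_arcs_in_set by metis
  next
    assume "(u, w) \<in> sym_arcs (x # r)"
    then show ?thesis using h(2) kr sym_arcs_in_set by metis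
  qed
  moreover have "k (last (x # p)) = f (last (x # p))" "k (last (x # q)) = g (last (x # q))"
    "k (last (x # r)) = h (last (x # r))"
    by (intro kp kq kr last_in_set; simp)+
  ultimately show ?thesis using f(3) g(3) h(3) by (intro exI[of _ k]) blast
qed

context dicrit
begin

section \<open>Double counting of arcs, and components\<close>

lemma card_arcs_Times:
  assumes "finite X" "finite Y"
  shows "card (A \<inter> X \<times> Y) = (\<Sum>u\<in>X. card (outs u \<inter> Y))" "card (A \<inter> X \<times> Y) = (\<Sum>w\<in>Y. card (ins w \<inter> X))"
proof -
  have "A \<inter> X \<times> Y = Sigma X (\<lambda>u. outs u \<inter> Y)" by (auto simp: outs_def)
  then show "card (A \<inter> X \<times> Y) = (\<Sum>u\<in>X. card (outs u \<inter> Y))" using assms by simp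
  have "A \<inter> X \<times> Y = (Sigma Y (\<lambda>w. ins w \<inter> X))\<inverse>" by (auto simp: ins_def)
  then show "card (A \<inter> X \<times> Y) = (\<Sum>w\<in>Y. card (ins w \<inter> X))" using assms by simp
qed

lemma sum_degrees: "(\<Sum>v\<in>V. card (outs v)) = card A" "(\<Sum>v\<in>V. card (ins v)) = card A"
proof -
  have "A \<inter> V \<times> V = A" "\<And>v. outs v \<inter> V = outs v" "\<And>v. ins v \<inter> V = ins v"
    using A_subset outs_subset ins_subset by blast+
  then show "(\<Sum>v\<in>V. card (outs v)) = card A" "(\<Sum>v\<in>V. card (ins v)) = card A"
    using card_arcs_Times[OF finite_V finite_V] by simp_all
qed

text \<open>Every vertex of \<open>S\<close> emits two arcs, and each of them ends in
  \<open>S\<close> or in \<open>T\<close>.\<close>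

lemma boundary_ins:
  assumes "finite S" "finite T" "S \<inter> T = {}" "\<And>u. u \<in> S \<Longrightarrow> low u" "\<And>u. u \<in> S \<Longrightarrow> outs u \<subseteq> S \<union> T"
  shows "card (A \<inter> S \<times> S) + (\<Sum>x\<in>T. card (ins x \<inter> S)) = 2 * card S"
proof -
  have "card (A \<inter> S \<times> (S \<union> T)) = (\<Sum>u\<in>S. card (outs u \<inter> (S \<union> T)))"
    using card_arcs_Times(1) assms by simp
  also have "\<dots> = (\<Sum>u\<in>S. 2)"
    using assms(4,5) by (intro sum.cong) (auto simp: low_def Int_absorb2)
  finally have "card (A \<inter> S \<times> (S \<union> T)) = 2 * card S" by simp
  moreover have "A \<inter> S \<times> (S \<union> T) = A \<inter> S \<times> S \<union> A \<inter> S \<times> T" by blast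
  moreover have "card (A \<inter> S \<times> S \<union> A \<inter> S \<times> T) = card (A \<inter> S \<times> S) + card (A \<inter> S \<times> T)"
    by (rule card_Un_disjoint) (use assms(3) finite_A in auto)
  ultimately show ?thesis using card_arcs_Times(2)[OF assms(1,2)] by simp
qed

lemma boundary_outs:
  assumes "finite S" "finite T" "S \<inter> T = {}" "\<And>u. u \<in> S \<Longrightarrow> low u" "\<And>u. u \<in> S \<Longrightarrow> ins u \<subseteq> S \<union> T"
  shows "card (A \<inter> S \<times> S) + (\<Sum>x\<in>T. card (outs x \<inter> S)) = 2 * card S"
proof -
  interpret C: dicrit V "A\<inverse>" by (rule dicrit_converse) unfold_locales
  have "A\<inverse> \<inter> S \<times> S = (A \<inter> S \<times> S)\<inverse>" by auto
  then show ?thesis using C.boundary_ins[OF assms(1,2,3)] assms(4,5) unfolding converse_defs by simp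
qed

lemma component:
  assumes "finite W" "w \<in> W"
  obtains K where "conn K" "w \<in> K" "K \<subseteq> W" "\<And>u z. u \<in> K \<Longrightarrow> z \<in> W - K \<Longrightarrow> \<not> adj u z"
proof -
  let ?P = "\<lambda>K. conn K \<and> w \<in> K \<and> K \<subseteq> W"
  have w: "?P {w}" using conn_single assms by auto
  have "\<forall>K. ?P K \<longrightarrow> card K < Suc (card W)" using card_mono[OF assms(1)] le_imp_less_Suc by blast
  from ex_has_greatest_nat[of ?P, OF w this] obtain K where
    K: "conn K" "w \<in> K" "K \<subseteq> W" and max: "\<And>L. conn L \<Longrightarrow> w \<in> L \<Longrightarrow> L \<subseteq> W \<Longrightarrow> card L \<le> card K"
    by metis
  have "\<not> adj u z" if "u \<in> K" "z \<in> W - K" for u z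
  proof
    assume "adj u z"
    then have "adj z u" using adj_sym by blast
    then have "conn (insert z K)" using K(1) that conn_insert by blast
    then have "card (insert z K) \<le> card K" using max[of "insert z K"] K that by blast
    then show False using that conn_finite[OF K(1)] by simp
  qed
  then show ?thesis using that K by blast
qed

text \<open>Colour the three legs alternately from \<open>x\<close>. If the rim vertices do not all
  agree, at most one rim arc is monochromatic, and the digraph would be coloured. So the legs have
  equal parity; an empty \<open>p\<close> encodes a leg of length 0.\<close>

lemma wheel_parity:
  assumes A: "A = {(a, b), (b, c), (c, a)} \<union> sym_arcs (x # p) \<union> sym_arcs (x # q) \<union> sym_arcs (x # r)"
    and d: "distinct (x # p @ q @ r)" "distinct [a, b, c]"
    and l: "a = last (x # p)" "b = last (x # q)" "c = last (x # r)"
  shows "even (length p) = even (length q)" "even (length q) = even (length r)"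
proof -
  obtain f :: "'a \<Rightarrow> bool" where
    f: "\<forall>(u, w) \<in> sym_arcs (x # p) \<union> sym_arcs (x # q) \<union> sym_arcs (x # r). f u \<noteq> f w"
    and fl: "f (last (x # p)) \<longleftrightarrow> even (length p)" "f (last (x # q)) \<longleftrightarrow> even (length q)"
      "f (last (x # r)) \<longleftrightarrow> even (length r)"
    using star_colouring[OF d(1)] by (elim exE conjE) (rule that)
  note fl = fl[folded l]
  have m: "mono_arcs A f \<subseteq> {(u, w) \<in> {(a, b), (b, c), (c, a)}. f u = f w}"
  proof
    fix e assume "e \<in> mono_arcs A f"
    then obtain u w where "e = (u, w)" "(u, w) \<in> A" "f u = f w" by (auto simp: mono_arcs_def)
    moreover from this have "(u, w) \<notin> sym_arcs (x # p) \<union> sym_arcs (x # q) \<union> sym_arcs (x # r)" using f by blast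
    ultimately show "e \<in> {(u, w) \<in> {(a, b), (b, c), (c, a)}. f u = f w}" unfolding A by blast
  qed
  have "f a = f b \<and> f b = f c"
  proof (rule ccontr)
    assume "\<not> ?thesis"
    then consider "f a \<noteq> f b" "f b \<noteq> f c" | "f a \<noteq> f b" "f c \<noteq> f a" | "f b \<noteq> f c" "f c \<noteq> f a" by blast
    then have "\<exists>u w. u \<noteq> w \<and> mono_arcs A f \<subseteq> {(u, w)}"
    proof cases
      case 1
      then have "mono_arcs A f \<subseteq> {(c, a)}" using m by blast
      moreover have "c \<noteq> a" using d(2) by auto
      ultimately show ?thesis by blast
    next
      case 2
      then have "mono_arcs A f \<subseteq> {(b, c)}" using m by blast
      moreover have "b \<noteq> c" using d(2) by auto
      ultimately show ?thesis by blast
    next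
      case 3
      then have "mono_arcs A f \<subseteq> {(a, b)}" using m by blast
      moreover have "a \<noteq> b" using d(2) by auto
      ultimately show ?thesis by blast
    qed
    then show False using not_colourable acyclic_arc acyclic_subset by metis
  qed
  then show "even (length p) = even (length q)" "even (length q) = even (length r)" using fl by simp_all
qed

end

text \<open>\<open>x\<close> may itself be low. Thus the case without excess is covered too, with an
  arbitrary vertex as \<open>x\<close>.\<close>

locale one_exceptional = dicrit V A for V :: "'a set" and A +
  fixes x :: 'a
  assumes x_V: "x \<in> V" and others_low: "v \<in> V \<Longrightarrow> v \<noteq> x \<Longrightarrow> low v"
    and x_le_3: "card (ins x) \<le> 3"
begin

abbreviation "S \<equiv> V - {x}"

lemma outs_S: "u \<in> V \<Longrightarrow> outs u \<inter> S \<subseteq> {z} \<Longrightarrow> u \<noteq> x \<Longrightarrow> (u, x) \<in> A"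
proof (rule ccontr)
  assume *: "u \<in> V" "outs u \<inter> S \<subseteq> {z}" "u \<noteq> x" "(u, x) \<notin> A"
  then have "outs u \<subseteq> {z}" using outs_subset[of u] by (auto simp: outs_def)
  then have "card (outs u) \<le> 1" using card_mono[of "{z}"] by simp
  then show False using others_low * by (simp add: low_def)
qed

lemma ins_S: "u \<in> V \<Longrightarrow> ins u \<inter> S \<subseteq> {z} \<Longrightarrow> u \<noteq> x \<Longrightarrow> (x, u) \<in> A"
proof (rule ccontr)
  assume *: "u \<in> V" "ins u \<inter> S \<subseteq> {z}" "u \<noteq> x" "(x, u) \<notin> A"
  then have "ins u \<subseteq> {z}" using ins_subset[of u] by (auto simp: ins_def)
  then have "card (ins u) \<le> 1" using card_mono[of "{z}"] by simp
  then show False using others_low * by (simp add: low_def)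
qed

text \<open>By the arc bound each component of \<open>S\<close> sends at least two arcs to
  \<open>x\<close>; two components would need in-degree 4.\<close>

lemma conn_S: "conn S"
proof -
  have fS: "finite S" using finite_V by simp
  have "card (outs x) \<ge> 2" using two_outs_ge x_V by blast
  then have "outs x \<noteq> {}" by auto
  moreover have "outs x \<subseteq> S" using outs_subset[of x] loopfree by (auto simp: outs_def)
  ultimately obtain w where w: "w \<in> S" by blast
  obtain K where K: "conn K" "w \<in> K" "K \<subseteq> S" "\<And>u z. u \<in> K \<Longrightarrow> z \<in> S - K \<Longrightarrow> \<not> adj u z"
    using component[OF fS w] by blast
  have b: "2 \<le> card (ins x \<inter> L)"
    if L: "conn L" "L \<subseteq> S" "\<And>u z. u \<in> L \<Longrightarrow> z \<in> S - L \<Longrightarrow> \<not> adj u z" for L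
  proof -
    have low: "\<And>u. u \<in> L \<Longrightarrow> low u" using L(2) others_low by blast
    have "outs u \<subseteq> L \<union> {x}" if "u \<in> L" for u
      using L(3)[OF that] outs_subset[of u] by (auto simp: outs_def adj_def)
    then have "card (A \<inter> L \<times> L) + (\<Sum>x\<in>{x}. card (ins x \<inter> L)) = 2 * card L"
      using L(1,2) low conn_finite by (intro boundary_ins) auto
    then show ?thesis using arcs_in_conn[OF L(1) low] by simp
  qed
  have "K = S"
  proof (rule ccontr)
    assume "K \<noteq> S"
    then obtain y where y: "y \<in> S - K" using K(3) by blast
    obtain L where L: "conn L" "y \<in> L" "L \<subseteq> S - K" "\<And>u z. u \<in> L \<Longrightarrow> z \<in> S - K - L \<Longrightarrow> \<not> adj u z"
      using component[of "S - K" y] fS y by blast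
    have "\<not> adj u z" if "u \<in> L" "z \<in> S - L" for u z
      using that L(3,4) K(4) adj_sym by blast
    then have "2 \<le> card (ins x \<inter> L)" using b L by blast
    moreover have "2 \<le> card (ins x \<inter> K)" using b K by blast
    moreover have "card (ins x \<inter> K \<union> ins x \<inter> L) = card (ins x \<inter> K) + card (ins x \<inter> L)"
      by (rule card_Un_disjoint) (use L(3) in auto)
    moreover have "card (ins x \<inter> K \<union> ins x \<inter> L) \<le> card (ins x)" by (rule card_mono) auto
    ultimately show False using x_le_3 by linarith
  qed
  then show ?thesis using K(1) by simp
qed

lemma card_arcs_S: "card (A \<inter> S \<times> S) + card (ins x) = 2 * card S"
  "card (A \<inter> S \<times> S) + card (outs x) = 2 * card S"
proof -
  have fS: "finite S" using finite_V by simp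
  have low: "\<And>u. u \<in> S \<Longrightarrow> low u" using others_low by blast
  have "ins x \<inter> S = ins x" "outs x \<inter> S = outs x"
    using ins_subset[of x] outs_subset[of x] loopfree by (auto simp: outs_def ins_def)
  moreover have "card (A \<inter> S \<times> S) + (\<Sum>x\<in>{x}. card (ins x \<inter> S)) = 2 * card S"
    using fS low outs_subset by (intro boundary_ins) auto
  moreover have "card (A \<inter> S \<times> S) + (\<Sum>x\<in>{x}. card (outs x \<inter> S)) = 2 * card S"
    using fS low ins_subset by (intro boundary_outs) auto
  ultimately show "card (A \<inter> S \<times> S) + card (ins x) = 2 * card S"
    "card (A \<inter> S \<times> S) + card (outs x) = 2 * card S" by simp_all
qed

lemma A_eq: "A = A \<inter> S \<times> S \<union> {x} \<times> outs x \<union> ins x \<times> {x}"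
  using A_subset loopfree by (auto simp: outs_def ins_def)

text \<open>Then \<open>S\<close> is extremal, a symmetric path, and the degrees of its ends force
  digons to \<open>x\<close>. The result is a symmetric cycle: odd length is excluded, and an even
  one is coloured alternately.\<close>

lemma card_ins_x_neq_2: "card (ins x) \<noteq> 2"
proof
  assume 2: "card (ins x) = 2"
  have low: "\<And>u. u \<in> S \<Longrightarrow> low u" using others_low by blast
  obtain p where p: "distinct p" "set p = S" "A \<inter> S \<times> S = sym_arcs p"
    using arcs_in_conn[OF conn_S low] card_arcs_S(1) 2 by auto
  have p0: "p \<noteq> []" using conn_nonempty[OF conn_S] unfolding p(2)[symmetric] by simp
  have hl: "hd p \<in> S" "last p \<in> S" unfolding p(2)[symmetric] using p0 by simp_all
  have h: "outs (hd p) \<inter> S \<subseteq> {hd (tl p)}" "ins (hd p) \<inter> S \<subseteq> {hd (tl p)}"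
  proof -
    have "w = hd (tl p)" if "(hd p, w) \<in> A \<or> (w, hd p) \<in> A" "w \<in> S" for w
    proof -
      have "(hd p, w) \<in> sym_arcs p" using that hl p(3) sym_arcs_sym[of w "hd p" p] by blast
      then show ?thesis by (rule hd_sym_arcs[OF p(1)])
    qed
    then show "outs (hd p) \<inter> S \<subseteq> {hd (tl p)}" "ins (hd p) \<inter> S \<subseteq> {hd (tl p)}"
      by (auto simp: outs_def ins_def)
  qed
  have l: "outs (last p) \<inter> S \<subseteq> {hd (tl (rev p))}" "ins (last p) \<inter> S \<subseteq> {hd (tl (rev p))}"
  proof -
    have "w = hd (tl (rev p))" if "(last p, w) \<in> A \<or> (w, last p) \<in> A" "w \<in> S" for w
    proof -
      have "(last p, w) \<in> sym_arcs p" using that hl p(3) sym_arcs_sym[of w "last p" p] by blast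
      then show ?thesis by (rule last_sym_arcs[OF p(1)])
    qed
    then show "outs (last p) \<inter> S \<subseteq> {hd (tl (rev p))}" "ins (last p) \<inter> S \<subseteq> {hd (tl (rev p))}"
      by (auto simp: outs_def ins_def)
  qed
  have x: "(hd p, x) \<in> A" "(x, hd p) \<in> A" "(last p, x) \<in> A" "(x, last p) \<in> A"
    using h l hl outs_S ins_S by blast+
  have "hd p \<noteq> last p"
  proof
    assume e: "hd p = last p"
    then have "p = [hd p]" using singleton_if_hd_eq_last p(1) p0 by blast
    then have "sym_arcs p = {}" by (metis sym_arcs_single)
    then have "outs (hd p) \<inter> S = {}" using p(3) hl(1) by (auto simp: outs_def)
    then have "outs (hd p) \<subseteq> {x}" using outs_subset by blast
    then have "card (outs (hd p)) \<le> 1" using card_mono[of "{x}"] by simp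
    then show False using low hl(1) by (simp add: low_def)
  qed
  have c2: "card (outs x) = 2" using card_arcs_S 2 by linarith
  have i: "{hd p, last p} = ins x"
    by (rule card_subset_eq[OF finite_ins]) (use x 2 \<open>hd p \<noteq> last p\<close> in \<open>auto simp: ins_def\<close>)
  have o: "{hd p, last p} = outs x"
    by (rule card_subset_eq[OF finite_outs]) (use x c2 \<open>hd p \<noteq> last p\<close> in \<open>auto simp: outs_def\<close>)
  have "A = sym_arcs p \<union> {x} \<times> {hd p, last p} \<union> {hd p, last p} \<times> {x}"
    using A_eq unfolding p(3) i[symmetric] o[symmetric] .
  also have "\<dots> = sym_arcs p \<union> {(hd p, x), (x, hd p), (last p, x), (x, last p)}" by blast
  finally have A': "A = sym_arcs p \<union> {(hd p, x), (x, hd p), (last p, x), (x, last p)}" .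
  then have cyc: "sym_arcs ((x # p) @ [hd (x # p)]) \<subseteq> A"
    using p0 by (auto simp: sym_arcs_Cons sym_arcs_append)
  have dc: "distinct (x # p)" using p by auto
  have "length p \<ge> 2" using p0 \<open>hd p \<noteq> last p\<close> by (cases p; cases "tl p") auto
  then have "even (length (x # p))" using no_odd_cycle[OF dc] cyc by auto
  obtain f :: "'a \<Rightarrow> bool" where f: "f (hd (x # p)) = True" "\<forall>(u, w) \<in> sym_arcs (x # p). f u \<noteq> f w"
      "f (last (x # p)) = True \<longleftrightarrow> odd (length (x # p))"
    using alternating_colouring[OF dc, of True] by auto
  have "f x" "\<not> f (last p)" using f(1,3) \<open>even (length (x # p))\<close> p0 by auto
  moreover have "\<And>u w. (u, w) \<in> sym_arcs p \<union> {(hd p, x), (x, hd p)} \<Longrightarrow> f u \<noteq> f w"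
    using f(2) unfolding sym_arcs_Cons[OF p0] by blast
  ultimately have "mono_arcs A f \<subseteq> {}" unfolding mono_arcs_def A' by blast
  then show False using not_colourable[of f] by simp
qed

text \<open>In the triangle form \<open>x\<close> is the hub. In the bridge form \<open>x\<close>
  completes the simple arc to a directed triangle and is at the same time the hub, with a leg of
  length 0.\<close>

lemma extended_wheel_form:
  assumes c3: "card (ins x) = 3" "pverts G = V" "parcs G = A"
  shows "extended_wheel G"
proof -
  have o3: "card (outs x) = 3" using card_arcs_S c3 by linarith
  have low: "\<And>u. u \<in> S \<Longrightarrow> low u" using others_low by blast
  have "card (A \<inter> S \<times> S) + 3 = 2 * card S" using card_arcs_S(1) c3 by simp
  then consider p q where "bridge_form S p q" | p q r where "triangle_form S p q r"
    using near_symmetric_conn[OF conn_S] low by blast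
  then show ?thesis
  proof cases
    fix p q assume F: "bridge_form S p q"
    note F' = bridge_formD[OF F]
    have arcS: "(u, w) \<in> {(last p, last q)} \<union> sym_arcs p \<union> sym_arcs q" if "(u, w) \<in> A" "u \<in> S" "w \<in> S" for u w
      using that F'(5) by blast
    have disj: "set p \<inter> set q = {}" "distinct p" "distinct q" using F'(3) by auto
    have mem: "hd p \<in> set p" "last p \<in> set p" "hd q \<in> set q" "last q \<in> set q" using F'(1,2) by simp_all
    have memS: "hd p \<in> S" "last p \<in> S" "hd q \<in> S" "last q \<in> S" using mem F'(4) by blast+
    have sub: "set p \<subseteq> S" "set q \<subseteq> S" using F'(4) by blast+
    have p_out: "u = last p \<and> w = last q \<or> (u, w) \<in> sym_arcs p" if "(u, w) \<in> A" "u \<in> set p" "w \<in> S" for u w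
      using arcS[OF that(1) _ that(3)] that(2) sub disj(1) sym_arcs_in_set[of u w q] by blast
    have p_in: "(w, u) \<in> sym_arcs p" if "(u, w) \<in> A" "w \<in> set p" "u \<in> S" for u w
      using arcS[OF that(1) that(3)] that(2) sub disj(1) mem(4) sym_arcs_in_set[of u w q] sym_arcs_sym[of u w p] by blast
    have q_out: "(u, w) \<in> sym_arcs q" if "(u, w) \<in> A" "u \<in> set q" "w \<in> S" for u w
      using arcS[OF that(1) _ that(3)] that(2) sub disj(1) mem(2) sym_arcs_in_set[of u w p] by blast
    have q_in: "u = last p \<and> w = last q \<or> (w, u) \<in> sym_arcs q" if "(u, w) \<in> A" "w \<in> set q" "u \<in> S" for u w
      using arcS[OF that(1) that(3)] that(2) sub disj(1) sym_arcs_in_set[of u w p] sym_arcs_sym[of u w q] by blast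
    \<comment> \<open>If \<open>p\<close> were a single vertex, it would have no in-neighbour
      besides \<open>x\<close>; dually for \<open>q\<close>, whose last vertex needs an
      out-neighbour.\<close>
    have hp: "hd p \<noteq> last p"
    proof
      assume "hd p = last p"
      then have "sym_arcs p = {}" using sym_arcs_if_hd_eq_last disj by blast
      then have "(w, last p) \<notin> A" if "w \<in> S" for w
        using p_in[OF _ mem(2) that] by auto
      then have "ins (last p) \<subseteq> {x}" using ins_subset by (auto simp: ins_def)
      then have "card (ins (last p)) \<le> 1" using card_mono[of "{x}"] by simp
      then show False using low memS by (simp add: low_def)
    qed
    have hq: "hd q \<noteq> last q"
    proof
      assume "hd q = last q"
      then have "sym_arcs q = {}" using sym_arcs_if_hd_eq_last disj by blast
      then have "(last q, w) \<notin> A" if "w \<in> S" for w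
        using q_out[OF _ mem(4) that] by auto
      then have "outs (last q) \<subseteq> {x}" using outs_subset by (auto simp: outs_def)
      then have "card (outs (last q)) \<le> 1" using card_mono[of "{x}"] by simp
      then show False using low memS by (simp add: low_def)
    qed
    have P: "w = hd (tl p)" if "(hd p, w) \<in> A \<or> (w, hd p) \<in> A" "w \<in> S" for w
      by (rule hd_sym_arcs[OF disj(2)])
        (use that p_out[OF _ mem(1) that(2)] p_in[OF _ mem(1) that(2)] hp in blast)
    have Q: "w = hd (tl q)" if "(hd q, w) \<in> A \<or> (w, hd q) \<in> A" "w \<in> S" for w
      by (rule hd_sym_arcs[OF disj(3)])
        (use that q_out[OF _ mem(3) that(2)] q_in[OF _ mem(3) that(2)] hq in blast)
    have a: "w = hd (tl (rev p))" if "(w, last p) \<in> A" "w \<in> S" for w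
      by (rule last_sym_arcs[OF disj(2) p_in[OF that(1) mem(2) that(2)]])
    have b: "w = hd (tl (rev q))" if "(last q, w) \<in> A" "w \<in> S" for w
      by (rule last_sym_arcs[OF disj(3) q_out[OF that(1) mem(4) that(2)]])
    have "outs (hd p) \<inter> S \<subseteq> {hd (tl p)}" "ins (hd p) \<inter> S \<subseteq> {hd (tl p)}"
      "outs (hd q) \<inter> S \<subseteq> {hd (tl q)}" "ins (hd q) \<inter> S \<subseteq> {hd (tl q)}"
      "ins (last p) \<inter> S \<subseteq> {hd (tl (rev p))}" "outs (last q) \<inter> S \<subseteq> {hd (tl (rev q))}"
      unfolding outs_def ins_def using P Q a b by blast+
    then have arcx: "(hd p, x) \<in> A" "(x, hd p) \<in> A" "(hd q, x) \<in> A" "(x, hd q) \<in> A" "(x, last p) \<in> A" "(last q, x) \<in> A"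
      using memS outs_S ins_S by blast+
    have d3: "hd p \<noteq> hd q" "hd p \<noteq> last q" "hd q \<noteq> last p" "last p \<noteq> last q"
      using mem disj by (metis disjoint_iff)+
    have o: "outs x = {hd p, hd q, last p}"
      by (rule card_subset_eq[OF finite_outs, symmetric]) (use arcx o3 d3 hp in \<open>auto simp: outs_def\<close>)
    have i: "ins x = {hd p, hd q, last q}"
      by (rule card_subset_eq[OF finite_ins, symmetric]) (use arcx c3 d3 hq in \<open>auto simp: ins_def\<close>)
    have "A = {(last p, last q)} \<union> sym_arcs p \<union> sym_arcs q \<union> {x} \<times> {hd p, hd q, last p}
        \<union> {hd p, hd q, last q} \<times> {x}"
      using A_eq unfolding F'(5) i o .
    also have "\<dots> = {(x, last p), (last p, last q), (last q, x)} \<union> sym_arcs [x] \<union> sym_arcs (x # p) \<union> sym_arcs (x # q)"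
      unfolding sym_arcs_Cons[OF F'(1)] sym_arcs_Cons[OF F'(2)] sym_arcs_single by blast
    finally have A': "A = {(x, last p), (last p, last q), (last q, x)} \<union> sym_arcs [x] \<union> sym_arcs (x # p) \<union> sym_arcs (x # q)" .
    have xn: "x \<notin> set p" "x \<notin> set q" using F'(4) by blast+
    have d: "distinct (x # [] @ p @ q)" using xn F'(3) by simp
    have dl: "distinct [x, last p, last q]" using xn mem d3 by auto
    have par: "even (length p)" "even (length q)"
      using wheel_parity[OF A' d dl] F'(1,2) by auto
    show ?thesis unfolding extended_wheel_def
    proof (intro exI conjI)
      show "parcs G = {(x, last p), (last p, last q), (last q, x)} \<union> sym_arcs [x] \<union> sym_arcs (x # p) \<union> sym_arcs (x # q)"
        using A' c3 by simp
      show "pverts G = set [x] \<union> set (x # p) \<union> set (x # q)" using c3 F'(4) x_V by auto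
    qed (use dl par xn F'(1,2) disj in \<open>auto simp: path_between_def\<close>)
  next
    fix p q r assume F: "triangle_form S p q r"
    \<comment> \<open>Proved for the first path only and transferred to the others by rotating the
      triangle. If the path is a single vertex, its neighbours in \<open>S\<close> are the other two
      corners.\<close>
    have dig: "(hd p, x) \<in> A \<and> (x, hd p) \<in> A" if F: "triangle_form S p q r" for p q r
    proof -
      note F' = triangle_formD[OF F]
      have disj: "set p \<inter> set q = {}" "set p \<inter> set r = {}" "distinct p" using F'(4) by auto
      have mem: "hd p \<in> set p" "last p \<in> set p" "last q \<in> set q" "last r \<in> set r" using F'(1-3) by simp_all
      have memS: "hd p \<in> S" using mem F'(5) by blast
      have arcS: "(u, w) \<in> {(last p, last q), (last q, last r), (last r, last p)} \<union> sym_arcs p \<union> sym_arcs q \<union> sym_arcs r"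
        if "(u, w) \<in> A" "u \<in> S" "w \<in> S" for u w
        using that F'(6) by blast
      have l: "last p \<noteq> last q" "last p \<noteq> last r" "last q \<notin> set p" "last r \<notin> set p"
        using mem disj by (metis disjoint_iff)+
      have n: "hd p \<notin> set q" "hd p \<notin> set r" using mem(1) disj by (metis disjoint_iff)+
      have e: "sym_arcs p = {}" if "hd p = last p" using sym_arcs_if_hd_eq_last disj(3) that by blast
      have o: "w = (if hd p = last p then last q else hd (tl p))" if w: "(hd p, w) \<in> A" "w \<in> S" for w
      proof -
        consider "hd p = last p" "w = last q" | "hd p = last q" | "hd p = last r"
          | "(hd p, w) \<in> sym_arcs p" | "(hd p, w) \<in> sym_arcs q" | "(hd p, w) \<in> sym_arcs r"
          using arcS[OF w(1) memS w(2)] by auto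
        then have "hd p = last p \<and> w = last q \<or> (hd p, w) \<in> sym_arcs p"
          by cases (use mem(1) l n sym_arcs_in_set in metis)+
        then show ?thesis using e hd_sym_arcs[OF disj(3), of w] by auto
      qed
      have i: "w = (if hd p = last p then last r else hd (tl p))" if w: "(w, hd p) \<in> A" "w \<in> S" for w
      proof -
        consider "hd p = last p" "w = last r" | "hd p = last q" | "hd p = last r"
          | "(w, hd p) \<in> sym_arcs p" | "(w, hd p) \<in> sym_arcs q" | "(w, hd p) \<in> sym_arcs r"
          using arcS[OF w(1) w(2) memS] by auto
        then have "hd p = last p \<and> w = last r \<or> (hd p, w) \<in> sym_arcs p"
          by cases (use mem(1) l n sym_arcs_in_set sym_arcs_sym in metis)+
        then show ?thesis using e hd_sym_arcs[OF disj(3), of w] by auto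
      qed
      have "outs (hd p) \<inter> S \<subseteq> {if hd p = last p then last q else hd (tl p)}"
        "ins (hd p) \<inter> S \<subseteq> {if hd p = last p then last r else hd (tl p)}"
        using o i unfolding outs_def ins_def by blast+
      then show ?thesis using memS outs_S ins_S by blast
    qed
    note F' = triangle_formD[OF F]
    have arcx: "(hd p, x) \<in> A" "(x, hd p) \<in> A" "(hd q, x) \<in> A" "(x, hd q) \<in> A" "(hd r, x) \<in> A" "(x, hd r) \<in> A"
      using dig[OF F] dig[OF triangle_form_rotate[OF F]]
        dig[OF triangle_form_rotate[OF triangle_form_rotate[OF F]]] by blast+
    have mem: "hd p \<in> set p" "hd q \<in> set q" "hd r \<in> set r" "last p \<in> set p" "last q \<in> set q" "last r \<in> set r"
      using F'(1-3) by simp_all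
    have disj: "set p \<inter> set q = {}" "set p \<inter> set r = {}" "set q \<inter> set r = {}" using F'(4) by auto
    have d3: "hd p \<noteq> hd q" "hd p \<noteq> hd r" "hd q \<noteq> hd r" "last p \<noteq> last q" "last p \<noteq> last r" "last q \<noteq> last r"
      using mem disj by (metis disjoint_iff)+
    have o: "outs x = {hd p, hd q, hd r}"
      by (rule card_subset_eq[OF finite_outs, symmetric]) (use arcx o3 d3 in \<open>auto simp: outs_def\<close>)
    have i: "ins x = {hd p, hd q, hd r}"
      by (rule card_subset_eq[OF finite_ins, symmetric]) (use arcx c3 d3 in \<open>auto simp: ins_def\<close>)
    have "A = {(last p, last q), (last q, last r), (last r, last p)} \<union> sym_arcs p \<union> sym_arcs q \<union> sym_arcs r
        \<union> {x} \<times> {hd p, hd q, hd r} \<union> {hd p, hd q, hd r} \<times> {x}"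
      using A_eq unfolding F'(6) i o .
    also have "\<dots> = {(last p, last q), (last q, last r), (last r, last p)}
        \<union> sym_arcs (x # p) \<union> sym_arcs (x # q) \<union> sym_arcs (x # r)"
      unfolding sym_arcs_Cons[OF F'(1)] sym_arcs_Cons[OF F'(2)] sym_arcs_Cons[OF F'(3)] by blast
    finally have A': "A = {(last p, last q), (last q, last r), (last r, last p)}
        \<union> sym_arcs (x # p) \<union> sym_arcs (x # q) \<union> sym_arcs (x # r)" .
    have xn: "x \<notin> set p" "x \<notin> set q" "x \<notin> set r" using F'(5) by blast+
    have d: "distinct (x # p @ q @ r)" using xn F'(4) by simp
    have dl: "distinct [last p, last q, last r]" using d3 by auto
    have par: "even (length p) = even (length q)" "even (length q) = even (length r)"
      using wheel_parity[OF A' d dl] F'(1-3) by auto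
    show ?thesis unfolding extended_wheel_def
    proof (intro exI conjI)
      show "parcs G = {(last p, last q), (last q, last r), (last r, last p)} \<union> sym_arcs (x # p) \<union> sym_arcs (x # q) \<union> sym_arcs (x # r)"
        using A' c3 by simp
      show "pverts G = set (x # p) \<union> set (x # q) \<union> set (x # r)" using c3 F'(5) x_V by auto
    qed (use dl par xn F'(1-4) disj in \<open>auto simp: path_between_def\<close>)
  qed
qed

end

section \<open>Two exceptional vertices\<close>

lemma glue_colourings:
  assumes "set p \<inter> set q = {}" "\<forall>(u, w) \<in> sym_arcs p. f u \<noteq> f w" "\<forall>(u, w) \<in> sym_arcs q. g u \<noteq> (g w :: bool)"
  obtains k where "\<And>u. u \<in> set p \<Longrightarrow> k u = f u" "\<And>u. u \<in> set q \<Longrightarrow> k u = g u"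
    "\<And>u w. (u, w) \<in> sym_arcs p \<union> sym_arcs q \<Longrightarrow> k u \<noteq> k w"
proof
  let ?k = "\<lambda>u. if u \<in> set p then f u else g u"
  show p: "?k u = f u" if "u \<in> set p" for u using that by simp
  show q: "?k u = g u" if "u \<in> set q" for u using that assms(1) by auto
  show "?k u \<noteq> ?k w" if "(u, w) \<in> sym_arcs p \<union> sym_arcs q" for u w
    using that
  proof
    assume *: "(u, w) \<in> sym_arcs p"
    then have "f u \<noteq> f w" using assms(2) by blast
    then show ?thesis using sym_arcs_in_set[OF *] p by simp
  next
    assume *: "(u, w) \<in> sym_arcs q"
    then have "g u \<noteq> g w" using assms(3) by blast
    then show ?thesis using sym_arcs_in_set[OF *] q by metis
  qed
qed

text \<open>Capital letters refer to \<open>s\<close>, small ones to \<open>t\<close>;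
  \<open>O\<close>, \<open>o\<close> count out-neighbours and \<open>I\<close>, \<open>i\<close>
  in-neighbours in component 1 or 2, while \<open>est\<close> and \<open>ets\<close> indicate the
  arcs from \<open>s\<close> to \<open>t\<close> and back. The bounds on \<open>o1\<close> and
  \<open>o2\<close> express that a component containing an out-neighbour of \<open>t\<close>
  contains exactly one, and at most one in-neighbour.\<close>

lemma degree_distribution:
  fixes O1 O2 I1 I2 o1 o2 i1 i2 est ets :: nat
  assumes "O1 + O2 + est = 3" "I1 + I2 + ets = 2" "o1 + o2 + ets = 2" "i1 + i2 + est = 3"
    and "I1 + i1 \<ge> 2" "I2 + i2 \<ge> 2" "I1 + i1 = O1 + o1" "I2 + i2 = O2 + o2"
    and o: "o1 \<ge> 1 \<longrightarrow> o1 = 1 \<and> i1 \<le> 1" "o2 \<ge> 1 \<longrightarrow> o2 = 1 \<and> i2 \<le> 1"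
    and e: "est = 0 \<or> est = 1" "ets = 0 \<or> ets = 1"
  shows "ets = 1 \<and> est = 0 \<and> o1 = 1 \<and> i1 = 1 \<and> O1 = 1 \<and> I1 = 1 \<and> o2 = 0 \<and> i2 = 2 \<and> O2 = 2 \<and> I2 = 0 \<or>
     ets = 1 \<and> est = 0 \<and> o2 = 1 \<and> i2 = 1 \<and> O2 = 1 \<and> I2 = 1 \<and> o1 = 0 \<and> i1 = 2 \<and> O1 = 2 \<and> I1 = 0 \<or>
     ets = 0 \<and> est = 1 \<and> o1 = 1 \<and> i1 = 1 \<and> O1 = 1 \<and> I1 = 1 \<and> o2 = 1 \<and> i2 = 1 \<and> O2 = 1 \<and> I2 = 1"
proof (cases "ets = 1")
  case True
  have "est = 0" using True assms(1-8) e(1) by linarith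
  have "o1 = 1 \<and> o2 = 0 \<or> o1 = 0 \<and> o2 = 1" using True assms(3) by linarith
  then show ?thesis
  proof
    assume "o1 = 1 \<and> o2 = 0"
    then have "i1 \<le> 1" using o(1) by simp
    then have "i1 = 1 \<and> O1 = 1 \<and> I1 = 1 \<and> i2 = 2 \<and> O2 = 2 \<and> I2 = 0"
      using True \<open>est = 0\<close> \<open>o1 = 1 \<and> o2 = 0\<close> assms(1-8) by linarith
    then show ?thesis using True \<open>est = 0\<close> \<open>o1 = 1 \<and> o2 = 0\<close> by simp
  next
    assume "o1 = 0 \<and> o2 = 1"
    then have "i2 \<le> 1" using o(2) by simp
    then have "i2 = 1 \<and> O2 = 1 \<and> I2 = 1 \<and> i1 = 2 \<and> O1 = 2 \<and> I1 = 0"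
      using True \<open>est = 0\<close> \<open>o1 = 0 \<and> o2 = 1\<close> assms(1-8) by linarith
    then show ?thesis using True \<open>est = 0\<close> \<open>o1 = 0 \<and> o2 = 1\<close> by simp
  qed
next
  case False
  then have "ets = 0" using e(2) by simp
  have "o1 \<le> 1" "o2 \<le> 1" using o by linarith+
  then have "o1 = 1" "o2 = 1" using assms(3) \<open>ets = 0\<close> by linarith+
  then have "i1 \<le> 1" "i2 \<le> 1" using o by simp_all
  then have "est = 1" "i1 = 1" "i2 = 1" using assms(4) e(1) by linarith+
  then have "I1 = 1 \<and> I2 = 1 \<and> O1 = 1 \<and> O2 = 1"
    using \<open>ets = 0\<close> \<open>o1 = 1\<close> \<open>o2 = 1\<close> assms(1-8) by linarith
  then show ?thesis using \<open>ets = 0\<close> \<open>est = 1\<close> \<open>o1 = 1\<close> \<open>o2 = 1\<close> \<open>i1 = 1\<close> \<open>i2 = 1\<close> by simp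
qed

text \<open>Each exceptional vertex has degree 2 on one side: holes can leave \<open>t\<close> along
  out-arcs, and dually \<open>s\<close> along in-arcs.\<close>

locale two_exceptional = dicrit V A for V :: "'a set" and A +
  fixes s t :: 'a
  assumes st: "s \<in> V" "t \<in> V" "s \<noteq> t"
    and others_low: "v \<in> V \<Longrightarrow> v \<noteq> s \<Longrightarrow> v \<noteq> t \<Longrightarrow> low v"
    and s_deg: "card (outs s) = 3" "card (ins s) = 2"
    and t_deg: "card (outs t) = 2" "card (ins t) = 3"
begin

abbreviation "W \<equiv> V - {s, t}"

definition comp :: "'a set \<Rightarrow> bool" where
  "comp K \<longleftrightarrow> conn K \<and> K \<subseteq> W \<and> (\<forall>u \<in> K. \<forall>z \<in> W - K. \<not> adj u z)"

lemma comp_low: "comp K \<Longrightarrow> u \<in> K \<Longrightarrow> low u"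
  using others_low by (auto simp: comp_def)

lemma comp_nbrs:
  assumes "comp K" "u \<in> K" shows "outs u \<subseteq> K \<union> {s, t}" "ins u \<subseteq> K \<union> {s, t}"
proof -
  have c: "z \<in> K \<union> {s, t}" if "adj u z" for z
    using assms that adj_in_V[OF that] unfolding comp_def by blast
  show "outs u \<subseteq> K \<union> {s, t}" "ins u \<subseteq> K \<union> {s, t}"
    unfolding outs_def ins_def using c by (auto simp: adj_def)
qed

lemma comp_finite: "comp K \<Longrightarrow> finite K"
  using conn_finite by (simp add: comp_def)

lemma comp_boundary:
  assumes "comp K"
  shows "card (A \<inter> K \<times> K) + (card (ins s \<inter> K) + card (ins t \<inter> K)) = 2 * card K"
    "card (A \<inter> K \<times> K) + (card (outs s \<inter> K) + card (outs t \<inter> K)) = 2 * card K"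
    "card (ins s \<inter> K) + card (ins t \<inter> K) \<ge> 2"
proof -
  have K: "K \<inter> {s, t} = {}" "conn K" using assms by (auto simp: comp_def)
  show 1: "card (A \<inter> K \<times> K) + (card (ins s \<inter> K) + card (ins t \<inter> K)) = 2 * card K"
    using boundary_ins[OF comp_finite[OF assms] _ K(1) comp_low[OF assms] comp_nbrs(1)[OF assms]] st(3)
    by (simp add: insert_commute)
  show "card (A \<inter> K \<times> K) + (card (outs s \<inter> K) + card (outs t \<inter> K)) = 2 * card K"
    using boundary_outs[OF comp_finite[OF assms] _ K(1) comp_low[OF assms] comp_nbrs(2)[OF assms]] st(3)
    by (simp add: insert_commute)
  have "card (A \<inter> K \<times> K) + 2 \<le> 2 * card K" using arcs_in_conn[OF K(2) comp_low[OF assms]] by blast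
  then show "card (ins s \<inter> K) + card (ins t \<inter> K) \<ge> 2" using 1 by linarith
qed

lemma comp_t:
  assumes "comp K" "card (outs t \<inter> K) \<ge> 1"
  shows "card (outs t \<inter> K) = 1 \<and> card (ins t \<inter> K) \<le> 1"
proof -
  have "outs t \<inter> K \<noteq> {}" "t \<notin> K" "conn K" using assms by (auto simp: comp_def)
  then show ?thesis using card_nbrs_in_conn[of K t] comp_low[OF assms(1)] t_deg(1) by blast
qed

text \<open>\<open>K1\<close> and \<open>K2\<close> may be empty, so that the same statement
  provides a first, a second and a third component.\<close>

lemma ex_comp:
  assumes "w \<in> W" "comp K1 \<or> K1 = {}" "comp K2 \<or> K2 = {}" "w \<notin> K1 \<union> K2"
  shows "\<exists>K. comp K \<and> K \<inter> (K1 \<union> K2) = {}"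
proof -
  have "finite (W - (K1 \<union> K2))" "w \<in> W - (K1 \<union> K2)" using finite_V assms(1,4) by auto
  then obtain K where K: "conn K" "K \<subseteq> W - (K1 \<union> K2)"
    "\<And>u z. u \<in> K \<Longrightarrow> z \<in> W - (K1 \<union> K2) - K \<Longrightarrow> \<not> adj u z"
    using component by metis
  have "\<not> adj u z" if "u \<in> K" "z \<in> W - K" for u z
  proof -
    have no: "\<not> adj z u" if "z \<in> L" "comp L" "K \<inter> L = {}" for L
      using that \<open>u \<in> K\<close> K(2) unfolding comp_def by blast
    have sub: "K \<inter> K1 = {}" "K \<inter> K2 = {}" using K(2) by blast+
    consider "z \<in> K1" | "z \<in> K2" | "z \<in> W - (K1 \<union> K2) - K" using \<open>z \<in> W - K\<close> by blast
    then show ?thesis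
    proof cases
      case 1
      then have "comp K1" using assms(2) by auto
      then show ?thesis using no[OF 1 _ sub(1)] adj_sym by metis
    next
      case 2
      then have "comp K2" using assms(3) by auto
      then show ?thesis using no[OF 2 _ sub(2)] adj_sym by metis
    next
      case 3
      then show ?thesis using K(3)[OF \<open>u \<in> K\<close>] by blast
    qed
  qed
  then have "comp K" using K(1,2) by (auto simp: comp_def)
  then show ?thesis using K(2) by blast
qed

text \<open>Three components would send six arcs to \<open>s\<close> and \<open>t\<close>, whose
  in-degrees sum to 5. With a single component, \<open>t\<close> would have an out-neighbour in it,
  hence at most one in-neighbour there, and in-degree at most 2 even with an arc from
  \<open>s\<close>.\<close>

lemma two_comps:
  obtains K1 K2 where "comp K1" "comp K2" "K1 \<inter> K2 = {}" "W = K1 \<union> K2"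
proof -
  have "W \<noteq> {}"
  proof
    assume "W = {}"
    then have "outs s \<subseteq> {t}" using outs_subset[of s] loopfree by (auto simp: outs_def)
    then show False using s_deg card_mono[of "{t}" "outs s"] by simp
  qed
  then obtain w where "w \<in> W" by blast
  then obtain K1 where K1: "comp K1" using ex_comp[of w "{}" "{}"] by blast
  have "W \<noteq> K1"
  proof
    assume W: "W = K1"
    have "outs t \<subseteq> insert s (outs t \<inter> K1)" "ins t \<subseteq> insert s (ins t \<inter> K1)"
      using W outs_subset[of t] ins_subset[of t] loopfree by (auto simp: outs_def ins_def)
    then have "card (outs t) \<le> card (insert s (outs t \<inter> K1))" "card (ins t) \<le> card (insert s (ins t \<inter> K1))"
      by (intro card_mono; simp)+
    then have "card (outs t) \<le> Suc (card (outs t \<inter> K1))" "card (ins t) \<le> Suc (card (ins t \<inter> K1))"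
      using card_insert_le_m1 by (auto simp: card_insert_if split: if_splits)
    then show False using comp_t[OF K1] t_deg by linarith
  qed
  moreover have "K1 \<subseteq> W" using K1 by (simp add: comp_def)
  ultimately obtain w where "w \<in> W" "w \<notin> K1" by blast
  then obtain K2 where K2: "comp K2" "K2 \<inter> K1 = {}" using ex_comp[of w K1 "{}"] K1 by auto
  have "W = K1 \<union> K2"
  proof (rule ccontr)
    assume "W \<noteq> K1 \<union> K2"
    moreover have "K1 \<union> K2 \<subseteq> W" using K1 K2 by (auto simp: comp_def)
    ultimately obtain w where "w \<in> W" "w \<notin> K1 \<union> K2" by blast
    then obtain K3 where K3: "comp K3" "K3 \<inter> (K1 \<union> K2) = {}" using ex_comp[of w K1 K2] K1 K2 by blast
    have "card (X \<inter> K1) + card (X \<inter> K2) + card (X \<inter> K3) \<le> card X" if "finite X" for X :: "'a set"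
    proof -
      have "card (X \<inter> K1) + card (X \<inter> K2) = card (X \<inter> K1 \<union> X \<inter> K2)"
        by (rule card_Un_disjoint[symmetric]) (use that K2 in auto)
      moreover have "card (X \<inter> K1 \<union> X \<inter> K2) + card (X \<inter> K3) = card (X \<inter> K1 \<union> X \<inter> K2 \<union> X \<inter> K3)"
        by (rule card_Un_disjoint[symmetric]) (use that K3 in auto)
      moreover have "card (X \<inter> K1 \<union> X \<inter> K2 \<union> X \<inter> K3) \<le> card X"
        by (rule card_mono) (use that in auto)
      ultimately show ?thesis by linarith
    qed
    from this[of "ins s"] this[of "ins t"] show False
      using comp_boundary(3)[OF K1] comp_boundary(3)[OF K2(1)] comp_boundary(3)[OF K3(1)] s_deg t_deg by simp
  qed
  then show ?thesis using that K1 K2 by blast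
qed

lemma comp_symmetric_path:
  assumes K: "comp K" "card (ins s \<inter> K) + card (ins t \<inter> K) = 2"
  obtains p where "distinct p" "p \<noteq> []" "set p = K" "A \<inter> K \<times> K = sym_arcs p"
    "\<And>w. w \<in> K \<Longrightarrow> (hd p, w) \<in> A \<or> (w, hd p) \<in> A \<Longrightarrow> w = hd (tl p)"
    "\<And>w. w \<in> K \<Longrightarrow> (last p, w) \<in> A \<or> (w, last p) \<in> A \<Longrightarrow> w = hd (tl (rev p))"
proof -
  have "conn K" using K(1) by (simp add: comp_def)
  moreover have "card (A \<inter> K \<times> K) + 2 = 2 * card K" using comp_boundary(1)[OF K(1)] K(2) by linarith
  ultimately obtain p where p: "distinct p" "set p = K" "A \<inter> K \<times> K = sym_arcs p"
    using arcs_in_conn[OF _ comp_low[OF K(1)]] by blast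
  have p0: "p \<noteq> []" using conn_nonempty[OF \<open>conn K\<close>] unfolding p(2)[symmetric] by simp
  have hl: "hd p \<in> K" "last p \<in> K" unfolding p(2)[symmetric] using p0 by simp_all
  have "w = hd (tl p)" if "w \<in> K" "(hd p, w) \<in> A \<or> (w, hd p) \<in> A" for w
  proof -
    have "(hd p, w) \<in> sym_arcs p" using that hl p(3) sym_arcs_sym[of w "hd p" p] by blast
    then show ?thesis by (rule hd_sym_arcs[OF p(1)])
  qed
  moreover have "w = hd (tl (rev p))" if "w \<in> K" "(last p, w) \<in> A \<or> (w, last p) \<in> A" for w
  proof -
    have "(last p, w) \<in> sym_arcs p" using that hl p(3) sym_arcs_sym[of w "last p" p] by blast
    then show ?thesis by (rule last_sym_arcs[OF p(1)])
  qed
  ultimately show ?thesis using that p p0 by blast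
qed

lemma outs_st: "comp K \<Longrightarrow> u \<in> K \<Longrightarrow> (\<And>w. w \<in> K \<Longrightarrow> (u, w) \<in> A \<Longrightarrow> w = z) \<Longrightarrow> (u, s) \<in> A \<or> (u, t) \<in> A"
proof (rule ccontr)
  assume *: "comp K" "u \<in> K" "\<And>w. w \<in> K \<Longrightarrow> (u, w) \<in> A \<Longrightarrow> w = z" "\<not> ((u, s) \<in> A \<or> (u, t) \<in> A)"
  then have "outs u \<subseteq> {z}" using comp_nbrs(1)[OF *(1,2)] by (auto simp: outs_def)
  then have "card (outs u) \<le> 1" using card_mono[of "{z}"] by simp
  then show False using comp_low[OF *(1,2)] by (simp add: low_def)
qed

lemma ins_st: "comp K \<Longrightarrow> u \<in> K \<Longrightarrow> (\<And>w. w \<in> K \<Longrightarrow> (w, u) \<in> A \<Longrightarrow> w = z) \<Longrightarrow> (s, u) \<in> A \<or> (t, u) \<in> A"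
proof (rule ccontr)
  assume *: "comp K" "u \<in> K" "\<And>w. w \<in> K \<Longrightarrow> (w, u) \<in> A \<Longrightarrow> w = z" "\<not> ((s, u) \<in> A \<or> (t, u) \<in> A)"
  then have "ins u \<subseteq> {z}" using comp_nbrs(2)[OF *(1,2)] by (auto simp: ins_def)
  then have "card (ins u) \<le> 1" using card_mono[of "{z}"] by simp
  then show False using comp_low[OF *(1,2)] by (simp add: low_def)
qed

text \<open>Only two arcs leave \<open>K\<close>, so \<open>K\<close> is a symmetric path. By
  \<open>unique_nbr_symmetric\<close> and its dual, \<open>t\<close> and \<open>s\<close> are each
  joined to it by a digon at one vertex; both ends of the path need an arc to \<open>s\<close> or
  \<open>t\<close>, so these vertices are the ends, or the only vertex.\<close>

lemma path_between_exceptional: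
  assumes K: "comp K" "card (outs t \<inter> K) = 1" "card (ins t \<inter> K) = 1" "card (outs s \<inter> K) = 1" "card (ins s \<inter> K) = 1"
  obtains p where "distinct p" "p \<noteq> []" "set p = K" "A \<inter> K \<times> K = sym_arcs p"
    "outs t \<inter> K = {hd p}" "ins t \<inter> K = {hd p}" "outs s \<inter> K = {last p}" "ins s \<inter> K = {last p}"
proof -
  have b2: "card (ins s \<inter> K) + card (ins t \<inter> K) = 2" using K by simp
  obtain p where p: "distinct p" "p \<noteq> []" "set p = K" "A \<inter> K \<times> K = sym_arcs p"
    "\<And>w. w \<in> K \<Longrightarrow> (hd p, w) \<in> A \<or> (w, hd p) \<in> A \<Longrightarrow> w = hd (tl p)"
    "\<And>w. w \<in> K \<Longrightarrow> (last p, w) \<in> A \<or> (w, last p) \<in> A \<Longrightarrow> w = hd (tl (rev p))"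
    using comp_symmetric_path[OF K(1) b2] by blast
  have sym: "(b, a) \<in> A" if "a \<in> K" "b \<in> K" "(a, b) \<in> A" for a b
    using that p(4) sym_arcs_sym[of a b p] by blast
  have c: "conn K" "t \<notin> K" "s \<notin> K" using K(1) by (auto simp: comp_def)
  obtain q where q: "outs t \<inter> K = {q}" using K(2) card_1_singletonE by blast
  obtain q' where q': "ins s \<inter> K = {q'}" using K(5) card_1_singletonE by blast
  obtain i where i: "ins t \<inter> K = {i}" using K(3) card_1_singletonE by blast
  obtain o' where o': "outs s \<inter> K = {o'}" using K(4) card_1_singletonE by blast
  have "i = q"
    by (rule unique_nbr_symmetric[OF c(1) comp_low[OF K(1)] c(2) t_deg(1) sym])
      (use q i in \<open>auto simp: outs_def ins_def adj_def\<close>)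
  have "o' = q'"
    by (rule unique_nbr_symmetric'[OF c(1) comp_low[OF K(1)] c(3) s_deg(2) sym])
      (use q' o' in \<open>auto simp: outs_def ins_def adj_def\<close>)
  have hl: "hd p \<in> K" "last p \<in> K" unfolding p(3)[symmetric] using p(2) by simp_all
  have "(hd p, s) \<in> A \<or> (hd p, t) \<in> A" using outs_st[OF K(1) hl(1)] p(5) by blast
  then have h: "hd p = q \<or> hd p = q'" using q' i \<open>i = q\<close> hl by (auto simp: ins_def)
  have "(last p, s) \<in> A \<or> (last p, t) \<in> A" using outs_st[OF K(1) hl(2)] p(6) by blast
  then have l: "last p = q \<or> last p = q'" using q' i \<open>i = q\<close> hl by (auto simp: ins_def)
  have all: "u = hd p" if "hd p = last p" "u \<in> K" for u
    using singleton_if_hd_eq_last[OF p(1,2) that(1)] that(2) unfolding p(3)[symmetric]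
    by (metis empty_iff empty_set set_ConsD)
  have qK: "q \<in> K" "q' \<in> K" using q q' by auto
  consider "hd p = q" "last p = q'" | "hd p = q'" "last p = q"
    using h l all qK by metis
  then show ?thesis
  proof cases
    case 1
    then show ?thesis using that[of p] p(1-4) q q' i o' \<open>i = q\<close> \<open>o' = q'\<close> by simp
  next
    case 2
    then show ?thesis using that[of "rev p"] p(1-4) q q' i o' \<open>i = q\<close> \<open>o' = q'\<close>
      by (simp add: hd_rev last_rev)
  qed
qed

lemma A_split:
  assumes "comp K1" "comp K2" "K1 \<inter> K2 = {}" "W = K1 \<union> K2"
  shows "A = A \<inter> K1 \<times> K1 \<union> A \<inter> K2 \<times> K2 \<union> A \<inter> {s, t} \<times> {s, t}
     \<union> {t} \<times> (outs t \<inter> K1) \<union> {t} \<times> (outs t \<inter> K2) \<union> {s} \<times> (outs s \<inter> K1) \<union> {s} \<times> (outs s \<inter> K2)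
     \<union> (ins t \<inter> K1) \<times> {t} \<union> (ins t \<inter> K2) \<times> {t} \<union> (ins s \<inter> K1) \<times> {s} \<union> (ins s \<inter> K2) \<times> {s}"
    (is "A = ?R")
proof
  have V: "V = K1 \<union> K2 \<union> {s, t}" using assms(4) st by blast
  have no: "(a, b) \<notin> A \<and> (b, a) \<notin> A" if "a \<in> K1" "b \<in> K2" for a b
    using that assms by (auto simp: comp_def adj_def)
  show "A \<subseteq> ?R"
  proof (rule subrelI)
    fix a b assume ab: "(a, b) \<in> A"
    then have "a \<in> K1 \<or> a \<in> K2 \<or> a = s \<or> a = t" "b \<in> K1 \<or> b \<in> K2 \<or> b = s \<or> b = t"
      using A_subset V by blast+
    then show "(a, b) \<in> ?R" using ab no[of a b] no[of b a]
      by (elim disjE) (simp_all add: outs_def ins_def)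
  qed
  show "?R \<subseteq> A" unfolding outs_def ins_def by blast
qed

text \<open>\<open>K1\<close> is a symmetric path joined by digons to \<open>t\<close> and
  \<open>s\<close>. The ends of the symmetric path on \<open>K2\<close> receive the arcs of
  \<open>s\<close> and send arcs to \<open>t\<close>. Wrong parities would allow a
  colouring.\<close>

lemma F_expansion_form:
  assumes K: "comp K1" "comp K2" "K1 \<inter> K2 = {}" "W = K1 \<union> K2"
    and ts: "(t, s) \<in> A" "(s, t) \<notin> A"
    and c1: "card (outs t \<inter> K1) = 1" "card (ins t \<inter> K1) = 1" "card (outs s \<inter> K1) = 1" "card (ins s \<inter> K1) = 1"
    and c2: "card (outs t \<inter> K2) = 0" "card (ins t \<inter> K2) = 2" "card (outs s \<inter> K2) = 2" "card (ins s \<inter> K2) = 0"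
    and G: "pverts G = V" "parcs G = A"
  shows "F_expansion G"
proof -
  obtain p where p: "distinct p" "p \<noteq> []" "set p = K1" "A \<inter> K1 \<times> K1 = sym_arcs p"
    "outs t \<inter> K1 = {hd p}" "ins t \<inter> K1 = {hd p}" "outs s \<inter> K1 = {last p}" "ins s \<inter> K1 = {last p}"
    using path_between_exceptional[OF K(1) c1] by blast
  obtain r where r: "distinct r" "r \<noteq> []" "set r = K2" "A \<inter> K2 \<times> K2 = sym_arcs r"
    "\<And>w. w \<in> K2 \<Longrightarrow> (hd r, w) \<in> A \<or> (w, hd r) \<in> A \<Longrightarrow> w = hd (tl r)"
    "\<And>w. w \<in> K2 \<Longrightarrow> (last r, w) \<in> A \<or> (w, last r) \<in> A \<Longrightarrow> w = hd (tl (rev r))"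
    using comp_symmetric_path[OF K(2)] c2 by auto
  have hl: "hd r \<in> K2" "last r \<in> K2" unfolding r(3)[symmetric] using r(2) by simp_all
  have e2: "outs t \<inter> K2 = {}" "ins s \<inter> K2 = {}" using c2 by simp_all
  have no: "(u, s) \<notin> A" "(t, u) \<notin> A" if "u \<in> K2" for u using e2 that by (auto simp: outs_def ins_def)
  have ht: "(hd r, t) \<in> A" "(last r, t) \<in> A"
    using outs_st[OF K(2) hl(1)] outs_st[OF K(2) hl(2)] r(5,6) no hl by blast+
  have hs: "(s, hd r) \<in> A" "(s, last r) \<in> A"
    using ins_st[OF K(2) hl(1)] ins_st[OF K(2) hl(2)] r(5,6) no hl by blast+
  have hr: "hd r \<noteq> last r"
  proof
    assume "hd r = last r"
    then have "set r = {hd r}" using singleton_if_hd_eq_last[OF r(1,2)] by (metis empty_set list.simps(15))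
    then have "ins t \<inter> K2 \<subseteq> {hd r}" using r(3) by blast
    then show False using c2(2) card_mono[of "{hd r}" "ins t \<inter> K2"] by simp
  qed
  have it: "ins t \<inter> K2 = {hd r, last r}"
    by (rule card_subset_eq[symmetric]) (use ht hl hr c2 in \<open>auto simp: ins_def\<close>)
  have os: "outs s \<inter> K2 = {hd r, last r}"
    by (rule card_subset_eq[symmetric]) (use hs hl hr c2 in \<open>auto simp: outs_def\<close>)
  have tt: "A \<inter> {s, t} \<times> {s, t} = {(t, s)}" using ts loopfree by blast
  have A1: "A = {(t, s), (s, last r), (s, hd r), (last r, t), (hd r, t)} \<union> sym_arcs p \<union> sym_arcs r
      \<union> {(t, hd p), (hd p, t), (last p, s), (s, last p)}"
  proof -
    have "A = sym_arcs p \<union> sym_arcs r \<union> {(t, s)} \<union> {t} \<times> {hd p} \<union> {t} \<times> {} \<union> {s} \<times> {last p}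
        \<union> {s} \<times> {hd r, last r} \<union> {hd p} \<times> {t} \<union> {hd r, last r} \<times> {t} \<union> {last p} \<times> {s} \<union> {} \<times> {s}"
      using A_split[OF K] unfolding p(4-8) r(4) it os e2 tt .
    also have "\<dots> = {(t, s), (s, last r), (s, hd r), (last r, t), (hd r, t)} \<union> sym_arcs p \<union> sym_arcs r
      \<union> {(t, hd p), (hd p, t), (last p, s), (s, last p)}" by auto
    finally show ?thesis .
  qed
  have stn: "s \<notin> K1" "t \<notin> K1" "s \<notin> K2" "t \<notin> K2" using K by auto
  have parity: "odd (length p) \<and> even (length r)"
  proof (rule ccontr)
    \<comment> \<open>Colour \<open>t\<close>, \<open>p\<close>, \<open>s\<close> alternately and
      \<open>r\<close> alternately, starting opposite to \<open>t\<close>. If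
      \<open>length p\<close> is odd, then \<open>s\<close> agrees with \<open>t\<close>, and for
      odd \<open>length r\<close> only the arc from \<open>t\<close> to \<open>s\<close> is
      monochromatic. If \<open>length p\<close> is even, that arc is fine, and the remaining ones
      run from the source \<open>s\<close> through the ends of \<open>r\<close> to the sink
      \<open>t\<close>.\<close>
    assume par: "\<not> ?thesis"
    have d: "distinct (t # p @ [s])" using p stn st(3) by auto
    obtain f :: "'a \<Rightarrow> bool" where f: "f (hd (t # p @ [s])) = True" "\<forall>(u, w) \<in> sym_arcs (t # p @ [s]). f u \<noteq> f w"
      "f (last (t # p @ [s])) = True \<longleftrightarrow> odd (length (t # p @ [s]))"
      using alternating_colouring[OF d, of True] by blast
    obtain g :: "'a \<Rightarrow> bool" where g: "g (hd r) = False" "\<forall>(u, w) \<in> sym_arcs r. g u \<noteq> g w"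
      "g (last r) = False \<longleftrightarrow> odd (length r)"
      using alternating_colouring[OF r(1,2), of False] by blast
    have disj: "set (t # p @ [s]) \<inter> set r = {}" using stn K(3) p(3) r(3) by auto
    obtain k where k: "\<And>u. u \<in> set (t # p @ [s]) \<Longrightarrow> k u = f u" "\<And>u. u \<in> set r \<Longrightarrow> k u = g u"
      "\<And>u w. (u, w) \<in> sym_arcs (t # p @ [s]) \<union> sym_arcs r \<Longrightarrow> k u \<noteq> k w"
      using glue_colourings[OF disj f(2) g(2)] by blast
    have sy: "sym_arcs (t # p @ [s]) = sym_arcs p \<union> {(t, hd p), (hd p, t), (last p, s), (s, last p)}"
      using p(2) by (auto simp: sym_arcs_Cons sym_arcs_append)
    have kt: "k t" "k s \<longleftrightarrow> odd (length p)" using k(1)[of t] k(1)[of s] f(1,3) by simp_all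
    have kr: "\<not> k (hd r)" "\<not> k (last r) \<longleftrightarrow> odd (length r)" using k(2) g(1,3) r(2) by simp_all
    have m: "mono_arcs A k \<subseteq> {(u, w) \<in> {(t, s), (s, last r), (s, hd r), (last r, t), (hd r, t)}. k u = k w}"
      using k(3) unfolding mono_arcs_def A1 sy by blast
    have neq: "last r \<noteq> t" "hd r \<noteq> t" "last r \<noteq> s" "hd r \<noteq> s" using hl stn by metis+
    show False
    proof (cases "odd (length p)")
      case True
      then have "mono_arcs A k \<subseteq> {(t, s)}" using m kt kr par by blast
      then show False using acyclic_subset[OF acyclic_arc] st(3) not_colourable by metis
    next
      case False
      then have m': "mono_arcs A k \<subseteq> {(s, last r), (s, hd r), (last r, t), (hd r, t)}" using m kt by blast
      have "acyclic {(last r, t), (hd r, t)}"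
        by (rule acyclic_add_sink[of "{}" _ t]) (use neq in auto)
      then have "acyclic (mono_arcs A k)"
        by (rule acyclic_add_source[of _ _ s]) (use m' neq st(3) in auto)
      then show False using not_colourable by blast
    qed
  qed
  have A2: "A = {(t, s), (s, last r), (s, hd r), (last r, t), (hd r, t)}
      \<union> sym_arcs [t, hd p] \<union> sym_arcs (s # rev p) \<union> sym_arcs r"
    unfolding A1 using p(2) by (auto simp: sym_arcs_Cons hd_rev)
  have hp: "hd p \<in> set p" using p(2) by simp
  \<comment> \<open>\<open>t\<close>, \<open>s\<close> and \<open>hd p\<close> become the vertices
    \<open>x\<close>, \<open>y\<close> and \<open>z\<close> of F. The symmetric path from
    \<open>t\<close> to \<open>s\<close> has an even number of edges; cutting it after the first
    edge leaves two odd paths.\<close>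
  show ?thesis unfolding F_expansion_def
  proof (intro exI conjI)
    show "parcs G = {(t, s), (s, last r), (s, hd r), (last r, t), (hd r, t)}
      \<union> sym_arcs [t, hd p] \<union> sym_arcs (s # rev p) \<union> sym_arcs r" using A2 G by simp
    show "pverts G = set [t, hd p] \<union> set (s # rev p) \<union> set r"
      unfolding G using K(4) p(3) r(3) st hp by auto
    show "path_between t [t, hd p] (hd p)" "path_between s (s # rev p) (hd p)" "path_between (hd r) r (last r)"
      using p stn hp r by (auto simp: path_between_def last_rev)
    show "set [t, hd p] \<inter> set (s # rev p) = {hd p}" using hp stn p(3) st(3) by auto
    show "set [t, hd p] \<inter> set r = {}" "set (s # rev p) \<inter> set r = {}"
      using hp stn p(3) r(3) K(3) by auto
  qed (use parity r(2) in auto)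
qed

text \<open>Both components together with \<open>s\<close> and \<open>t\<close> form a symmetric
  cycle. It cannot be odd, and if it is even, its alternating colouring leaves at most the arc from
  \<open>s\<close> to \<open>t\<close> monochromatic.\<close>

lemma no_arc_s_t:
  assumes K: "comp K1" "comp K2" "K1 \<inter> K2 = {}" "W = K1 \<union> K2"
    and ts: "(s, t) \<in> A" "(t, s) \<notin> A"
    and c1: "card (outs t \<inter> K1) = 1" "card (ins t \<inter> K1) = 1" "card (outs s \<inter> K1) = 1" "card (ins s \<inter> K1) = 1"
    and c2: "card (outs t \<inter> K2) = 1" "card (ins t \<inter> K2) = 1" "card (outs s \<inter> K2) = 1" "card (ins s \<inter> K2) = 1"
  shows False
proof -
  obtain p where p: "distinct p" "p \<noteq> []" "set p = K1" "A \<inter> K1 \<times> K1 = sym_arcs p"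
    "outs t \<inter> K1 = {hd p}" "ins t \<inter> K1 = {hd p}" "outs s \<inter> K1 = {last p}" "ins s \<inter> K1 = {last p}"
    using path_between_exceptional[OF K(1) c1] by blast
  obtain q where q: "distinct q" "q \<noteq> []" "set q = K2" "A \<inter> K2 \<times> K2 = sym_arcs q"
    "outs t \<inter> K2 = {hd q}" "ins t \<inter> K2 = {hd q}" "outs s \<inter> K2 = {last q}" "ins s \<inter> K2 = {last q}"
    using path_between_exceptional[OF K(2) c2] by blast
  have tt: "A \<inter> {s, t} \<times> {s, t} = {(s, t)}" using ts loopfree by blast
  have A1: "A = {(s, t)} \<union> sym_arcs p \<union> sym_arcs q
      \<union> {(t, hd p), (hd p, t), (last p, s), (s, last p)} \<union> {(t, hd q), (hd q, t), (last q, s), (s, last q)}"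
  proof -
    have "A = sym_arcs p \<union> sym_arcs q \<union> {(s, t)} \<union> {t} \<times> {hd p} \<union> {t} \<times> {hd q} \<union> {s} \<times> {last p}
        \<union> {s} \<times> {last q} \<union> {hd p} \<times> {t} \<union> {hd q} \<times> {t} \<union> {last p} \<times> {s} \<union> {last q} \<times> {s}"
      using A_split[OF K] unfolding p(4-8) q(4-8) tt .
    also have "\<dots> = {(s, t)} \<union> sym_arcs p \<union> sym_arcs q
      \<union> {(t, hd p), (hd p, t), (last p, s), (s, last p)} \<union> {(t, hd q), (hd q, t), (last q, s), (s, last q)}" by auto
    finally show ?thesis .
  qed
  define c where "c = (t # p) @ (s # rev q)"
  have stn: "s \<notin> K1" "t \<notin> K1" "s \<notin> K2" "t \<notin> K2" using K by auto
  have dc: "distinct c" using p q stn st(3) K(3) by (auto simp: c_def)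
  have sc: "sym_arcs c = sym_arcs p \<union> sym_arcs q \<union> {(t, hd p), (hd p, t), (last p, s), (s, last p)}
      \<union> {(last q, s), (s, last q)}"
    using p(2) q(2) unfolding c_def by (subst sym_arcs_append) (auto simp: sym_arcs_Cons hd_rev)
  have lc: "c \<noteq> []" "last c = hd q" "hd c = t" using q(2) by (auto simp: c_def last_rev)
  then have cyc: "sym_arcs (c @ [hd c]) = sym_arcs c \<union> {(hd q, t), (t, hd q)}"
    by (subst sym_arcs_append) auto
  have "sym_arcs (c @ [hd c]) \<subseteq> A" unfolding cyc sc A1 by blast
  moreover have "length c \<ge> 3" using p(2) q(2) by (cases p; cases q) (auto simp: c_def)
  ultimately have ev: "even (length c)" using no_odd_cycle[OF dc] by blast
  obtain f :: "'a \<Rightarrow> bool" where f: "f (hd c) = True" "\<forall>(u, w) \<in> sym_arcs c. f u \<noteq> f w"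
      "f (last c) = True \<longleftrightarrow> odd (length c)"
    using alternating_colouring[OF dc lc(1), of True] by blast
  have "f t" "\<not> f (hd q)" using f(1,3) ev lc by simp_all
  moreover have "A \<subseteq> sym_arcs c \<union> {(s, t), (hd q, t), (t, hd q)}" unfolding A1 sc by auto
  moreover have "f u \<noteq> f w" if "(u, w) \<in> sym_arcs c" for u w using f(2) that by blast
  ultimately have "mono_arcs A f \<subseteq> {(s, t)}" unfolding mono_arcs_def by blast
  then show False using acyclic_subset[OF acyclic_arc] st(3) not_colourable by metis
qed

lemma F_expansion_of_two_exceptional:
  assumes G: "pverts G = V" "parcs G = A"
  shows "F_expansion G"
proof -
  obtain K1 K2 where K: "comp K1" "comp K2" "K1 \<inter> K2 = {}" "W = K1 \<union> K2" using two_comps by blast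
  have V: "V = K1 \<union> K2 \<union> {s, t}" using K(4) st by blast
  have stn: "s \<notin> K1" "t \<notin> K1" "s \<notin> K2" "t \<notin> K2" using K by auto
  have split: "card X = card (X \<inter> K1) + card (X \<inter> K2) + card (X \<inter> {s, t})" if "X \<subseteq> V" for X
  proof -
    have fX: "finite X" using that finite_V finite_subset by blast
    have "card (X \<inter> K1 \<union> X \<inter> K2) = card (X \<inter> K1) + card (X \<inter> K2)"
      by (rule card_Un_disjoint) (use fX K(3) in auto)
    moreover have "card (X \<inter> K1 \<union> X \<inter> K2 \<union> X \<inter> {s, t}) = card (X \<inter> K1 \<union> X \<inter> K2) + card (X \<inter> {s, t})"
      by (rule card_Un_disjoint) (use fX stn in auto)
    moreover have "X \<inter> K1 \<union> X \<inter> K2 \<union> X \<inter> {s, t} = X" using that V by blast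
    ultimately show ?thesis by simp
  qed
  define ets where "ets = (if (t, s) \<in> A then 1 else 0 :: nat)"
  define est where "est = (if (s, t) \<in> A then 1 else 0 :: nat)"
  have "outs s \<inter> {s, t} = (if (s, t) \<in> A then {t} else {})" "ins s \<inter> {s, t} = (if (t, s) \<in> A then {t} else {})"
    "outs t \<inter> {s, t} = (if (t, s) \<in> A then {s} else {})" "ins t \<inter> {s, t} = (if (s, t) \<in> A then {s} else {})"
    using loopfree by (auto simp: outs_def ins_def)
  then have "card (outs s \<inter> {s, t}) = est" "card (ins s \<inter> {s, t}) = ets"
    "card (outs t \<inter> {s, t}) = ets" "card (ins t \<inter> {s, t}) = est"
    by (simp_all add: est_def ets_def)
  then have sums:
    "card (outs s \<inter> K1) + card (outs s \<inter> K2) + est = 3" "card (ins s \<inter> K1) + card (ins s \<inter> K2) + ets = 2"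
    "card (outs t \<inter> K1) + card (outs t \<inter> K2) + ets = 2" "card (ins t \<inter> K1) + card (ins t \<inter> K2) + est = 3"
    using split[OF outs_subset[of s]] split[OF ins_subset[of s]] split[OF outs_subset[of t]] split[OF ins_subset[of t]]
      s_deg t_deg by simp_all
  have b: "card (ins s \<inter> K) + card (ins t \<inter> K) \<ge> 2"
    "card (ins s \<inter> K) + card (ins t \<inter> K) = card (outs s \<inter> K) + card (outs t \<inter> K)" if "comp K" for K
    using comp_boundary[OF that] by linarith+
  have e01: "est = 0 \<or> est = 1" "ets = 0 \<or> ets = 1" by (auto simp: est_def ets_def)
  have t01: "card (outs t \<inter> K) \<ge> 1 \<longrightarrow> card (outs t \<inter> K) = 1 \<and> card (ins t \<inter> K) \<le> 1" if "comp K" for K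
    using comp_t[OF that] by blast
  note degree_distribution[OF sums b(1)[OF K(1)] b(1)[OF K(2)] b(2)[OF K(1)] b(2)[OF K(2)]
      t01[OF K(1)] t01[OF K(2)] e01]
  then consider
      "ets = 1" "est = 0" "card (outs t \<inter> K1) = 1" "card (ins t \<inter> K1) = 1" "card (outs s \<inter> K1) = 1"
      "card (ins s \<inter> K1) = 1" "card (outs t \<inter> K2) = 0" "card (ins t \<inter> K2) = 2" "card (outs s \<inter> K2) = 2"
      "card (ins s \<inter> K2) = 0"
    | "ets = 1" "est = 0" "card (outs t \<inter> K2) = 1" "card (ins t \<inter> K2) = 1" "card (outs s \<inter> K2) = 1"
      "card (ins s \<inter> K2) = 1" "card (outs t \<inter> K1) = 0" "card (ins t \<inter> K1) = 2" "card (outs s \<inter> K1) = 2"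
      "card (ins s \<inter> K1) = 0"
    | "ets = 0" "est = 1" "card (outs t \<inter> K1) = 1" "card (ins t \<inter> K1) = 1" "card (outs s \<inter> K1) = 1"
      "card (ins s \<inter> K1) = 1" "card (outs t \<inter> K2) = 1" "card (ins t \<inter> K2) = 1" "card (outs s \<inter> K2) = 1"
      "card (ins s \<inter> K2) = 1"
    by (elim disjE conjE)
  then show ?thesis
  proof cases
    case 1
    have "(t, s) \<in> A" "(s, t) \<notin> A" using 1(1,2) by (auto simp: ets_def est_def split: if_splits)
    then show ?thesis by (rule F_expansion_form[OF K _ _ 1(3-10) G])
  next
    case 2
    have "(t, s) \<in> A" "(s, t) \<notin> A" using 2(1,2) by (auto simp: ets_def est_def split: if_splits)
    moreover have "K2 \<inter> K1 = {}" "W = K2 \<union> K1" using K(3,4) by (auto simp: Un_commute)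
    ultimately show ?thesis using F_expansion_form[OF K(2,1) _ _ _ _ 2(3-10) G] by blast
  next
    case 3
    have "(s, t) \<in> A" "(t, s) \<notin> A" using 3(1,2) by (auto simp: ets_def est_def split: if_splits)
    from no_arc_s_t[OF K this 3(3-10)] show ?thesis ..
  qed
qed

end

lemma (in dicrit) few_arcs_form:
  assumes "card A \<le> 2 * card V + 1" and G: "pverts G = V" "parcs G = A"
  shows "extended_wheel G \<or> F_expansion G"
proof -
  have V: "V \<noteq> {}"
  proof
    assume "V = {}"
    then have "mono_arcs A f = {}" for f using A_subset by (auto simp: mono_arcs_def)
    then show False using not_colourable[of "\<lambda>_. True"] by simp
  qed
  have outs: "(\<forall>v \<in> V. card (outs v) = 2) \<and> card A = 2 * card V \<or>
    (\<exists>s \<in> V. card (outs s) = 3 \<and> (\<forall>v \<in> V - {s}. card (outs v) = 2)) \<and> card A = 2 * card V + 1"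
    using exactly_one_excess[of V "\<lambda>v. card (outs v)"] finite_V two_outs_ge assms(1) by (simp add: sum_degrees)
  have ins: "(\<forall>v \<in> V. card (ins v) = 2) \<and> card A = 2 * card V \<or>
    (\<exists>s \<in> V. card (ins s) = 3 \<and> (\<forall>v \<in> V - {s}. card (ins v) = 2)) \<and> card A = 2 * card V + 1"
    using exactly_one_excess[of V "\<lambda>v. card (ins v)"] finite_V two_ins_ge assms(1) by (simp add: sum_degrees)
  show ?thesis
  proof (cases "card A = 2 * card V")
    case True
    then have d: "\<forall>v\<in>V. card (outs v) = 2" "\<forall>v\<in>V. card (ins v) = 2" using outs ins by auto
    obtain x where x: "x \<in> V" using V by blast
    interpret one_exceptional V A x
      by unfold_locales (use x d in \<open>auto simp: low_def\<close>)
    from card_ins_x_neq_2 d x show ?thesis by blast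
  next
    case False
    then obtain s t where s: "s \<in> V" "card (outs s) = 3" "\<forall>v\<in>V - {s}. card (outs v) = 2"
      and t: "t \<in> V" "card (ins t) = 3" "\<forall>v\<in>V - {t}. card (ins v) = 2" using outs ins by metis
    show ?thesis
    proof (cases "s = t")
      case True
      interpret one_exceptional V A s
        by unfold_locales (use s t True in \<open>auto simp: low_def\<close>)
      show ?thesis using extended_wheel_form[OF _ G] t True by blast
    next
      case False
      interpret two_exceptional V A s t
        by unfold_locales (use s t False in \<open>auto simp: low_def\<close>)
      show ?thesis using F_expansion_of_two_exceptional[OF G] by blast
    qed
  qed
qed

section \<open>From dicritical digraphs to arc sets\<close>

lemma subgraph_pairI:
  assumes "pair_wf_digraph G" "pair_wf_digraph H" "pverts H \<subseteq> pverts G" "parcs H \<subseteq> parcs G"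
  shows "subgraph (with_proj H) (with_proj G)"
  using assms by (simp add: subgraph_def wf_digraph_wp_iff compatible_def)

lemma ex_sym_arc:
  assumes "u \<in> set p" "length p \<ge> 2"
  shows "\<exists>w. (u, w) \<in> sym_arcs p"
proof -
  obtain as bs where p: "p = as @ u # bs" using assms(1) by (metis split_list)
  show ?thesis
  proof (cases "bs = []")
    case True
    then have "as \<noteq> []" using assms(2) p by auto
    then show ?thesis unfolding p by (auto simp: sym_arcs_append)
  next
    case False
    then have "(u, hd bs) \<in> sym_arcs (u # bs)" by (simp add: sym_arcs_Cons)
    then show ?thesis unfolding p by (cases "as = []") (auto simp: sym_arcs_append)
  qed
qed

text \<open>An odd symmetric cycle in \<open>G\<close> is a subdigraph without a colouring, so by
  criticality it would be all of \<open>G\<close>, which is excluded.\<close>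

lemma three_dicritical_dicrit:
  assumes "pair_digraph G" and crit: "three_dicritical G" and "\<not> symmetric_odd_cycle G"
  shows "dicrit (pverts G) (parcs G)"
proof -
  interpret pair_digraph G by fact
  have wf: "pair_wf_digraph G" by unfold_locales
  have sub: "\<exists>f. acyclic (mono_arcs (parcs H) f)"
    if "pair_wf_digraph H" "pverts H \<subseteq> pverts G" "parcs H \<subseteq> parcs G" "H \<noteq> G" for H
    using crit subgraph_pairI[OF wf that(1-3)] that(4) two_dicolourable_iff[OF that(1)]
    unfolding three_dicritical_def by blast
  show ?thesis
  proof
    show "finite (pverts G)" by (rule pair_finite_verts)
    show "parcs G \<subseteq> pverts G \<times> pverts G" using wellformed' by auto
    show "(v, v) \<notin> parcs G" for v using no_loops' by blast
    show "\<not> acyclic (mono_arcs (parcs G) f)" for f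
      using crit two_dicolourable_iff[OF wf] unfolding three_dicritical_def by blast
  next
    fix v assume v: "v \<in> pverts G"
    let ?H = "\<lparr>pverts = pverts G - {v}, parcs = parcs G \<inter> (- {v}) \<times> (- {v})\<rparr>"
    have "pair_wf_digraph ?H" by unfold_locales (auto dest: in_arcsD1 in_arcsD2)
    moreover have "?H \<noteq> G" using v by (metis Diff_iff pair_pre_digraph.select_convs(1) singletonI)
    ultimately show "\<exists>f. acyclic (mono_arcs (parcs G \<inter> (- {v}) \<times> (- {v})) f)"
      using sub[of ?H] by auto
  next
    fix c :: "'a list" assume c: "distinct c" "length c \<ge> 3" "odd (length c)"
    show "\<not> sym_arcs (c @ [hd c]) \<subseteq> parcs G"
    proof
      assume arcs: "sym_arcs (c @ [hd c]) \<subseteq> parcs G"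
      let ?H = "\<lparr>pverts = set c, parcs = sym_arcs (c @ [hd c])\<rparr>"
      have ne: "c \<noteq> []" using c(2) by auto
      then have "set (c @ [hd c]) = set c" by auto
      then have in_c: "u \<in> set c \<and> w \<in> set c" if "(u, w) \<in> sym_arcs (c @ [hd c])" for u w
        using sym_arcs_in_set[OF that] by simp
      then have "pair_wf_digraph ?H" by unfold_locales auto
      moreover have "set c \<subseteq> pverts G"
      proof
        fix u assume "u \<in> set c"
        then obtain w where "(u, w) \<in> sym_arcs (c @ [hd c])" using ex_sym_arc[of u "c @ [hd c]"] c(2) by auto
        then show "u \<in> pverts G" using arcs in_arcsD1 by blast
      qed
      moreover have "?H \<noteq> G"
        using c assms(3) unfolding symmetric_odd_cycle_def
        by (metis pair_pre_digraph.select_convs(1,2))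
      ultimately obtain f where "acyclic (mono_arcs (sym_arcs (c @ [hd c])) f)"
        using sub[of ?H] arcs by auto
      then show False using odd_cycle_not_colourable[OF ne c(3)] by blast
    qed
  qed
qed

section \<open>Counting arcs\<close>

lemma path_betweenD:
  assumes "path_between x P a"
  shows "P \<noteq> []" "hd P = x" "last P = a" "distinct P" "x \<in> set P" "a \<in> set P"
  using assms by (auto simp: path_between_def)

lemma sym_arcs_disjoint:
  assumes "distinct P" "set P \<inter> set Q \<subseteq> {z}"
  shows "sym_arcs P \<inter> sym_arcs Q = {}"
proof -
  have False if "(u, w) \<in> sym_arcs P" "(u, w) \<in> sym_arcs Q" for u w
    using sym_arcs_in_set[OF that(1)] sym_arcs_in_set[OF that(2)] assms(2) sym_arcs_neq[OF assms(1) that(1)]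
    by blast
  then show ?thesis by auto
qed

text \<open>This guards the arc count against rim arcs hidden in spokes. Such an overlap forces
  \<open>b = x\<close>, so the spoke to \<open>b\<close> has length 0, while the spoke to
  \<open>a\<close> has length 1, against equal parity.\<close>

lemma rim_arc_not_sym:
  assumes P: "path_between x P a" and Q: "path_between x Q b" and PQ: "set P \<inter> set Q = {x}"
    and par: "even (vwalk_length P) = even (vwalk_length Q)" and "a \<noteq> b"
  shows "(a, b) \<notin> sym_arcs P" "(b, a) \<notin> sym_arcs P"
proof -
  show ab: "(a, b) \<notin> sym_arcs P"
  proof
    assume ab: "(a, b) \<in> sym_arcs P"
    then have "b = x" using sym_arcs_in_set[OF ab] path_betweenD[OF Q] PQ by blast
    then have "Q = [x]" using singleton_if_hd_eq_last[of Q] path_betweenD[OF Q] by simp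
    then have ev: "even (vwalk_length P)" using par by simp
    have "(hd P, a) \<in> sym_arcs P" using ab sym_arcs_sym[of a b P] \<open>b = x\<close> path_betweenD(2)[OF P] by simp
    then have "a = hd (tl P)" by (rule hd_sym_arcs[OF path_betweenD(4)[OF P]])
    have "tl P \<noteq> []" using \<open>(hd P, a) \<in> sym_arcs P\<close> by (cases P; cases "tl P") auto
    then have "tl P = [a]"
      using singleton_if_hd_eq_last[of "tl P"] \<open>a = hd (tl P)\<close> path_betweenD[OF P]
      by (simp add: distinct_tl last_tl)
    then have "length P = 2" by (cases P) auto
    then show False using ev by simp
  qed
  then show "(b, a) \<notin> sym_arcs P" by (simp add: sym_arcs_sym[of b a])
qed

text \<open>With N the sum of the three list lengths, there are 3 + 2(N - 3) arcs. The hub is listed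
  three times, so N is the number of vertices plus 2.\<close>

lemma card_extended_wheel:
  assumes "extended_wheel G"
  shows "card (parcs G) = 2 * card (pverts G) + 1"
proof -
  obtain x a b c P Q R where d: "distinct [a, b, c]"
    and p: "path_between x P a" "path_between x Q b" "path_between x R c"
    and i: "set P \<inter> set Q = {x}" "set P \<inter> set R = {x}" "set Q \<inter> set R = {x}"
    and par: "even (vwalk_length P) = even (vwalk_length Q)" "even (vwalk_length Q) = even (vwalk_length R)"
    and G: "pverts G = set P \<union> set Q \<union> set R"
      "parcs G = {(a, b), (b, c), (c, a)} \<union> sym_arcs P \<union> sym_arcs Q \<union> sym_arcs R"
    using assms unfolding extended_wheel_def by blast
  note P = path_betweenD[OF p(1)] and Q = path_betweenD[OF p(2)] and R = path_betweenD[OF p(3)]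
  have i': "set Q \<inter> set P = {x}" "set R \<inter> set P = {x}" "set R \<inter> set Q = {x}" using i by blast+
  have ne: "a \<noteq> b" "b \<noteq> c" "c \<noteq> a" "b \<noteq> a" "c \<noteq> b" "a \<noteq> c" using d by auto
  have ps: "even (vwalk_length Q) = even (vwalk_length P)" "even (vwalk_length R) = even (vwalk_length Q)"
    "even (vwalk_length P) = even (vwalk_length R)" "even (vwalk_length R) = even (vwalk_length P)" using par by simp_all
  \<comment> \<open>For the rim arc opposite to a spoke: each of its ends could lie on that spoke
    only by being \<open>x\<close>.\<close>
  have third: "(u, w) \<notin> sym_arcs Z"
    if "u \<in> X" "w \<in> Y" "u \<noteq> w" "X \<inter> set Z = {x}" "Y \<inter> set Z = {x}" for u w X Y Z
  proof
    assume *: "(u, w) \<in> sym_arcs Z"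
    have "u \<in> X \<inter> set Z" "w \<in> Y \<inter> set Z" using that(1,2) sym_arcs_in_set[OF *] by simp_all
    then show False using that(3) unfolding that(4,5) by simp
  qed
  have rim: "{(a, b), (b, c), (c, a)} \<inter> sym_arcs P = {}" "{(a, b), (b, c), (c, a)} \<inter> sym_arcs Q = {}"
    "{(a, b), (b, c), (c, a)} \<inter> sym_arcs R = {}"
    using rim_arc_not_sym(1)[OF p(1,2) i(1) par(1) ne(1)] rim_arc_not_sym(2)[OF p(1,3) i(2) ps(3) ne(6)]
      third[OF Q(6) R(6) ne(2) i'(1,2)]
      rim_arc_not_sym(2)[OF p(2,1) i'(1) ps(1) ne(4)] rim_arc_not_sym(1)[OF p(2,3) i(3) par(2) ne(2)]
      third[OF R(6) P(6) ne(3) i'(3) i(1)]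
      rim_arc_not_sym(1)[OF p(3,1) i'(2) ps(4) ne(3)] rim_arc_not_sym(2)[OF p(3,2) i'(3) ps(2) ne(5)]
      third[OF P(6) Q(6) ne(1) i(2,3)]
    by auto
  have dj: "sym_arcs P \<inter> sym_arcs Q = {}" "sym_arcs P \<inter> sym_arcs R = {}" "sym_arcs Q \<inter> sym_arcs R = {}"
    using sym_arcs_disjoint[OF P(4), of Q x] sym_arcs_disjoint[OF P(4), of R x] sym_arcs_disjoint[OF Q(4), of R x] i
    by auto
  have "card (parcs G) = card ({(a, b), (b, c), (c, a)} \<union> sym_arcs P \<union> sym_arcs Q) + card (sym_arcs R)"
    unfolding G by (rule card_Un_disjoint) (use rim dj in auto)
  also have "card ({(a, b), (b, c), (c, a)} \<union> sym_arcs P \<union> sym_arcs Q) =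
      card ({(a, b), (b, c), (c, a)} \<union> sym_arcs P) + card (sym_arcs Q)"
    by (rule card_Un_disjoint) (use rim dj in auto)
  also have "card ({(a, b), (b, c), (c, a)} \<union> sym_arcs P) = card {(a, b), (b, c), (c, a)} + card (sym_arcs P)"
    by (rule card_Un_disjoint) (use rim in auto)
  also have "card {(a, b), (b, c), (c, a)} = 3" using ne by simp
  finally have cA: "card (parcs G) + 6 = 3 + 2 * length P + 2 * length Q + 2 * length R"
    using card_sym_arcs[OF P(4,1)] card_sym_arcs[OF Q(4,1)] card_sym_arcs[OF R(4,1)] by linarith
  have "card (set P \<union> set Q) + card (set P \<inter> set Q) = length P + length Q"
    using card_Un_Int[of "set P" "set Q"] P(4) Q(4) by (simp add: distinct_card)
  then have "card (set P \<union> set Q) + 1 = length P + length Q" using i(1) by simp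
  moreover have "card (set P \<union> set Q \<union> set R) + card ((set P \<union> set Q) \<inter> set R) = card (set P \<union> set Q) + length R"
    using card_Un_Int[of "set P \<union> set Q" "set R"] R(4) by (simp add: distinct_card)
  moreover have "(set P \<union> set Q) \<inter> set R = {x}" using i by blast
  ultimately have "card (pverts G) + 2 = length P + length Q + length R" using G(1) by simp
  then show ?thesis using cA by linarith
qed

text \<open>With N the sum of the three list lengths, there are 5 + 2(N - 3) arcs. Only
  \<open>z\<close> is listed twice, so N is the number of vertices plus 1.\<close>

lemma card_F_expansion:
  assumes "F_expansion G"
  shows "card (parcs G) = 2 * card (pverts G) + 1"
proof -
  obtain x y z u w P Q R where
    p: "path_between x P z" "path_between y Q z" "path_between u R w"
    and o: "odd (vwalk_length P)" "odd (vwalk_length Q)" "odd (vwalk_length R)"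
    and i: "set P \<inter> set Q = {z}" "set P \<inter> set R = {}" "set Q \<inter> set R = {}"
    and G: "pverts G = set P \<union> set Q \<union> set R"
      "parcs G = {(x, y), (y, w), (y, u), (w, x), (u, x)} \<union> sym_arcs P \<union> sym_arcs Q \<union> sym_arcs R"
    using assms unfolding F_expansion_def by (elim exE conjE) (rule that)
  note P = path_betweenD[OF p(1)] and Q = path_betweenD[OF p(2)] and R = path_betweenD[OF p(3)]
  have odd_ne: "a \<noteq> b" if "path_between a L b" "odd (vwalk_length L)" for a b L
  proof
    assume "a = b"
    then have "L = [hd L]" using singleton_if_hd_eq_last[of L] path_betweenD[OF that(1)] by simp
    then have "length L = 1" by (cases L) auto
    then show False using that(2) by simp
  qed
  have ends: "x \<noteq> z" "y \<noteq> z" "u \<noteq> w" using odd_ne[OF p(1) o(1)] odd_ne[OF p(2) o(2)] odd_ne[OF p(3) o(3)] .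
  have out: "x \<notin> set Q" "x \<notin> set R" "y \<notin> set P" "y \<notin> set R" "u \<notin> set P" "u \<notin> set Q" "w \<notin> set P" "w \<notin> set Q"
    using ends P(5) Q(5) R(5,6) i by blast+
  let ?T = "{(x, y), (y, w), (y, u), (w, x), (u, x)}"
  have "x \<noteq> y" "x \<noteq> u" "x \<noteq> w" "y \<noteq> u" "y \<noteq> w" using out P(5) Q(5) by blast+
  then have T: "card ?T = 5" using ends by simp
  have rim: "?T \<inter> sym_arcs P = {}" "?T \<inter> sym_arcs Q = {}" "?T \<inter> sym_arcs R = {}"
    using out by (auto dest: sym_arcs_in_set)
  have dj: "sym_arcs P \<inter> sym_arcs Q = {}" "sym_arcs P \<inter> sym_arcs R = {}" "sym_arcs Q \<inter> sym_arcs R = {}"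
    using sym_arcs_disjoint[OF P(4), of Q z] sym_arcs_disjoint[OF P(4), of R z] sym_arcs_disjoint[OF Q(4), of R z] i
    by auto
  have "card (parcs G) = card (?T \<union> sym_arcs P \<union> sym_arcs Q) + card (sym_arcs R)"
    unfolding G by (rule card_Un_disjoint) (use rim dj in auto)
  also have "card (?T \<union> sym_arcs P \<union> sym_arcs Q) = card (?T \<union> sym_arcs P) + card (sym_arcs Q)"
    by (rule card_Un_disjoint) (use rim dj in auto)
  also have "card (?T \<union> sym_arcs P) = card ?T + card (sym_arcs P)"
    by (rule card_Un_disjoint) (use rim in auto)
  finally have cA: "card (parcs G) + 6 = 5 + 2 * length P + 2 * length Q + 2 * length R"
    using card_sym_arcs[OF P(4,1)] card_sym_arcs[OF Q(4,1)] card_sym_arcs[OF R(4,1)] T by linarith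
  have "card (set P \<union> set Q) + card (set P \<inter> set Q) = length P + length Q"
    using card_Un_Int[of "set P" "set Q"] P(4) Q(4) by (simp add: distinct_card)
  then have "card (set P \<union> set Q) + 1 = length P + length Q" using i(1) by simp
  moreover have "(set P \<union> set Q) \<inter> set R = {}" using i by blast
  then have "card (set P \<union> set Q \<union> set R) = card (set P \<union> set Q) + length R"
    using R(4) by (simp add: card_Un_disjoint distinct_card)
  ultimately have "card (pverts G) + 1 = length P + length Q + length R" using G(1) by simp
  then show ?thesis using cA by linarith
qed

theorem theorem1p7:
  fixes G :: "'a pair_pre_digraph"
  assumes "pair_digraph G"
    and "three_dicritical G"
    and "\<not> symmetric_odd_cycle G"
  shows "(card (parcs G) = 2 * card (pverts G) + 1 \<longleftrightarrow> G \<in> D3') \<and>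
         (G \<notin> D3' \<longrightarrow> card (parcs G) \<ge> 2 * card (pverts G) + 2)"
proof -
  interpret dicrit "pverts G" "parcs G" using three_dicritical_dicrit[OF assms] .
  have "G \<in> D3'" if "card (parcs G) \<le> 2 * card (pverts G) + 1"
    using few_arcs_form[OF that] by (simp add: D3'_def)
  moreover have "card (parcs G) = 2 * card (pverts G) + 1" if "G \<in> D3'"
    using that card_extended_wheel card_F_expansion by (auto simp: D3'_def)
  ultimately show ?thesis by linarith
qed

end
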